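(* Let $\Omega_1\subset\mathbb{R}^{N_1}$ and $\Omega_2\subset\mathbb{R}^{N_2}$ be regions satisfying (B1) and (B2), let $b_2$ satisfy (B3) on $\partial\Omega_2$, and let $\Omega_p:=\Omega_1\times\Omega_2$ and $V:=H_0^1(\Omega_1)\otimes H^1(\Omega_2)$. Let $\{\lambda_{1j}\}_{j\in\mathbb{N}}$, $\{e_{1j}\}_{j\in\mathbb{N}}$ be the Dirichlet Laplacian eigenvalues and eigenfunctions on $\Omega_1$, let $\{\lambda_{2k}\}_{k\in\mathbb{N}}$, $\{g_{2k}\}_{k\in\mathbb{N}}$ be the Robin Laplacian eigenvalues and eigenfunctions on $\Omega_2$ with weight $b_2$, and put $u_{jk}:=e_{1j}\otimes g_{2k}$, $\mathcal{U}:=\{u_{jk}:j,k\in\mathbb{N}\}$. Then each $u_{jk}\in\mathcal{U}$ is a Dirichlet–Robin Laplacian (DRL) eigenfunction on $\Omega_p$ corresponding to the eigenvalue $\lambda_{1j}+\lambda_{2k}$. Moreover $\mathcal{U}$ is an orthogonal family in $V$ with respect to the inner product $$[u,v]_{b2}:=\int_{\Omega_p}\nabla u\cdot\nabla v\,dx\,dy+\int_{\Omega_1}\int_{\partial\Omega_2}b_2(y)\,u\,v\,d\sigma_2\,dx$$ and is an orthogonal family in $L^2(\Omega_p)$.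
   Context: A region is a nonempty, connected, open subset of $\mathbb{R}^N$. All function spaces are real; $\sigma$ denotes $(N-1)$-dimensional Hausdorff measure on a boundary ($\sigma_2$ the one on $\partial\Omega_2$), and in boundary integrals functions are replaced by their traces. Condition (B1) on a region $\Omega\subset\mathbb{R}^N$: $\Omega$ is bounded and its boundary $\partial\Omega:=\overline{\Omega}\setminus\Omega$ is the union of a finite number of disjoint closed Lipschitz surfaces, each having finite surface area. Condition (B2): $\Omega$ satisfies (B1); the imbedding of $H^1(\Omega)$ into $L^p(\Omega)$ is compact for $1\le p<p_s$, where $p_s=2N/(N-2)$ if $N\ge3$ and $p_s=\infty$ if $N=2$ (Rellich theorem); and the trace map $\gamma:H^1(\Omega)\to L^2(\partial\Omega,d\sigma)$ is compact ($L^2$-compact trace theorem). Condition (B3) on $b:\partial\Omega\to(0,\infty)$: $b$ is Borel measurable, $b\in L^\infty(\partial\Omega,d\sigma)$ and $b\ge b_0>0$ $\sigma$-a.e. for some constant $b_0$. Tensor products: $(e\otimes f)(x,y):=e(x)f(y)$. For real separable Hilbert spaces $H_1\subset L^2(\Omega_1)$, $H_2\subset L^2(\Omega_2)$ with orthonormal bases $\{e_j\}$, $\{f_k\}$, the Hilbert tensor product $H_1\otimes H_2$ is the completion of the space of finite linear combinations $\sum\hat g_{jk}\,e_j\otimes f_k$ under $\langle g,h\rangle_\otimes:=\sum_{j,k}\hat g_{jk}\hat h_{jk}$; its elements are the functions $g(x,y)=\sum_{j,k}\hat g_{jk}e_j(x)f_k(y)$ with $\sum_{j,k}\hat g_{jk}^2<\infty$.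 In $V$, $H_0^1(\Omega_1)$ carries the inner product $\int_{\Omega_1}\nabla u\cdot\nabla v\,dx$ and $H^1(\Omega_2)$ its standard inner product (or any equivalent one; $V$ is the same set of functions). Dirichlet eigendata on $\Omega_1$: pairs $(\lambda_{1j},e_{1j})$ with $e_{1j}\in H_0^1(\Omega_1)$, $\int_{\Omega_1}\nabla e_{1j}\cdot\nabla h\,dx=\lambda_{1j}\int_{\Omega_1}e_{1j}h\,dx$ for all $h\in H_0^1(\Omega_1)$; the $\lambda_{1j}>0$ are all the eigenvalues repeated according to multiplicity, $\lambda_{1j}\to\infty$, $\{e_{1j}\}$ is an orthonormal basis of $L^2(\Omega_1)$ and $\{\lambda_{1j}^{-1/2}e_{1j}\}$ an orthonormal basis of $H_0^1(\Omega_1)$. Robin eigendata on $\Omega_2$ with weight $b_2$: with $[u,v]_b:=\int_{\Omega_2}\nabla u\cdot\nabla v\,dy+\int_{\partial\Omega_2}b_2uv\,d\sigma_2$, pairs $(\lambda_{2k},g_{2k})$ with $g_{2k}\in H^1(\Omega_2)$, $[g_{2k},h]_b=\lambda_{2k}\int_{\Omega_2}g_{2k}h\,dy$ for all $h\in H^1(\Omega_2)$; the $\lambda_{2k}>0$ are all the eigenvalues repeated according to multiplicity, increasing to $\infty$, and $\{g_{2k}\}$ is a maximal $[\cdot,\cdot]_b$-orthonormal set in $H^1(\Omega_2)$, so that $\int_{\Omega_2}g_{2j}g_{2k}\,dy=\delta_{jk}/\lambda_{2k}$. DRL eigenproblem on $\Omega_p$: find $(\lambda,u)\in\mathbb{R}\times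 V$, $u\neq0$, with $[u,h]_{b2}=\lambda\int_{\Omega_p}u\,h\,dx\,dy$ for all $h\in V$. *)

theory Defs
  imports "HOL-Analysis.Analysis"
begin

text \<open>
  R^N is an arbitrary Euclidean space \<^typ>\<open>'a::euclidean_space\<close> with N = DIM('a).
  Elements of function spaces are represented by Borel functions, and equality in such a
  space is equality almost everywhere.
\<close>

abbreviation vol :: "'a::euclidean_space set \<Rightarrow> 'a measure" where
  "vol \<Omega> \<equiv> restrict_space lborel \<Omega>"


text \<open>The factor \<^term>\<open>unit_ball_vol m / 2 ^ m\<close> normalises m-dimensional Hausdorff
  measure so that it is surface area on smooth m-dimensional surfaces.  The empty set is
  treated separately because \<^term>\<open>(0::real) ^ 0 = 1\<close>.\<close>

definition hausdorff_weight :: "nat \<Rightarrow> 'a::metric_space set \<Rightarrow> ennreal" where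
  "hausdorff_weight m C =
     (if C = {} then 0 else ennreal (unit_ball_vol (real m) * (diameter C / 2) ^ m))"

definition hausdorff_pre :: "nat \<Rightarrow> real \<Rightarrow> 'a::metric_space set \<Rightarrow> ennreal" where
  "hausdorff_pre m \<delta> A =
     (INF C \<in> {C :: nat \<Rightarrow> 'a set. A \<subseteq> (\<Union>i. C i) \<and> (\<forall>i. bounded (C i) \<and> diameter (C i) \<le> \<delta>)}.
        (\<Sum>i. hausdorff_weight m (C i)))"

definition hausdorff_outer :: "nat \<Rightarrow> 'a::metric_space set \<Rightarrow> ennreal" where
  "hausdorff_outer m A = (SUP \<delta> \<in> {0<..}. hausdorff_pre m \<delta> A)"

text \<open>\<^const>\<open>hausdorff_outer\<close> is a metric outer measure, hence countably additive on the
  Borel sets, so \<^const>\<open>measure_of\<close> does not take its default value here.\<close>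

definition hausdorff_measure :: "nat \<Rightarrow> 'a::metric_space measure" where
  "hausdorff_measure m = measure_of UNIV (sets borel) (hausdorff_outer m)"

text \<open>For open \<^term>\<open>\<Omega>\<close>, \<^term>\<open>frontier \<Omega>\<close> is \<^term>\<open>closure \<Omega> - \<Omega>\<close>.\<close>

definition surf :: "'a::euclidean_space set \<Rightarrow> 'a measure" where
  "surf \<Omega> = restrict_space (hausdorff_measure (DIM('a) - 1)) (frontier \<Omega>)"


definition ip_tendsto ::
  "(('a \<Rightarrow> real) \<Rightarrow> ('a \<Rightarrow> real) \<Rightarrow> real) \<Rightarrow> (nat \<Rightarrow> 'a \<Rightarrow> real) \<Rightarrow> ('a \<Rightarrow> real) \<Rightarrow> bool" where
  "ip_tendsto ip s u \<longleftrightarrow>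
     (\<lambda>n. ip (\<lambda>x. s n x - u x) (\<lambda>x. s n x - u x)) \<longlonglongrightarrow> 0"

definition orthonormal_family ::
  "('a \<Rightarrow> real) set \<Rightarrow> (('a \<Rightarrow> real) \<Rightarrow> ('a \<Rightarrow> real) \<Rightarrow> real) \<Rightarrow> (nat \<Rightarrow> 'a \<Rightarrow> real) \<Rightarrow> bool" where
  "orthonormal_family H ip e \<longleftrightarrow>
     (\<forall>n. e n \<in> H) \<and> (\<forall>m n. ip (e m) (e n) = (if m = n then 1 else 0))"

definition orthonormal_basis ::
  "('a \<Rightarrow> real) set \<Rightarrow> (('a \<Rightarrow> real) \<Rightarrow> ('a \<Rightarrow> real) \<Rightarrow> real) \<Rightarrow> (nat \<Rightarrow> 'a \<Rightarrow> real) \<Rightarrow> bool" where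
  "orthonormal_basis H ip e \<longleftrightarrow>
     orthonormal_family H ip e \<and>
     (\<forall>u\<in>H. ip_tendsto ip (\<lambda>n x. \<Sum>i<n. ip u (e i) * e i x) u)"

definition orthogonal_family ::
  "('a \<Rightarrow> real) set \<Rightarrow> (('a \<Rightarrow> real) \<Rightarrow> ('a \<Rightarrow> real) \<Rightarrow> real) \<Rightarrow> ('i \<Rightarrow> 'a \<Rightarrow> real) \<Rightarrow> bool" where
  "orthogonal_family H ip u \<longleftrightarrow>
     (\<forall>i. u i \<in> H) \<and> (\<forall>i j. i \<noteq> j \<longrightarrow> ip (u i) (u j) = 0)"


definition Lp :: "'a measure \<Rightarrow> real \<Rightarrow> ('a \<Rightarrow> real) set" where
  "Lp M p = {u \<in> borel_measurable M. integrable M (\<lambda>x. \<bar>u x\<bar> powr p)}"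

definition L2 :: "'a measure \<Rightarrow> ('a \<Rightarrow> real) set" where
  "L2 M = {u \<in> borel_measurable M. integrable M (\<lambda>x. (u x)\<^sup>2)}"

definition l2_ip :: "'a measure \<Rightarrow> ('a \<Rightarrow> real) \<Rightarrow> ('a \<Rightarrow> real) \<Rightarrow> real" where
  "l2_ip M u v = (LINT x|M. u x * v x)"

fun Ck :: "nat \<Rightarrow> ('a::euclidean_space \<Rightarrow> real) \<Rightarrow> bool" where
  "Ck 0 f = continuous_on UNIV f"
| "Ck (Suc k) f = ((\<forall>x. f differentiable at x) \<and>
     (\<forall>i\<in>Basis. Ck k (\<lambda>x. frechet_derivative f (at x) i)))"

text \<open>Functions in $C_c^\infty(\Omega)$, extended by zero to the whole space.\<close>

definition test_fun :: "'a::euclidean_space set \<Rightarrow> ('a \<Rightarrow> real) \<Rightarrow> bool" where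
  "test_fun \<Omega> \<phi> \<longleftrightarrow> (\<forall>k. Ck k \<phi>) \<and>
     compact (closure {x. \<phi> x \<noteq> 0}) \<and> closure {x. \<phi> x \<noteq> 0} \<subseteq> \<Omega>"

definition has_weak_gradient ::
  "'a::euclidean_space set \<Rightarrow> ('a \<Rightarrow> real) \<Rightarrow> ('a \<Rightarrow> 'a) \<Rightarrow> bool" where
  "has_weak_gradient \<Omega> u G \<longleftrightarrow>
     G \<in> borel_measurable (vol \<Omega>) \<and> integrable (vol \<Omega>) (\<lambda>x. (norm (G x))\<^sup>2) \<and>
     (\<forall>\<phi>. test_fun \<Omega> \<phi> \<longrightarrow> (\<forall>i\<in>Basis.
        (LINT x|vol \<Omega>. u x * frechet_derivative \<phi> (at x) i) =
          - (LINT x|vol \<Omega>. (G x \<bullet> i) * \<phi> x)))"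

definition wgrad :: "'a::euclidean_space set \<Rightarrow> ('a \<Rightarrow> real) \<Rightarrow> 'a \<Rightarrow> 'a" where
  "wgrad \<Omega> u = (SOME G. has_weak_gradient \<Omega> u G)"

definition H1 :: "'a::euclidean_space set \<Rightarrow> ('a \<Rightarrow> real) set" where
  "H1 \<Omega> = {u \<in> L2 (vol \<Omega>). \<exists>G. has_weak_gradient \<Omega> u G}"

definition grad_ip :: "'a::euclidean_space set \<Rightarrow> ('a \<Rightarrow> real) \<Rightarrow> ('a \<Rightarrow> real) \<Rightarrow> real" where
  "grad_ip \<Omega> u v = (LINT x|vol \<Omega>. wgrad \<Omega> u x \<bullet> wgrad \<Omega> v x)"

definition h1_ip :: "'a::euclidean_space set \<Rightarrow> ('a \<Rightarrow> real) \<Rightarrow> ('a \<Rightarrow> real) \<Rightarrow> real" where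
  "h1_ip \<Omega> u v = l2_ip (vol \<Omega>) u v + grad_ip \<Omega> u v"

definition H10 :: "'a::euclidean_space set \<Rightarrow> ('a \<Rightarrow> real) set" where
  "H10 \<Omega> = {u \<in> H1 \<Omega>. \<exists>\<phi>. (\<forall>n. test_fun \<Omega> (\<phi> n)) \<and> ip_tendsto (h1_ip \<Omega>) \<phi> u}"


text \<open>The trace map is the closure, from $H^1(\Omega)$ to $L^2(\partial\Omega,\sigma)$, of the
  restriction map on functions that are Lipschitz continuous on the closed region.\<close>

definition has_trace ::
  "'a::euclidean_space set \<Rightarrow> ('a \<Rightarrow> real) \<Rightarrow> ('a \<Rightarrow> real) \<Rightarrow> bool" where
  "has_trace \<Omega> u t \<longleftrightarrow> u \<in> H1 \<Omega> \<and> t \<in> L2 (surf \<Omega>) \<and>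
     (\<exists>\<phi>. (\<forall>n. \<phi> n \<in> H1 \<Omega> \<and> \<phi> n \<in> L2 (surf \<Omega>) \<and> (\<exists>L. L-lipschitz_on (closure \<Omega>) (\<phi> n))) \<and>
        ip_tendsto (h1_ip \<Omega>) \<phi> u \<and> ip_tendsto (l2_ip (surf \<Omega>)) \<phi> t)"

definition bdry_trace :: "'a::euclidean_space set \<Rightarrow> ('a \<Rightarrow> real) \<Rightarrow> 'a \<Rightarrow> real" where
  "bdry_trace \<Omega> u = (SOME t. has_trace \<Omega> u t)"


definition region :: "'a::euclidean_space set \<Rightarrow> bool" where
  "region \<Omega> \<longleftrightarrow> \<Omega> \<noteq> {} \<and> connected \<Omega> \<and> open \<Omega>"

text \<open>A compact connected set that is, near each of its points, the graph of a Lipschitz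
  function over the hyperplane orthogonal to some unit vector \<open>\<nu>\<close>.\<close>

definition closed_lipschitz_surface :: "'a::euclidean_space set \<Rightarrow> bool" where
  "closed_lipschitz_surface S \<longleftrightarrow> compact S \<and> connected S \<and>
     (\<forall>p\<in>S. \<exists>\<nu> r L. \<exists>\<psi> :: 'a \<Rightarrow> real. norm \<nu> = 1 \<and> r > 0 \<and> L-lipschitz_on UNIV \<psi> \<and>
        S \<inter> ball p r = {x \<in> ball p r. x \<bullet> \<nu> = \<psi> (x - (x \<bullet> \<nu>) *\<^sub>R \<nu>)})"

definition cond_B1 :: "'a::euclidean_space set \<Rightarrow> bool" where
  "cond_B1 \<Omega> \<longleftrightarrow> bounded \<Omega> \<and>
     (\<exists>F. finite F \<and> disjoint F \<and> \<Union>F = frontier \<Omega> \<and>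
        (\<forall>S\<in>F. closed_lipschitz_surface S \<and>
           emeasure (hausdorff_measure (DIM('a) - 1)) S < \<infinity>))"

text \<open>For \<^term>\<open>DIM('a::euclidean_space) \<le> 2\<close> there is no upper bound on \<^term>\<open>p\<close>.\<close>

definition compact_imbedding :: "'a::euclidean_space set \<Rightarrow> bool" where
  "compact_imbedding \<Omega> \<longleftrightarrow>
     (\<forall>p::real. 1 \<le> p \<and> (DIM('a) \<ge> 3 \<longrightarrow> p < 2 * real DIM('a) / (real DIM('a) - 2)) \<longrightarrow>
        H1 \<Omega> \<subseteq> Lp (vol \<Omega>) p \<and>
        (\<forall>u C. (\<forall>n. u n \<in> H1 \<Omega> \<and> h1_ip \<Omega> (u n) (u n) \<le> C) \<longrightarrow>
           (\<exists>r w. strict_mono (r :: nat \<Rightarrow> nat) \<and> w \<in> Lp (vol \<Omega>) p \<and>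
              (\<lambda>n. LINT x|vol \<Omega>. \<bar>u (r n) x - w x\<bar> powr p) \<longlonglongrightarrow> 0)))"

text \<open>The first two conjuncts say that the trace map is a well-defined map
  $H^1(\Omega) \to L^2(\partial\Omega,\sigma)$, the third that it is compact.\<close>

definition compact_trace :: "'a::euclidean_space set \<Rightarrow> bool" where
  "compact_trace \<Omega> \<longleftrightarrow>
     (\<forall>u\<in>H1 \<Omega>. \<exists>t. has_trace \<Omega> u t) \<and>
     (\<forall>u s t. has_trace \<Omega> u s \<and> has_trace \<Omega> u t \<longrightarrow> (AE x in surf \<Omega>. s x = t x)) \<and>
     (\<forall>u C. (\<forall>n. u n \<in> H1 \<Omega> \<and> h1_ip \<Omega> (u n) (u n) \<le> C) \<longrightarrow>
        (\<exists>r w. strict_mono (r :: nat \<Rightarrow> nat) \<and> w \<in> L2 (surf \<Omega>) \<and>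
           ip_tendsto (l2_ip (surf \<Omega>)) (\<lambda>n. bdry_trace \<Omega> (u (r n))) w))"

definition cond_B2 :: "'a::euclidean_space set \<Rightarrow> bool" where
  "cond_B2 \<Omega> \<longleftrightarrow> cond_B1 \<Omega> \<and> compact_imbedding \<Omega> \<and> compact_trace \<Omega>"

definition cond_B3 :: "'a::euclidean_space set \<Rightarrow> ('a \<Rightarrow> real) \<Rightarrow> bool" where
  "cond_B3 \<Omega> b \<longleftrightarrow> (\<forall>y\<in>frontier \<Omega>. b y > 0) \<and> b \<in> borel_measurable (surf \<Omega>) \<and>
     (\<exists>C. AE y in surf \<Omega>. \<bar>b y\<bar> \<le> C) \<and> (\<exists>b0>0. AE y in surf \<Omega>. b0 \<le> b y)"


definition eigenpair ::
  "'a measure \<Rightarrow> ('a \<Rightarrow> real) set \<Rightarrow> (('a \<Rightarrow> real) \<Rightarrow> ('a \<Rightarrow> real) \<Rightarrow> real) \<Rightarrow>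
     real \<Rightarrow> ('a \<Rightarrow> real) \<Rightarrow> bool" where
  "eigenpair M H a \<mu> u \<longleftrightarrow> u \<in> H \<and> \<not> (AE x in M. u x = 0) \<and>
     (\<forall>h\<in>H. a u h = \<mu> * l2_ip M u h)"

text \<open>Every eigenfunction is a combination of those \<open>e j\<close> whose eigenvalue is the same; for
  linearly independent \<open>e j\<close> and \<open>l j \<longlonglongrightarrow> \<infinity>\<close> this says that \<open>l\<close> lists all
  eigenvalues, each as often as its multiplicity.\<close>

definition all_eigenvalues ::
  "'a measure \<Rightarrow> ('a \<Rightarrow> real) set \<Rightarrow> (('a \<Rightarrow> real) \<Rightarrow> ('a \<Rightarrow> real) \<Rightarrow> real) \<Rightarrow>
     (nat \<Rightarrow> real) \<Rightarrow> (nat \<Rightarrow> 'a \<Rightarrow> real) \<Rightarrow> bool" where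
  "all_eigenvalues M H a l e \<longleftrightarrow>
     (\<forall>\<mu> u. eigenpair M H a \<mu> u \<longrightarrow>
        (\<exists>c. AE x in M. u x = (\<Sum>j | l j = \<mu>. c j * e j x)))"

definition dirichlet_eigendata ::
  "'a::euclidean_space set \<Rightarrow> (nat \<Rightarrow> real) \<Rightarrow> (nat \<Rightarrow> 'a \<Rightarrow> real) \<Rightarrow> bool" where
  "dirichlet_eigendata \<Omega> l e \<longleftrightarrow>
     (\<forall>j. l j > 0 \<and> eigenpair (vol \<Omega>) (H10 \<Omega>) (grad_ip \<Omega>) (l j) (e j)) \<and>
     all_eigenvalues (vol \<Omega>) (H10 \<Omega>) (grad_ip \<Omega>) l e \<and>
     filterlim l at_top sequentially \<and>
     orthonormal_basis (L2 (vol \<Omega>)) (l2_ip (vol \<Omega>)) e \<and>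
     orthonormal_basis (H10 \<Omega>) (grad_ip \<Omega>) (\<lambda>j x. e j x / sqrt (l j))"

definition robin_ip ::
  "'a::euclidean_space set \<Rightarrow> ('a \<Rightarrow> real) \<Rightarrow> ('a \<Rightarrow> real) \<Rightarrow> ('a \<Rightarrow> real) \<Rightarrow> real" where
  "robin_ip \<Omega> b u v = grad_ip \<Omega> u v +
     (LINT y|surf \<Omega>. b y * bdry_trace \<Omega> u y * bdry_trace \<Omega> v y)"

definition robin_eigendata ::
  "'a::euclidean_space set \<Rightarrow> ('a \<Rightarrow> real) \<Rightarrow> (nat \<Rightarrow> real) \<Rightarrow> (nat \<Rightarrow> 'a \<Rightarrow> real) \<Rightarrow> bool" where
  "robin_eigendata \<Omega> b l g \<longleftrightarrow>
     (\<forall>k. l k > 0 \<and> eigenpair (vol \<Omega>) (H1 \<Omega>) (robin_ip \<Omega> b) (l k) (g k)) \<and>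
     all_eigenvalues (vol \<Omega>) (H1 \<Omega>) (robin_ip \<Omega> b) l g \<and>
     mono l \<and> filterlim l at_top sequentially \<and>
     orthonormal_family (H1 \<Omega>) (robin_ip \<Omega> b) g \<and>
     (\<forall>v\<in>H1 \<Omega>. (\<forall>k. robin_ip \<Omega> b v (g k) = 0) \<longrightarrow> (AE y in vol \<Omega>. v y = 0))"


definition tensor :: "('a \<Rightarrow> real) \<Rightarrow> ('b \<Rightarrow> real) \<Rightarrow> 'a \<times> 'b \<Rightarrow> real" (infixr "\<otimes>\<^sub>f" 70) where
  "(e \<otimes>\<^sub>f f) = (\<lambda>(x, y). e x * f y)"

text \<open>The series is understood in $L^2$; the resulting set of functions does not depend on the
  orthonormal bases.\<close>

definition hilbert_tensor ::
  "('a \<times> 'b) measure \<Rightarrow>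
     ('a \<Rightarrow> real) set \<Rightarrow> (('a \<Rightarrow> real) \<Rightarrow> ('a \<Rightarrow> real) \<Rightarrow> real) \<Rightarrow>
     ('b \<Rightarrow> real) set \<Rightarrow> (('b \<Rightarrow> real) \<Rightarrow> ('b \<Rightarrow> real) \<Rightarrow> real) \<Rightarrow> ('a \<times> 'b \<Rightarrow> real) set" where
  "hilbert_tensor M H ipH K ipK =
     {g \<in> L2 M. \<exists>e f (c :: nat \<Rightarrow> nat \<Rightarrow> real).
        orthonormal_basis H ipH e \<and> orthonormal_basis K ipK f \<and>
        (\<lambda>(j, k). (c j k)\<^sup>2) summable_on UNIV \<and>
        ip_tendsto (l2_ip M) (\<lambda>n z. \<Sum>j<n. \<Sum>k<n. c j k * (e j \<otimes>\<^sub>f f k) z) g}"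

definition V_space ::
  "'a::euclidean_space set \<Rightarrow> 'b::euclidean_space set \<Rightarrow> ('a \<times> 'b \<Rightarrow> real) set" where
  "V_space \<Omega>1 \<Omega>2 =
     hilbert_tensor (vol (\<Omega>1 \<times> \<Omega>2)) (H10 \<Omega>1) (grad_ip \<Omega>1) (H1 \<Omega>2) (h1_ip \<Omega>2)"

text \<open>A function \<open>u\<close> in \<^const>\<open>V_space\<close> has slices \<open>u(x, \<cdot>)\<close> in $H^1(\Omega_2)$ for almost every
  \<open>x\<close>; its trace on $\Omega_1\times\partial\Omega_2$ is the trace of these slices.  The outer integral
  is taken over the complete measure \<open>lebesgue\<close>, because the inner one is determined only for
  almost every \<open>x\<close> and need not be Borel measurable in \<open>x\<close>.\<close>

definition DRL_ip ::
  "'a::euclidean_space set \<Rightarrow> 'b::euclidean_space set \<Rightarrow> ('b \<Rightarrow> real) \<Rightarrow>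
     ('a \<times> 'b \<Rightarrow> real) \<Rightarrow> ('a \<times> 'b \<Rightarrow> real) \<Rightarrow> real" where
  "DRL_ip \<Omega>1 \<Omega>2 b u v = grad_ip (\<Omega>1 \<times> \<Omega>2) u v +
     (LINT x|lebesgue_on \<Omega>1. LINT y|surf \<Omega>2.
        b y * bdry_trace \<Omega>2 (\<lambda>y. u (x, y)) y * bdry_trace \<Omega>2 (\<lambda>y. v (x, y)) y)"

definition DRL_eigenpair ::
  "'a::euclidean_space set \<Rightarrow> 'b::euclidean_space set \<Rightarrow> ('b \<Rightarrow> real) \<Rightarrow>
     real \<Rightarrow> ('a \<times> 'b \<Rightarrow> real) \<Rightarrow> bool" where
  "DRL_eigenpair \<Omega>1 \<Omega>2 b \<mu> u \<longleftrightarrow>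
     eigenpair (vol (\<Omega>1 \<times> \<Omega>2)) (V_space \<Omega>1 \<Omega>2) (DRL_ip \<Omega>1 \<Omega>2 b) \<mu> u"

end

theory Submission
  imports Defs
begin

text \<open>
  The proof is separation of variables. Let \<open>u = e \<otimes> g\<close> with a Dirichlet eigenfunction \<open>e\<close> and a Robin
  eigenfunction \<open>g\<close>, and let \<open>h\<close> be an element of the space \<open>V\<close>. The gradient of \<open>u\<close> is \<open>(g \<nabla>e, e \<nabla>g)\<close>, so the form
  \<open>[u, h]\<close> consists of \<open>\<integral> g \<nabla>e \<bullet> \<nabla>_x h\<close>, of \<open>\<integral> e \<nabla>g \<bullet> \<nabla>_y h\<close> and of the boundary term. The first integral is the
  Dirichlet eigenvalue times \<open>\<integral> u h\<close>. For almost every \<open>x\<close> the slice \<open>h(x, \<cdot>)\<close> is an admissible test function for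
  the Robin problem, and the Robin equation says that the remaining two contributions add up, after
  integration over \<open>x\<close>, to the Robin eigenvalue times \<open>\<integral> u h\<close>. This is \<open>DRL_ip_tensor\<close>; it uses of the
  trace only that it exists, is unique and is homogeneous. With \<open>h\<close> another member of the family the
  equation reduces orthogonality in \<open>V\<close> to orthogonality in \<open>L^2\<close>, which is Fubini's theorem.

  The work lies in two facts about \<open>V\<close>, whose elements are given only as \<open>L^2\<close> limits of tensor series. The
  first, \<open>V_space_gradient\<close>, is that such a limit has a weak gradient, on the product and on almost every slice.
  The gradients of the partial sums are Cauchy in \<open>L^2\<close> (\<open>tensor_combination_gradient_bound\<close>, which rests on
  Poincare's inequality), \<open>L^2\<close> is complete, and weak gradients are closed under \<open>L^2\<close> limits. Gradients are
  unique almost everywhere by the fundamental lemma of the calculus of variations, proved with explicit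
  smooth bumps; so limits and Fubini arguments do compute the gradient in the form.

  The second, \<open>tensor_mem_V_space\<close>, is that \<open>u\<close> itself belongs to \<open>V\<close>. This needs an orthonormal basis of \<open>H^1(\<Omega>2)\<close>
  for the standard inner product, indexed by the natural numbers, while the Robin eigenfunctions are
  orthonormal for another one. In \<open>H1_orthonormal_basis_exists\<close> a maximal orthonormal set comes from Zorn's lemma
  and is countable because of the compact imbedding into \<open>L^2\<close>.
\<close>

section \<open>Semi-inner products on spaces of functions\<close>
text \<open>Elements of function spaces are functions, not classes of functions, so an inner product is
  only positive semidefinite here: functions that vanish almost everywhere have norm zero.\<close>

locale semi_inner_space =
  fixes H :: "('a \<Rightarrow> real) set" and ip :: "('a \<Rightarrow> real) \<Rightarrow> ('a \<Rightarrow> real) \<Rightarrow> real"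
  assumes zero_mem: "(\<lambda>x. 0) \<in> H"
    and add_mem: "u \<in> H \<Longrightarrow> v \<in> H \<Longrightarrow> (\<lambda>x. u x + v x) \<in> H"
    and scale_mem: "u \<in> H \<Longrightarrow> (\<lambda>x. c * u x) \<in> H"
    and sym: "u \<in> H \<Longrightarrow> v \<in> H \<Longrightarrow> ip u v = ip v u"
    and add_left: "u \<in> H \<Longrightarrow> v \<in> H \<Longrightarrow> w \<in> H \<Longrightarrow> ip (\<lambda>x. u x + v x) w = ip u w + ip v w"
    and scale_left: "u \<in> H \<Longrightarrow> w \<in> H \<Longrightarrow> ip (\<lambda>x. c * u x) w = c * ip u w"
    and nonneg: "u \<in> H \<Longrightarrow> 0 \<le> ip u u"
begin

lemma add_right: "u \<in> H \<Longrightarrow> v \<in> H \<Longrightarrow> w \<in> H \<Longrightarrow> ip w (\<lambda>x. u x + v x) = ip w u + ip w v"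
  using sym[of w "\<lambda>x. u x + v x"] sym[of w u] sym[of w v] by (simp add: add_mem add_left)

lemma scale_right: "u \<in> H \<Longrightarrow> w \<in> H \<Longrightarrow> ip w (\<lambda>x. c * u x) = c * ip w u"
  using sym[of w "\<lambda>x. c * u x"] sym[of w u] by (simp add: scale_mem scale_left)

lemma diff_mem: "u \<in> H \<Longrightarrow> v \<in> H \<Longrightarrow> (\<lambda>x. u x - v x) \<in> H"
  using add_mem[of u "\<lambda>x. (-1) * v x"] scale_mem[of v "-1"] by simp

lemma diff_left: "u \<in> H \<Longrightarrow> v \<in> H \<Longrightarrow> w \<in> H \<Longrightarrow> ip (\<lambda>x. u x - v x) w = ip u w - ip v w"
  using add_left[of u "\<lambda>x. (-1) * v x" w] scale_left[of v w "-1"] scale_mem[of v "-1"] by simp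

lemma diff_right: "u \<in> H \<Longrightarrow> v \<in> H \<Longrightarrow> w \<in> H \<Longrightarrow> ip w (\<lambda>x. u x - v x) = ip w u - ip w v"
  using sym[of w "\<lambda>x. u x - v x"] sym[of w u] sym[of w v] by (simp add: diff_mem diff_left)

lemma sum_mem:
  assumes "\<And>i. i \<in> I \<Longrightarrow> v i \<in> H"
  shows "(\<lambda>x. \<Sum>i\<in>I. c i * v i x) \<in> H"
proof (cases "finite I")
  case True
  then show ?thesis using assms
  proof (induction I)
    case (insert i I)
    then show ?case
      using add_mem[of "\<lambda>x. c i * v i x" "\<lambda>x. \<Sum>i\<in>I. c i * v i x"] by (simp add: scale_mem)
  qed (simp add: zero_mem)
qed (simp add: zero_mem)

lemma zero_left: "w \<in> H \<Longrightarrow> ip (\<lambda>x. 0) w = 0"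
  using scale_left[of "\<lambda>x. 0" w 0] zero_mem by simp

lemma sum_left:
  assumes "\<And>i. i \<in> I \<Longrightarrow> v i \<in> H" "w \<in> H"
  shows "ip (\<lambda>x. \<Sum>i\<in>I. c i * v i x) w = (\<Sum>i\<in>I. c i * ip (v i) w)"
proof (cases "finite I")
  case True
  then show ?thesis using assms
  proof (induction I)
    case empty
    then show ?case by (simp add: zero_left)
  next
    case (insert i I)
    then show ?case
      using add_left[of "\<lambda>x. c i * v i x" "\<lambda>x. \<Sum>i\<in>I. c i * v i x" w]
      by (simp add: scale_mem sum_mem scale_left)
  qed
qed (simp add: zero_left assms)

lemma sum_right:
  assumes "\<And>i. i \<in> I \<Longrightarrow> v i \<in> H" "w \<in> H"
  shows "ip w (\<lambda>x. \<Sum>i\<in>I. c i * v i x) = (\<Sum>i\<in>I. c i * ip w (v i))"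
  using sum_left[OF assms, where c=c] sym[OF assms(2) sum_mem[of I v c]] assms
  by (simp add: sym)

lemma ip_sum_orthonormal:
  assumes "\<And>i. i \<in> I \<Longrightarrow> v i \<in> H" "finite I"
    and on: "\<And>i j. i \<in> I \<Longrightarrow> j \<in> I \<Longrightarrow> ip (v i) (v j) = (if i = j then 1 else 0)"
  shows "ip (\<lambda>x. \<Sum>i\<in>I. c i * v i x) (\<lambda>x. \<Sum>i\<in>I. c i * v i x) = (\<Sum>i\<in>I. (c i)\<^sup>2)"
proof -
  have "ip (\<lambda>x. \<Sum>i\<in>I. c i * v i x) (\<lambda>x. \<Sum>i\<in>I. c i * v i x) = (\<Sum>i\<in>I. c i * (\<Sum>j\<in>I. c j * ip (v i) (v j)))"
    using assms(1) by (simp add: sum_left sum_right sum_mem)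
  also have "\<dots> = (\<Sum>i\<in>I. (c i)\<^sup>2)"
  proof (rule sum.cong[OF refl])
    fix i assume i: "i \<in> I"
    have "(\<Sum>j\<in>I. c j * ip (v i) (v j)) = (\<Sum>j\<in>I. if i = j then c j else 0)"
      by (rule sum.cong) (auto simp: on i)
    then show "c i * (\<Sum>j\<in>I. c j * ip (v i) (v j)) = (c i)\<^sup>2"
      using assms(2) i by (simp add: power2_eq_square)
  qed
  finally show ?thesis .
qed

lemma ip_diff_partial_sum:
  assumes "u \<in> H" "\<And>i. i \<in> I \<Longrightarrow> v i \<in> H" "finite I"
    and on: "\<And>i j. i \<in> I \<Longrightarrow> j \<in> I \<Longrightarrow> ip (v i) (v j) = (if i = j then 1 else 0)"
  defines "s \<equiv> (\<lambda>x. \<Sum>i\<in>I. ip u (v i) * v i x)"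
  shows "ip (\<lambda>x. s x - u x) (\<lambda>x. s x - u x) = ip u u - (\<Sum>i\<in>I. (ip u (v i))\<^sup>2)"
proof -
  have s: "s \<in> H" unfolding s_def using assms by (intro sum_mem) auto
  have 1: "ip s s = (\<Sum>i\<in>I. (ip u (v i))\<^sup>2)"
    unfolding s_def using assms by (intro ip_sum_orthonormal) auto
  have 2: "ip u s = (\<Sum>i\<in>I. (ip u (v i))\<^sup>2)"
    unfolding s_def using assms by (subst sum_right) (auto simp: power2_eq_square)
  show ?thesis
    using s assms(1) 1 2 sym[OF s assms(1)] by (simp add: diff_left diff_right diff_mem)
qed

lemma bessel:
  assumes "u \<in> H" "\<And>i. i \<in> I \<Longrightarrow> v i \<in> H" "finite I"
    and "\<And>i j. i \<in> I \<Longrightarrow> j \<in> I \<Longrightarrow> ip (v i) (v j) = (if i = j then 1 else 0)"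
  shows "(\<Sum>i\<in>I. (ip u (v i))\<^sup>2) \<le> ip u u"
  using ip_diff_partial_sum[OF assms] nonneg[OF diff_mem[OF sum_mem[of I v] assms(1)], of "\<lambda>i. ip u (v i)"] assms(2)
  by simp

lemma cauchy_schwarz:
  assumes u: "u \<in> H" and v: "v \<in> H"
  shows "(ip u v)\<^sup>2 \<le> ip u u * ip v v"
proof -
  \<comment> \<open>The quadratic in \<open>t\<close> is the squared norm of \<open>u + t v\<close>.\<close>
  have q: "0 \<le> ip u u + 2 * t * ip u v + t\<^sup>2 * ip v v" for t
  proof -
    have "0 \<le> ip (\<lambda>x. u x + t * v x) (\<lambda>x. u x + t * v x)"
      by (intro nonneg add_mem scale_mem u v)
    then show ?thesis
      using u v by (simp add: add_left add_right scale_left scale_right add_mem scale_mem sym[OF v u] power2_eq_square algebra_simps)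
  qed
  show ?thesis
  proof (cases "ip v v = 0")
    case True
    have "ip u v = 0"
    proof (rule ccontr)
      assume "ip u v \<noteq> 0"
      then show False
        using q[of "- (ip u u + 1) / (2 * ip u v)"] True by (simp add: field_simps)
    qed
    then show ?thesis using True by simp
  next
    case False
    then have "ip v v > 0" using nonneg[OF v] by simp
    then show ?thesis using q[of "- ip u v / ip v v"]
      by (simp add: field_simps power2_eq_square)
  qed
qed

lemma null_left:
  assumes "u \<in> H" "v \<in> H" "ip u u = 0"
  shows "ip u v = 0"
  using cauchy_schwarz[OF assms(1,2)] assms(3) by simp

lemma tendsto_ip_left:
  assumes u: "\<And>n. u n \<in> H" and w: "w \<in> H" and v: "v \<in> H"
    and lim: "(\<lambda>n. ip (\<lambda>x. u n x - w x) (\<lambda>x. u n x - w x)) \<longlonglongrightarrow> 0"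
  shows "(\<lambda>n. ip (u n) v) \<longlonglongrightarrow> ip w v"
proof -
  have "(\<lambda>n. sqrt (ip (\<lambda>x. u n x - w x) (\<lambda>x. u n x - w x) * ip v v)) \<longlonglongrightarrow> sqrt (0 * ip v v)"
    by (intro tendsto_intros lim)
  then have "(\<lambda>n. ip (u n) v - ip w v) \<longlonglongrightarrow> 0"
  proof (rule Lim_null_comparison[rotated, OF tendsto_eq_rhs])
    show "\<forall>\<^sub>F n in sequentially. norm (ip (u n) v - ip w v)
       \<le> sqrt (ip (\<lambda>x. u n x - w x) (\<lambda>x. u n x - w x) * ip v v)"
    proof (rule always_eventually, rule allI)
      fix n
      have "(ip (u n) v - ip w v)\<^sup>2 \<le> ip (\<lambda>x. u n x - w x) (\<lambda>x. u n x - w x) * ip v v"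
        using cauchy_schwarz[OF diff_mem[OF u w] v] u w v by (simp add: diff_left)
      then show "norm (ip (u n) v - ip w v)
       \<le> sqrt (ip (\<lambda>x. u n x - w x) (\<lambda>x. u n x - w x) * ip v v)"
        by (simp add: real_le_rsqrt)
    qed
  qed simp
  then show ?thesis by (simp add: LIM_zero_iff)
qed

end

section \<open>Square integrable functions\<close>

lemma integrable_inner_square:
  fixes F G :: "'a \<Rightarrow> 'b::euclidean_space"
  assumes [measurable]: "F \<in> borel_measurable M" "G \<in> borel_measurable M"
    and F: "integrable M (\<lambda>x. (norm (F x))\<^sup>2)" and G: "integrable M (\<lambda>x. (norm (G x))\<^sup>2)"
  shows "integrable M (\<lambda>x. F x \<bullet> G x)"
proof (rule Bochner_Integration.integrable_bound[OF Bochner_Integration.integrable_add[OF F G]])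
  show "AE x in M. norm (F x \<bullet> G x) \<le> norm ((norm (F x))\<^sup>2 + (norm (G x))\<^sup>2)"
  proof (rule AE_I2)
    fix x
    have "\<bar>F x \<bullet> G x\<bar> \<le> norm (F x) * norm (G x)" by (rule Cauchy_Schwarz_ineq2)
    also have "\<dots> \<le> (norm (F x))\<^sup>2 + (norm (G x))\<^sup>2"
      using sum_squares_bound[of "norm (F x)" "norm (G x)"]
        mult_nonneg_nonneg[OF norm_ge_zero[of "F x"] norm_ge_zero[of "G x"]]
      unfolding mult.assoc by linarith
    finally show "norm (F x \<bullet> G x) \<le> norm ((norm (F x))\<^sup>2 + (norm (G x))\<^sup>2)" by simp
  qed
qed measurable

lemma square_integrable_add:
  fixes F G :: "'a \<Rightarrow> 'b::euclidean_space"
  assumes [measurable]: "F \<in> borel_measurable M" "G \<in> borel_measurable M"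
    and F: "integrable M (\<lambda>x. (norm (F x))\<^sup>2)" and G: "integrable M (\<lambda>x. (norm (G x))\<^sup>2)"
  shows "integrable M (\<lambda>x. (norm (F x + G x))\<^sup>2)"
proof -
  have "(\<lambda>x. (norm (F x + G x))\<^sup>2) = (\<lambda>x. (norm (F x))\<^sup>2 + 2 * (F x \<bullet> G x) + (norm (G x))\<^sup>2)"
    by (auto simp: power2_norm_eq_inner inner_simps inner_commute)
  then show ?thesis using integrable_inner_square[OF assms] F G by simp
qed

lemma square_integrable_diff:
  fixes F G :: "'a \<Rightarrow> 'b::euclidean_space"
  assumes "F \<in> borel_measurable M" "G \<in> borel_measurable M"
    and "integrable M (\<lambda>x. (norm (F x))\<^sup>2)" and "integrable M (\<lambda>x. (norm (G x))\<^sup>2)"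
  shows "integrable M (\<lambda>x. (norm (F x - G x))\<^sup>2)"
  using square_integrable_add[of F M "\<lambda>x. - G x"] assms by simp

lemma L2_iff: "u \<in> L2 M \<longleftrightarrow> u \<in> borel_measurable M \<and> integrable M (\<lambda>x. (norm (u x))\<^sup>2)"
  by (simp add: L2_def)

lemma L2_mult_integrable: "u \<in> L2 M \<Longrightarrow> v \<in> L2 M \<Longrightarrow> integrable M (\<lambda>x. u x * v x)"
  using integrable_inner_square[of u M v] by (simp add: L2_iff)

lemma L2_measurable: "u \<in> L2 M \<Longrightarrow> u \<in> borel_measurable M"
  by (simp add: L2_def)

interpretation l2: semi_inner_space "L2 M" "l2_ip M" for M :: "'a measure"
proof
  fix u v w :: "'a \<Rightarrow> real" and c :: real
  show "(\<lambda>x. 0) \<in> L2 M" by (simp add: L2_def)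
  assume u: "u \<in> L2 M"
  show "(\<lambda>x. c * u x) \<in> L2 M"
    using u unfolding L2_def by (auto simp: power_mult_distrib intro!: borel_measurable_times)
  show "0 \<le> l2_ip M u u" by (simp add: l2_ip_def)
  { assume w: "w \<in> L2 M"
    show "l2_ip M (\<lambda>x. c * u x) w = c * l2_ip M u w"
      by (simp add: l2_ip_def mult.assoc) }
  assume v: "v \<in> L2 M"
  show "(\<lambda>x. u x + v x) \<in> L2 M"
    using u v square_integrable_add[of u M v] unfolding L2_iff by (auto intro!: borel_measurable_add)
  show "l2_ip M u v = l2_ip M v u" by (simp add: l2_ip_def mult.commute)
  assume w: "w \<in> L2 M"
  show "l2_ip M (\<lambda>x. u x + v x) w = l2_ip M u w + l2_ip M v w"
    using u v w by (simp add: l2_ip_def distrib_right L2_mult_integrable)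
qed

lemma integral_inner_le:
  fixes F G :: "'a \<Rightarrow> 'b::euclidean_space"
  assumes [measurable]: "F \<in> borel_measurable M" "G \<in> borel_measurable M"
    and F: "integrable M (\<lambda>x. (norm (F x))\<^sup>2)" and G: "integrable M (\<lambda>x. (norm (G x))\<^sup>2)"
  shows "\<bar>LINT x|M. F x \<bullet> G x\<bar> \<le> sqrt ((LINT x|M. (norm (F x))\<^sup>2) * (LINT x|M. (norm (G x))\<^sup>2))"
proof -
  have nF: "(\<lambda>x. norm (F x)) \<in> L2 M" and nG: "(\<lambda>x. norm (G x)) \<in> L2 M"
    using F G by (auto simp: L2_def)
  have "\<bar>LINT x|M. F x \<bullet> G x\<bar> \<le> (LINT x|M. \<bar>F x \<bullet> G x\<bar>)"
    by (rule integral_abs_bound)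
  also have "\<dots> \<le> (LINT x|M. norm (F x) * norm (G x))"
    using integrable_inner_square[OF assms] L2_mult_integrable[OF nF nG]
    by (intro integral_mono) (auto intro: Cauchy_Schwarz_ineq2)
  also have "\<dots> \<le> sqrt ((LINT x|M. (norm (F x))\<^sup>2) * (LINT x|M. (norm (G x))\<^sup>2))"
    using l2.cauchy_schwarz[OF nF nG] unfolding l2_ip_def
    by (intro real_le_rsqrt) (simp add: power2_eq_square)
  finally show ?thesis .
qed

lemma tendsto_integral_inner:
  fixes F :: "nat \<Rightarrow> 'a \<Rightarrow> 'b::euclidean_space"
  assumes [measurable]: "\<And>n. F n \<in> borel_measurable M" "G \<in> borel_measurable M" "K \<in> borel_measurable M"
    and F: "\<And>n. integrable M (\<lambda>x. (norm (F n x))\<^sup>2)" and G: "integrable M (\<lambda>x. (norm (G x))\<^sup>2)"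
    and K: "integrable M (\<lambda>x. (norm (K x))\<^sup>2)"
    and lim: "(\<lambda>n. LINT x|M. (norm (F n x - G x))\<^sup>2) \<longlonglongrightarrow> 0"
  shows "(\<lambda>n. LINT x|M. F n x \<bullet> K x) \<longlonglongrightarrow> (LINT x|M. G x \<bullet> K x)"
proof -
  have "(\<lambda>n. sqrt ((LINT x|M. (norm (F n x - G x))\<^sup>2) * (LINT x|M. (norm (K x))\<^sup>2))) \<longlonglongrightarrow>
     sqrt (0 * (LINT x|M. (norm (K x))\<^sup>2))"
    by (intro tendsto_intros lim)
  then have "(\<lambda>n. (LINT x|M. F n x \<bullet> K x) - (LINT x|M. G x \<bullet> K x)) \<longlonglongrightarrow> 0"
  proof (rule Lim_null_comparison[rotated, OF tendsto_eq_rhs])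
    show "\<forall>\<^sub>F n in sequentially. norm ((LINT x|M. F n x \<bullet> K x) - (LINT x|M. G x \<bullet> K x))
       \<le> sqrt ((LINT x|M. (norm (F n x - G x))\<^sup>2) * (LINT x|M. (norm (K x))\<^sup>2))"
    proof (rule always_eventually, rule allI)
      fix n
      have "(LINT x|M. F n x \<bullet> K x) - (LINT x|M. G x \<bullet> K x) = (LINT x|M. (F n x - G x) \<bullet> K x)"
        by (simp add: inner_diff_left integrable_inner_square F G K)
      then show "norm ((LINT x|M. F n x \<bullet> K x) - (LINT x|M. G x \<bullet> K x))
       \<le> sqrt ((LINT x|M. (norm (F n x - G x))\<^sup>2) * (LINT x|M. (norm (K x))\<^sup>2))"
        using integral_inner_le[of "\<lambda>x. F n x - G x" M K] by (simp add: square_integrable_diff F G K)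
    qed
  qed simp
  then show ?thesis by (simp add: LIM_zero_iff)
qed

text \<open>A subsequence whose consecutive squared distances are at most \<open>8^(-k)\<close> converges almost
  everywhere: the function \<open>\<Sum>k. 4^k * d_k^2\<close>, where \<open>d_k\<close> is the \<open>k\<close>-th increment, has finite integral, so at almost
  every point \<open>d_k \<le> sqrt C * 2^(-k)\<close> for some \<open>C\<close> and the increments are summable. Fatou's lemma turns the
  pointwise limit into a limit in mean.\<close>

lemma riesz_fischer:
  fixes F :: "nat \<Rightarrow> 'a \<Rightarrow> 'b::euclidean_space"
  assumes [measurable]: "\<And>n. F n \<in> borel_measurable M"
    and F: "\<And>n. integrable M (\<lambda>x. (norm (F n x))\<^sup>2)"
    and cauchy: "\<And>e. e > 0 \<Longrightarrow> \<exists>N. \<forall>m\<ge>N. \<forall>n\<ge>N. (LINT x|M. (norm (F m x - F n x))\<^sup>2) < e"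
  obtains G where "G \<in> borel_measurable M" "integrable M (\<lambda>x. (norm (G x))\<^sup>2)"
    "(\<lambda>n. LINT x|M. (norm (F n x - G x))\<^sup>2) \<longlonglongrightarrow> 0"
proof -
  have "\<forall>k::nat. \<exists>N. \<forall>m\<ge>N. \<forall>n\<ge>N. (LINT x|M. (norm (F m x - F n x))\<^sup>2) < (1/8)^k"
    using cauchy by simp
  then obtain N where N: "\<And>k m n. m \<ge> N k \<Longrightarrow> n \<ge> N k \<Longrightarrow> (LINT x|M. (norm (F m x - F n x))\<^sup>2) < (1/8)^k"
    by metis
  define r where "r k = k + (\<Sum>i\<le>k. N i)" for k
  have r_ge: "N k \<le> r k" "k \<le> r k" for k
    unfolding r_def using member_le_sum[of k "{..k}" N] by (auto simp: trans_le_add2)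
  have r_mono: "N k \<le> r (Suc k)" for k
    unfolding r_def using member_le_sum[of k "{..Suc k}" N] by (auto simp: trans_le_add2)
  define d where "d k x = norm (F (r (Suc k)) x - F (r k) x)" for k x
  have [measurable]: "d k \<in> borel_measurable M" for k unfolding d_def by measurable
  have d_int: "integrable M (\<lambda>x. (d k x)\<^sup>2)" for k
    unfolding d_def by (intro square_integrable_diff F) auto
  have d_le: "(LINT x|M. (d k x)\<^sup>2) \<le> (1/8)^k" for k
    unfolding d_def using N[OF r_mono r_ge(1)] by (simp add: less_imp_le)
  have fin: "(\<integral>\<^sup>+x. (\<Sum>k. ennreal (4^k * (d k x)\<^sup>2)) \<partial>M) < \<infinity>"
  proof -
    have "(\<integral>\<^sup>+x. (\<Sum>k. ennreal (4^k * (d k x)\<^sup>2)) \<partial>M) = (\<Sum>k. \<integral>\<^sup>+x. ennreal (4^k * (d k x)\<^sup>2) \<partial>M)"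
      by (rule nn_integral_suminf) measurable
    also have "\<dots> = (\<Sum>k. ennreal (4^k * (LINT x|M. (d k x)\<^sup>2)))"
      using d_int by (subst nn_integral_eq_integral) auto
    also have "\<dots> \<le> (\<Sum>k. ennreal ((1/2)^k))"
    proof (intro suminf_le ennreal_leI)
      fix k
      have "4^k * (LINT x|M. (d k x)\<^sup>2) \<le> 4^k * (1/8)^k"
        using d_le by (intro mult_left_mono) auto
      also have "\<dots> = (1/2)^k" by (simp flip: power_mult_distrib)
      finally show "4^k * (LINT x|M. (d k x)\<^sup>2) \<le> (1/2)^k" .
    qed auto
    also have "\<dots> = ennreal (\<Sum>k. (1/2)^k)"
      by (intro suminf_ennreal2 summable_geometric) auto
    also have "\<dots> < \<infinity>" by simp
    finally show ?thesis .
  qed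
  have conv: "AE x in M. convergent (\<lambda>k. F (r k) x)"
  proof -
    have "AE x in M. (\<Sum>k. ennreal (4^k * (d k x)\<^sup>2)) \<noteq> \<infinity>"
      using fin by (intro nn_integral_PInf_AE) auto
    then show ?thesis
    proof eventually_elim
      case (elim x)
      have sm: "summable (\<lambda>k. 4^k * (d k x)\<^sup>2)"
        using elim by (intro summable_suminf_not_top) auto
      then obtain C where C: "\<And>k. norm (4^k * (d k x)\<^sup>2) \<le> C"
        using summable_imp_Bseq[OF sm] by (auto simp: Bseq_def)
      have C0: "0 \<le> C" using C[of 0] norm_ge_zero order_trans by blast
      have le: "d k x \<le> sqrt C * (1/2)^k" for k
      proof -
        have "(2^k * d k x)\<^sup>2 \<le> C"
          using C[of k] power_mult[of "2::real" k 2] power_mult[of "2::real" 2 k]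
          by (simp add: power_mult_distrib mult.commute)
        then have "2^k * d k x \<le> sqrt C" by (rule real_le_rsqrt)
        then show ?thesis by (simp add: field_simps power_one_over)
      qed
      have "summable (\<lambda>k. norm (F (r (Suc k)) x - F (r k) x))"
        using le by (intro summable_comparison_test'[OF summable_mult[OF summable_geometric], where N=0])
          (auto simp: d_def)
      then have "summable (\<lambda>k. F (r (Suc k)) x - F (r k) x)" by (rule summable_norm_cancel)
      then have "convergent (\<lambda>n. (\<Sum>k<n. F (r (Suc k)) x - F (r k) x) + F (r 0) x)"
        by (intro convergent_add convergent_const) (auto simp: summable_iff_convergent)
      moreover have "(\<Sum>k<n. F (r (Suc k)) x - F (r k) x) + F (r 0) x = F (r n) x" for n
        using sum_lessThan_telescope[of "\<lambda>k. F (r k) x" n] by simp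
      ultimately show ?case by simp
    qed
  qed
  define G where "G x = lim (\<lambda>k. F (r k) x)" for x
  have G_meas[measurable]: "G \<in> borel_measurable M"
    unfolding G_def by (rule borel_measurable_lim_metric) measurable
  have lim: "AE x in M. (\<lambda>k. F (r k) x) \<longlonglongrightarrow> G x"
    using conv by eventually_elim (simp add: G_def convergent_LIMSEQ_iff)
  \<comment> \<open>Fatou: a bound on the distances to the late terms of the subsequence passes to the limit.\<close>
  have bound: "(\<integral>\<^sup>+x. ennreal ((norm (F n x - G x))\<^sup>2) \<partial>M) \<le> ennreal e"
    if e: "\<And>k. k \<ge> n0 \<Longrightarrow> (LINT x|M. (norm (F n x - F (r k) x))\<^sup>2) \<le> e" for n n0 e
  proof -
    have "(\<integral>\<^sup>+x. ennreal ((norm (F n x - G x))\<^sup>2) \<partial>M)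
        = (\<integral>\<^sup>+x. liminf (\<lambda>k. ennreal ((norm (F n x - F (r k) x))\<^sup>2)) \<partial>M)"
    proof (rule nn_integral_cong_AE)
      show "AE x in M. ennreal ((norm (F n x - G x))\<^sup>2) = liminf (\<lambda>k. ennreal ((norm (F n x - F (r k) x))\<^sup>2))"
        using lim
      proof eventually_elim
        case (elim x)
        have "(\<lambda>k. ennreal ((norm (F n x - F (r k) x))\<^sup>2)) \<longlonglongrightarrow> ennreal ((norm (F n x - G x))\<^sup>2)"
          by (intro tendsto_ennrealI tendsto_intros elim)
        from lim_imp_Liminf[OF sequentially_bot this] show ?case by (rule sym)
      qed
    qed
    also have "\<dots> \<le> liminf (\<lambda>k. \<integral>\<^sup>+x. ennreal ((norm (F n x - F (r k) x))\<^sup>2) \<partial>M)"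
      by (rule nn_integral_liminf) measurable
    also have "\<dots> = liminf (\<lambda>k. ennreal (LINT x|M. (norm (F n x - F (r k) x))\<^sup>2))"
      by (subst nn_integral_eq_integral) (auto intro!: square_integrable_diff F)
    also have "\<dots> \<le> ennreal e"
    proof -
      have "liminf (\<lambda>k. ennreal (LINT x|M. (norm (F n x - F (r k) x))\<^sup>2)) \<le> liminf (\<lambda>k::nat. ennreal e)"
        using e by (intro Liminf_mono) (auto simp: eventually_sequentially intro!: ennreal_leI)
      then show ?thesis by (simp add: Liminf_const)
    qed
    finally show ?thesis .
  qed
  have diff_int: "integrable M (\<lambda>x. (norm (F n x - G x))\<^sup>2)" if "n \<ge> N 0" for n
  proof -
    have "(\<integral>\<^sup>+x. ennreal ((norm (F n x - G x))\<^sup>2) \<partial>M) \<le> ennreal 1"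
    proof (rule bound[of "N 0"])
      fix k assume "N 0 \<le> k"
      then show "(LINT x|M. (norm (F n x - F (r k) x))\<^sup>2) \<le> 1"
        using N[of 0 n "r k"] that r_ge(2)[of k] by simp
    qed
    also have "\<dots> < \<infinity>" by simp
    finally show ?thesis by (intro integrableI_bounded) auto
  qed
  have G_int: "integrable M (\<lambda>x. (norm (G x))\<^sup>2)"
    using square_integrable_diff[OF _ _ F[of "N 0"] diff_int[of "N 0"]] by simp
  have "(\<lambda>n. LINT x|M. (norm (F n x - G x))\<^sup>2) \<longlonglongrightarrow> 0"
  proof (rule LIMSEQ_I)
    fix e :: real assume e: "0 < e"
    then obtain n0 where n0: "\<And>m n. m \<ge> n0 \<Longrightarrow> n \<ge> n0 \<Longrightarrow> (LINT x|M. (norm (F m x - F n x))\<^sup>2) < e/2"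
      using cauchy[of "e/2"] by auto
    have "norm ((LINT x|M. (norm (F n x - G x))\<^sup>2) - 0) < e" if n: "n \<ge> n0 + N 0" for n
    proof -
      have "ennreal (LINT x|M. (norm (F n x - G x))\<^sup>2) = (\<integral>\<^sup>+x. ennreal ((norm (F n x - G x))\<^sup>2) \<partial>M)"
        using diff_int[of n] n by (subst nn_integral_eq_integral) auto
      also have "\<dots> \<le> ennreal (e/2)"
        using n0[of n "r _"] n r_ge(2) by (intro bound[of n0]) (meson add_leD1 less_imp_le order_trans)
      finally show ?thesis using e by (simp add: ennreal_le_iff)
    qed
    then show "\<exists>no. \<forall>n\<ge>no. norm ((LINT x|M. (norm (F n x - G x))\<^sup>2) - 0) < e" by blast
  qed
  with G_meas G_int show ?thesis using that by blast
qed

section \<open>Smooth bumps and the fundamental lemma\<close>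
lemma borel_measurable_vol: "f \<in> borel_measurable borel \<Longrightarrow> f \<in> borel_measurable (vol \<Omega>)"
  by (rule measurable_restrict_space1) simp

lemma frechet_derivative_eqI:
  "(f has_derivative f') (at x) \<Longrightarrow> frechet_derivative f (at x) = f'"
  by (rule frechet_derivative_at[symmetric])

lemma Ck_continuous: "Ck k f \<Longrightarrow> continuous_on UNIV f"
  by (cases k) (auto intro: differentiable_imp_continuous_on simp: differentiable_on_def differentiable_at_withinI)

lemma Ck_SucD: "Ck (Suc k) f \<Longrightarrow> Ck k f"
proof (induction k arbitrary: f)
  case 0
  then show ?case using Ck_continuous[OF 0] by simp
next
  case (Suc k)
  then show ?case by simp
qed

lemma Ck_const: "Ck k (\<lambda>x. c)"
  by (induction k arbitrary: c) auto

lemma Ck_add: "Ck k f \<Longrightarrow> Ck k g \<Longrightarrow> Ck k (\<lambda>x. f x + g x)"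
proof (induction k arbitrary: f g)
  case 0
  then show ?case by (auto intro: continuous_intros)
next
  case (Suc k)
  then have d: "f differentiable at x" "g differentiable at x" for x by auto
  have "frechet_derivative (\<lambda>x. f x + g x) (at x) = (\<lambda>h. frechet_derivative f (at x) h + frechet_derivative g (at x) h)" for x
    using d by (intro frechet_derivative_eqI has_derivative_add) (auto simp: frechet_derivative_works)
  then show ?case using Suc d by (auto intro: derivative_intros)
qed

lemma Ck_mult: "Ck k f \<Longrightarrow> Ck k g \<Longrightarrow> Ck k (\<lambda>x. f x * g x)"
proof (induction k arbitrary: f g)
  case 0
  then show ?case by (auto intro: continuous_intros)
next
  case (Suc k)
  then have d: "f differentiable at x" "g differentiable at x" for x by auto
  have "frechet_derivative (\<lambda>x. f x * g x) (at x) = (\<lambda>h. f x * frechet_derivative g (at x) h + frechet_derivative f (at x) h * g x)" for x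
    using d by (intro frechet_derivative_eqI has_derivative_mult) (auto simp: frechet_derivative_works)
  moreover have "Ck k f" "Ck k g" using Suc.prems by (auto intro: Ck_SucD)
  ultimately show ?case using Suc.prems d by (auto intro!: Ck_add Suc.IH intro: derivative_intros)
qed

lemma Ck_prod: "(\<And>i. i \<in> I \<Longrightarrow> Ck k (f i)) \<Longrightarrow> Ck k (\<lambda>x. \<Prod>i\<in>I. f i x)"
  by (induction I rule: infinite_finite_induct) (auto intro: Ck_const Ck_mult)

text \<open>For every \<open>n\<close> this is smooth on the whole line, because the derivative of such a function is a
  combination of two functions of the same kind. The exponential beats the powers at the origin.\<close>

definition flat :: "nat \<Rightarrow> real \<Rightarrow> real" where
  "flat n t = (if t > 0 then inverse t ^ n * exp (- inverse t) else 0)"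

lemma flat_div_tendsto_0: "((\<lambda>t. flat n t / t) \<longlongrightarrow> 0) (at 0)"
proof -
  have "((\<lambda>t::real. inverse t ^ Suc n / exp (inverse t)) \<longlongrightarrow> 0) (at_right 0)"
    by (rule filterlim_compose[OF tendsto_power_div_exp_0 filterlim_inverse_at_top_right])
  moreover have "\<forall>\<^sub>F t in at_right 0. inverse t ^ Suc n / exp (inverse t) = flat n t / t"
    by (auto simp: eventually_at_filter flat_def exp_minus field_simps)
  ultimately have "((\<lambda>t. flat n t / t) \<longlongrightarrow> 0) (at_right 0)"
    by (rule Lim_transform_eventually)
  moreover have "((\<lambda>t. flat n t / t) \<longlongrightarrow> 0) (at_left 0)"
    by (rule Lim_transform_eventually[OF tendsto_const]) (auto simp: eventually_at_filter flat_def)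
  ultimately show ?thesis by (intro filterlim_split_at)
qed

lemma flat_has_derivative:
  "(flat n has_real_derivative (flat (n + 2) t - real n * flat (n + 1) t)) (at t)"
proof -
  consider "t > 0" | "t = 0" | "t < 0" by linarith
  then show ?thesis
  proof cases
    case 1
    have "((\<lambda>t. inverse t ^ n * exp (- inverse t)) has_real_derivative
        real n * (- (inverse t * inverse t)) * inverse t ^ (n - 1) * exp (- inverse t)
        + inverse t ^ n * (exp (- inverse t) * (inverse t * inverse t))) (at t)"
      using 1 by (auto intro!: derivative_eq_intros)
    then have "((\<lambda>t. inverse t ^ n * exp (- inverse t)) has_real_derivative (flat (n + 2) t - real n * flat (n + 1) t)) (at t)"
      by (rule DERIV_cong) (use 1 in \<open>cases n; auto simp: flat_def power2_eq_square algebra_simps\<close>)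
    then show ?thesis
      by (rule has_field_derivative_transform_within_open[where S="{0<..}"]) (use 1 in \<open>auto simp: flat_def\<close>)
  next
    case 2
    then show ?thesis using flat_div_tendsto_0[of n]
      by (simp add: has_field_derivative_iff flat_def)
  next
    case 3
    have "((\<lambda>t. 0) has_real_derivative (flat (n + 2) t - real n * flat (n + 1) t)) (at t)"
      using 3 by (simp add: flat_def)
    then show ?thesis
      by (rule has_field_derivative_transform_within_open[where S="{..<0}"]) (use 3 in \<open>auto simp: flat_def\<close>)
  qed
qed

lemma Ck_flat: "Ck k (\<lambda>x::'a::euclidean_space. flat n (c * (x \<bullet> i) + d))"
proof (induction k arbitrary: n)
  case 0
  have "isCont (flat n) t" for t using flat_has_derivative by (rule DERIV_isCont)
  then have "continuous_on UNIV (flat n)" by (simp add: continuous_at_imp_continuous_on)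
  then have "continuous_on UNIV (\<lambda>x::'a. flat n (c * (x \<bullet> i) + d))"
    by (rule continuous_on_compose2) (auto intro!: continuous_intros)
  then show ?case by simp
next
  case (Suc k)
  define D where "D x = flat (n + 2) (c * (x \<bullet> i) + d) - real n * flat (n + 1) (c * (x \<bullet> i) + d)" for x :: 'a
  have der: "((\<lambda>x. flat n (c * (x \<bullet> i) + d)) has_derivative (\<lambda>h. D x * (c * (h \<bullet> i)))) (at x)" for x
  proof -
    have "((\<lambda>x. c * (x \<bullet> i) + d) has_derivative (\<lambda>h. c * (h \<bullet> i))) (at x)"
      by (auto intro!: derivative_eq_intros)
    from has_derivative_compose[OF this flat_has_derivative[unfolded has_field_derivative_def]]
    show ?thesis by (simp add: D_def mult.commute)
  qed
  have "Ck k (\<lambda>x. D x * (c * (j \<bullet> i)))" for j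
    unfolding D_def diff_conv_add_uminus mult_minus_left[symmetric]
    by (intro Ck_mult Ck_add Ck_const Suc)
  then show ?case using der by (auto simp: frechet_derivative_eqI[OF der] differentiable_def)
qed

text \<open>This is positive exactly on \<open>box a b\<close>. The factor \<open>Suc n\<close> makes each argument of \<open>flat 0\<close> large at points
  inside the box, where \<open>exp (- 1 / t)\<close> is close to 1; so the bumps converge to the indicator of the box
  and are all bounded by it.\<close>

definition bump :: "'a::euclidean_space \<Rightarrow> 'a \<Rightarrow> nat \<Rightarrow> 'a \<Rightarrow> real" where
  "bump a b n x = (\<Prod>i\<in>Basis. flat 0 (real (Suc n) * (x \<bullet> i - a \<bullet> i)) * flat 0 (real (Suc n) * (b \<bullet> i - x \<bullet> i)))"

lemma bump_nonzero_iff: "bump a b n x \<noteq> 0 \<longleftrightarrow> x \<in> box a b"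
  by (auto simp: bump_def mem_box flat_def zero_less_mult_iff)

lemma bump_bounded: "0 \<le> bump a b n x" "bump a b n x \<le> 1"
proof -
  have *: "0 \<le> flat 0 t" "flat 0 t \<le> 1" for t by (auto simp: flat_def)
  show "0 \<le> bump a b n x" unfolding bump_def by (intro prod_nonneg mult_nonneg_nonneg ballI *)
  show "bump a b n x \<le> 1" unfolding bump_def by (intro prod_le_1 conjI mult_le_one mult_nonneg_nonneg *)
qed

lemma Ck_bump: "Ck k (bump a b n)"
proof -
  have "Ck k (\<lambda>x. flat 0 (real (Suc n) * (x \<bullet> i) + real (Suc n) * (- (a \<bullet> i))) *
      flat 0 ((- real (Suc n)) * (x \<bullet> i) + real (Suc n) * (b \<bullet> i)))" for i
    by (intro Ck_mult Ck_flat)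
  then have "Ck k (\<lambda>x. flat 0 (real (Suc n) * (x \<bullet> i - a \<bullet> i)) * flat 0 (real (Suc n) * (b \<bullet> i - x \<bullet> i)))" for i
    by (simp add: algebra_simps)
  then show ?thesis unfolding bump_def by (intro Ck_prod)
qed

lemma test_fun_bump:
  assumes "cbox a b \<subseteq> \<Omega>"
  shows "test_fun \<Omega> (bump a b n)"
proof -
  have "closure {x. bump a b n x \<noteq> 0} \<subseteq> cbox a b"
    using bump_nonzero_iff[of a b n] box_subset_cbox[of a b]
    by (intro closure_minimal closed_cbox) auto
  moreover from this have "compact (closure {x. bump a b n x \<noteq> 0})"
    by (meson bounded_cbox bounded_subset closed_closure compact_eq_bounded_closed)
  ultimately show ?thesis using assms Ck_bump by (auto simp: test_fun_def)
qed

lemma bump_tendsto_indicator: "(\<lambda>n. bump a b n x) \<longlonglongrightarrow> indicator (box a b) x"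
proof (cases "x \<in> box a b")
  case False
  then show ?thesis using bump_nonzero_iff[of a b _ x] by simp
next
  case True
  have lim: "(\<lambda>n. flat 0 (real (Suc n) * t)) \<longlonglongrightarrow> 1" if "t > 0" for t
  proof -
    have "(\<lambda>n. exp (- (inverse (real (Suc n)) * inverse t))) \<longlonglongrightarrow> exp (- (0 * inverse t))"
      by (intro tendsto_intros LIMSEQ_inverse_real_of_nat)
    then show ?thesis using that by (simp add: flat_def zero_less_mult_iff del: of_nat_Suc)
  qed
  have "(\<lambda>n. bump a b n x) \<longlonglongrightarrow> (\<Prod>i\<in>(Basis::'a set). 1 * 1)"
    unfolding bump_def using True by (intro tendsto_prod tendsto_mult lim) (auto simp: mem_box)
  then show ?thesis using True by simp
qed

lemma square_integrable_compact_support: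
  fixes f :: "'a::euclidean_space \<Rightarrow> real"
  assumes f: "continuous_on UNIV f" and K: "compact K" and off: "\<And>x. x \<notin> K \<Longrightarrow> f x = 0" and \<Omega>: "open \<Omega>"
  shows "f \<in> L2 (vol \<Omega>)"
proof -
  have [measurable]: "f \<in> borel_measurable borel" using f by (rule borel_measurable_continuous_onI)
  have "integrable lborel (\<lambda>x. indicator K x *\<^sub>R (f x)\<^sup>2)"
    using K f by (intro borel_integrable_compact) (auto intro!: continuous_intros elim: continuous_on_subset)
  moreover have "(\<lambda>x. indicator K x *\<^sub>R (f x)\<^sup>2) = (\<lambda>x. (f x)\<^sup>2)" using off by (force simp: indicator_def)
  ultimately have int: "integrable lborel (\<lambda>x. (f x)\<^sup>2)" by simp
  have "integrable lborel (\<lambda>x. indicator \<Omega> x *\<^sub>R (f x)\<^sup>2)"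
    using \<Omega> by (intro integrable_mult_indicator int) auto
  then show ?thesis using \<Omega>
    by (auto simp: L2_def integrable_restrict_space intro: borel_measurable_vol)
qed

lemma test_fun_continuous: "test_fun \<Omega> \<phi> \<Longrightarrow> continuous_on UNIV \<phi>"
  using Ck_continuous[of 0 \<phi>] by (simp add: test_fun_def)

lemma test_fun_differentiable: "test_fun \<Omega> \<phi> \<Longrightarrow> \<phi> differentiable at x"
proof -
  assume "test_fun \<Omega> \<phi>"
  then have "Ck (Suc 0) \<phi>" unfolding test_fun_def by blast
  then show ?thesis by simp
qed

lemma test_fun_deriv_continuous:
  "test_fun \<Omega> \<phi> \<Longrightarrow> i \<in> Basis \<Longrightarrow> continuous_on UNIV (\<lambda>x. frechet_derivative \<phi> (at x) i)"
proof -
  assume "test_fun \<Omega> \<phi>" and i: "i \<in> Basis"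
  then have "Ck (Suc 0) \<phi>" unfolding test_fun_def by blast
  then show ?thesis using i by simp
qed

lemma test_fun_L2: "open \<Omega> \<Longrightarrow> test_fun \<Omega> \<phi> \<Longrightarrow> \<phi> \<in> L2 (vol \<Omega>)"
  using closure_subset[of "{x. \<phi> x \<noteq> 0}"]
  by (intro square_integrable_compact_support[of _ "closure {x. \<phi> x \<noteq> 0}"])
    (auto simp: test_fun_continuous test_fun_def)

lemma test_fun_deriv_L2:
  assumes "open \<Omega>" "test_fun \<Omega> \<phi>" "i \<in> Basis"
  shows "(\<lambda>x. frechet_derivative \<phi> (at x) i) \<in> L2 (vol \<Omega>)"
proof (rule square_integrable_compact_support[of _ "closure {x. \<phi> x \<noteq> 0}"])
  fix x assume x: "x \<notin> closure {x. \<phi> x \<noteq> 0}"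
  have "(\<phi> has_derivative (\<lambda>h. 0)) (at x)"
  proof (rule has_derivative_transform_within_open[of "\<lambda>x. 0" _ x UNIV "- closure {x. \<phi> x \<noteq> 0}"])
    fix y assume "y \<in> - closure {x. \<phi> x \<noteq> 0}"
    then show "0 = \<phi> y" using closure_subset[of "{x. \<phi> x \<noteq> 0}"] by auto
  qed (use x in auto)
  then show "frechet_derivative \<phi> (at x) i = 0" by (simp add: frechet_derivative_eqI)
qed (use assms test_fun_deriv_continuous in \<open>auto simp: test_fun_def\<close>)

text \<open>The boxes are an intersection-stable generator of the Borel sets, and the sets over which \<open>v\<close>
  has integral zero form a Dynkin system.\<close>

lemma AE_zero_if_box_integrals_zero:
  fixes v :: "'a::euclidean_space \<Rightarrow> real"
  assumes v: "integrable lborel v" and tot: "(LINT x|lborel. v x) = 0"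
    and box: "\<And>c d. (LINT x|lborel. indicator (box c d) x * v x) = 0"
  shows "AE x in lborel. v x = 0"
proof -
  have zero: "(LINT x|lborel. indicator A x * v x) = 0" if "A \<in> sets borel" for A
  proof -
    have "Int_stable (range (\<lambda>(a, b). box a b :: 'a set))"
      by (auto simp: Int_stable_def box_Int_box)
    moreover have "range (\<lambda>(a, b). box a b :: 'a set) \<subseteq> Pow UNIV" by simp
    moreover have "A \<in> sigma_sets UNIV (range (\<lambda>(a, b). box a b))"
      using that by (simp add: borel_eq_box)
    ultimately show ?thesis
    proof (induction rule: sigma_sets_induct_disjoint)
      case (basic A) then show ?case using box by auto
    next
      case (compl A)
      then have A: "A \<in> sets borel" by (simp add: borel_eq_box)
      have "indicator (UNIV - A) x * v x = v x - indicator A x * v x" for x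
        by (auto simp: indicator_def)
      then show ?case
        using compl tot integrable_real_mult_indicator[of A lborel v] v A by (simp add: mult.commute)
    next
      case (union A)
      have A: "A i \<in> sets borel" for i using union by (auto simp: borel_eq_box)
      have "(LINT x:(\<Union>i. A i)|lborel. v x) = (\<Sum>i. (LINT x:(A i)|lborel. v x))"
        using union A v
        by (intro lebesgue_integral_countable_add)
          (auto simp: disjoint_family_on_def set_integrable_def intro!: integrable_mult_indicator[where f=v, simplified])
      then show ?case using union by (simp add: set_lebesgue_integral_def)
    qed auto
  qed
  show ?thesis
    using sigma_finite_measure.density_unique_banach[OF sigma_finite_lborel, of v "\<lambda>x. 0"] v zero by (simp add: set_lebesgue_integral_def)
qed

text \<open>Testing against bumps gives, by dominated convergence, zero integrals over all boxes whose
  closure lies in \<open>\<Omega>\<close>. On one such box this makes \<open>w\<close> vanish almost everywhere, and by Lindelof countably many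
  of them cover \<open>\<Omega>\<close>.\<close>

lemma fundamental_lemma:
  fixes w :: "'a::euclidean_space \<Rightarrow> real"
  assumes \<Omega>: "open \<Omega>" and w: "w \<in> L2 (vol \<Omega>)"
    and zero: "\<And>\<phi>. test_fun \<Omega> \<phi> \<Longrightarrow> (LINT x|vol \<Omega>. w x * \<phi> x) = 0"
  shows "AE x in vol \<Omega>. w x = 0"
proof -
  have [measurable]: "\<Omega> \<in> sets borel" using \<Omega> by simp
  have wm[measurable]: "w \<in> borel_measurable (vol \<Omega>)" using w by (rule L2_measurable)
  have box_L2: "indicator (cbox a b) \<in> L2 (vol \<Omega>)" for a b
  proof -
    have "integrable lborel (\<lambda>x. indicator (\<Omega> \<inter> cbox a b) x :: real)"
      using emeasure_bounded_finite[of "\<Omega> \<inter> cbox a b"] by (intro integrable_real_indicator) (auto simp: bounded_Int)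
    moreover have "(\<lambda>x. indicator \<Omega> x *\<^sub>R (indicator (cbox a b) x)\<^sup>2) = (\<lambda>x. indicator (\<Omega> \<inter> cbox a b) x :: real)"
      by (auto simp: indicator_def)
    ultimately show ?thesis
      by (auto simp: L2_def integrable_restrict_space intro!: borel_measurable_vol)
  qed
  have cint: "integrable (vol \<Omega>) (\<lambda>x. \<bar>w x\<bar> * indicator (cbox a b) x)" for a b
    using L2_mult_integrable[OF w box_L2, of a b] by (auto simp: abs_mult dest: integrable_abs)
  have bint: "integrable (vol \<Omega>) (\<lambda>x. w x * indicator (box a b) x)" for a b
  proof (rule Bochner_Integration.integrable_bound[OF cint[of a b]])
    have "(indicator (box a b) :: 'a \<Rightarrow> real) \<in> borel_measurable (vol \<Omega>)"
      by (intro borel_measurable_vol) simp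
    then show "(\<lambda>x. w x * indicator (box a b) x) \<in> borel_measurable (vol \<Omega>)"
      by (intro borel_measurable_times wm)
  qed (use box_subset_cbox[of a b] in \<open>auto intro!: AE_I2 simp: abs_mult split: split_indicator\<close>)
  have box0: "(LINT x|vol \<Omega>. w x * indicator (box a b) x) = 0" if "cbox a b \<subseteq> \<Omega>" for a b
  proof -
    have "(\<lambda>n. LINT x|vol \<Omega>. w x * bump a b n x) \<longlonglongrightarrow> (LINT x|vol \<Omega>. w x * indicator (box a b) x)"
    proof (rule integral_dominated_convergence[where w="\<lambda>x. \<bar>w x\<bar> * indicator (cbox a b) x"])
      show "AE x in vol \<Omega>. (\<lambda>n. w x * bump a b n x) \<longlonglongrightarrow> w x * indicator (box a b) x"
        by (intro AE_I2 tendsto_mult tendsto_const bump_tendsto_indicator)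
      show "AE x in vol \<Omega>. norm (w x * bump a b n x) \<le> \<bar>w x\<bar> * indicator (cbox a b) x" for n
      proof (rule AE_I2)
        fix x
        show "norm (w x * bump a b n x) \<le> \<bar>w x\<bar> * indicator (cbox a b) x"
          using bump_nonzero_iff[of a b n x] bump_bounded[where a=a and b=b and n=n and x=x] box_subset_cbox[of a b]
          by (cases "x \<in> cbox a b") (auto simp: abs_mult intro: mult_left_le)
      qed
      show "(\<lambda>x. w x * bump a b n x) \<in> borel_measurable (vol \<Omega>)" for n
        by (intro borel_measurable_times wm borel_measurable_vol borel_measurable_continuous_onI Ck_continuous[OF Ck_bump])
      show "(\<lambda>x. w x * indicator (box a b) x) \<in> borel_measurable (vol \<Omega>)"
        using bint by (rule borel_measurable_integrable)
    qed (rule cint)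
    moreover have "(LINT x|vol \<Omega>. w x * bump a b n x) = 0" for n
      using zero[OF test_fun_bump[OF that]] .
    ultimately have "(\<lambda>n::nat. 0) \<longlonglongrightarrow> (LINT x|vol \<Omega>. w x * indicator (box a b) x)" by simp
    then show ?thesis by (rule LIMSEQ_unique[OF _ tendsto_const])
  qed
  have AE_box: "AE x in lborel. x \<in> box a b \<longrightarrow> w x = 0" if ab: "cbox a b \<subseteq> \<Omega>" for a b
  proof -
    define v where "v x = indicator \<Omega> x *\<^sub>R (w x * indicator (box a b) x)" for x
    have vi: "integrable lborel v"
      using bint[of a b] by (simp add: integrable_restrict_space v_def[abs_def])
    have bx: "(LINT x|lborel. indicator (box c d) x * v x) = 0" for c d
    proof -
      obtain e f where ef: "box a b \<inter> box c d = box e f" "cbox e f \<subseteq> cbox a b"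
        by (rule that[OF box_Int_box]) (auto simp: mem_box)
      have "(LINT x|lborel. indicator (box c d) x * v x) = (LINT x|lborel. indicator \<Omega> x *\<^sub>R (w x * indicator (box e f) x))"
        unfolding ef(1)[symmetric] by (intro Bochner_Integration.integral_cong) (auto simp: v_def indicator_def)
      also have "\<dots> = (LINT x|vol \<Omega>. w x * indicator (box e f) x)"
        by (simp add: integral_restrict_space)
      also have "\<dots> = 0" using ef(2) ab by (intro box0) auto
      finally show ?thesis .
    qed
    have "(LINT x|lborel. v x) = 0"
      using box0[OF ab] by (simp add: integral_restrict_space v_def[abs_def])
    from AE_zero_if_box_integrals_zero[OF vi this bx]
    show ?thesis
    proof eventually_elim
      case (elim x)
      then show ?case using ab box_subset_cbox[of a b] by (auto simp: v_def indicator_def)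
    qed
  qed
  define F where "F = {box a b | a b. cbox a b \<subseteq> \<Omega>}"
  have UF: "\<Union>F = \<Omega>"
  proof (intro equalityI subsetI)
    fix x assume "x \<in> \<Omega>"
    then obtain a b where "x \<in> box a b" "cbox a b \<subseteq> \<Omega>"
      using \<Omega> by (meson open_contains_cbox)
    then show "x \<in> \<Union>F" by (auto simp: F_def)
  qed (use box_subset_cbox in \<open>force simp: F_def\<close>)
  have "\<And>S. S \<in> F \<Longrightarrow> open S" by (auto simp: F_def)
  from Lindelof[of F, OF this] obtain F' where F': "F' \<subseteq> F" "countable F'" "\<Union>F' = \<Union>F" by blast
  have "AE x in lborel. \<forall>S\<in>F'. x \<in> S \<longrightarrow> w x = 0"
    unfolding AE_ball_countable[OF F'(2)]
  proof
    fix S assume "S \<in> F'"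
    then obtain a b where "S = box a b" "cbox a b \<subseteq> \<Omega>" using F'(1) by (auto simp: F_def)
    then show "AE x in lborel. x \<in> S \<longrightarrow> w x = 0" using AE_box by simp
  qed
  then have "AE x in lborel. x \<in> \<Omega> \<longrightarrow> w x = 0"
    by eventually_elim (use F'(3) UF in blast)
  then show ?thesis by (simp add: AE_restrict_space_iff)
qed

section \<open>Weak gradients and the space $H^1$\<close>
lemma L2_component:
  assumes "G \<in> borel_measurable M" "integrable M (\<lambda>x. (norm (G x :: 'b::euclidean_space))\<^sup>2)" "i \<in> Basis"
  shows "(\<lambda>x. G x \<bullet> i) \<in> L2 M"
proof -
  have "integrable M (\<lambda>x. (G x \<bullet> i)\<^sup>2)"
    using assms(1,3) by (intro Bochner_Integration.integrable_bound[OF assms(2)])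
      (auto intro!: AE_I2 abs_le_square_iff[THEN iffD1] simp: Basis_le_norm)
  then show ?thesis using assms(1) by (auto simp: L2_def)
qed

lemma L2_null_iff: "u \<in> L2 M \<Longrightarrow> l2_ip M u u = 0 \<longleftrightarrow> (AE x in M. u x = 0)"
  using integral_nonneg_eq_0_iff_AE[of M "\<lambda>x. (u x)\<^sup>2"]
  by (auto simp: L2_def l2_ip_def power2_eq_square)

lemma l2_ip_diff_self: "l2_ip M (\<lambda>x. u x - v x) (\<lambda>x. u x - v x) = (LINT x|M. (norm (u x - v x))\<^sup>2)"
  by (simp add: l2_ip_def power2_eq_square)

text \<open>Hence the gradient that \<^const>\<open>wgrad\<close> chooses is determined almost everywhere.\<close>

lemma weak_gradient_unique:
  assumes \<Omega>: "open \<Omega>" and G: "has_weak_gradient \<Omega> u G" and K: "has_weak_gradient \<Omega> u K"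
  shows "AE x in vol \<Omega>. G x = K x"
proof -
  have "AE x in vol \<Omega>. \<forall>i\<in>Basis. (G x - K x) \<bullet> i = 0"
  proof (subst AE_finite_all[OF finite_Basis], rule ballI, rule fundamental_lemma[OF \<Omega>])
    fix i :: 'a assume i: "i \<in> Basis"
    have Gi: "(\<lambda>x. G x \<bullet> i) \<in> L2 (vol \<Omega>)" and Ki: "(\<lambda>x. K x \<bullet> i) \<in> L2 (vol \<Omega>)"
      using G K i by (auto simp: has_weak_gradient_def intro!: L2_component)
    show "(\<lambda>x. (G x - K x) \<bullet> i) \<in> L2 (vol \<Omega>)"
      unfolding inner_diff_left by (rule l2.diff_mem[OF Gi Ki])
    fix \<phi> assume \<phi>: "test_fun \<Omega> \<phi>"
    have "(LINT x|vol \<Omega>. u x * frechet_derivative \<phi> (at x) i) = - (LINT x|vol \<Omega>. (G x \<bullet> i) * \<phi> x)"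
      "(LINT x|vol \<Omega>. u x * frechet_derivative \<phi> (at x) i) = - (LINT x|vol \<Omega>. (K x \<bullet> i) * \<phi> x)"
      using G K \<phi> i unfolding has_weak_gradient_def by blast+
    then have "(LINT x|vol \<Omega>. (G x \<bullet> i) * \<phi> x) = (LINT x|vol \<Omega>. (K x \<bullet> i) * \<phi> x)"
      by simp
    then show "(LINT x|vol \<Omega>. (G x - K x) \<bullet> i * \<phi> x) = 0"
      using l2.diff_left[OF Gi Ki test_fun_L2[OF \<Omega> \<phi>]] by (simp add: l2_ip_def inner_diff_left)
  qed
  then show ?thesis
    by eventually_elim (auto intro: euclidean_eqI simp: inner_diff_left)
qed

lemma weak_gradient_add:
  assumes \<Omega>: "open \<Omega>" and u: "u \<in> L2 (vol \<Omega>)" "has_weak_gradient \<Omega> u G"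
    and v: "v \<in> L2 (vol \<Omega>)" "has_weak_gradient \<Omega> v K"
  shows "has_weak_gradient \<Omega> (\<lambda>x. u x + v x) (\<lambda>x. G x + K x)"
  unfolding has_weak_gradient_def
proof (intro conjI allI impI ballI)
  have G: "G \<in> borel_measurable (vol \<Omega>)" "integrable (vol \<Omega>) (\<lambda>x. (norm (G x))\<^sup>2)"
    and K: "K \<in> borel_measurable (vol \<Omega>)" "integrable (vol \<Omega>) (\<lambda>x. (norm (K x))\<^sup>2)"
    using u v by (auto simp: has_weak_gradient_def)
  show "(\<lambda>x. G x + K x) \<in> borel_measurable (vol \<Omega>)" using G K by (intro borel_measurable_add)
  show "integrable (vol \<Omega>) (\<lambda>x. (norm (G x + K x))\<^sup>2)" by (intro square_integrable_add G K)
  fix \<phi> i assume \<phi>: "test_fun \<Omega> \<phi>" and i: "i \<in> (Basis :: 'a set)"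
  show "(LINT x|vol \<Omega>. (u x + v x) * frechet_derivative \<phi> (at x) i) = - (LINT x|vol \<Omega>. (G x + K x) \<bullet> i * \<phi> x)"
    using l2.add_left[OF u(1) v(1) test_fun_deriv_L2[OF \<Omega> \<phi> i]]
      l2.add_left[OF L2_component[OF G i] L2_component[OF K i] test_fun_L2[OF \<Omega> \<phi>]] u(2) v(2) \<phi> i
    by (simp add: l2_ip_def has_weak_gradient_def inner_add_left)
qed

lemma weak_gradient_scale:
  assumes "has_weak_gradient \<Omega> u G"
  shows "has_weak_gradient \<Omega> (\<lambda>x. c * u x) (\<lambda>x. c *\<^sub>R G x)"
  using assms unfolding has_weak_gradient_def
  by (auto simp: mult.assoc power_mult_distrib)

lemma weak_gradient_zero: "has_weak_gradient \<Omega> (\<lambda>x. 0) (\<lambda>x. 0)"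
  by (simp add: has_weak_gradient_def)

lemma weak_gradient_sum:
  assumes \<Omega>: "open \<Omega>" and u: "\<And>i. i \<in> I \<Longrightarrow> u i \<in> L2 (vol \<Omega>)" "\<And>i. i \<in> I \<Longrightarrow> has_weak_gradient \<Omega> (u i) (G i)"
  shows "has_weak_gradient \<Omega> (\<lambda>x. \<Sum>i\<in>I. c i * u i x) (\<lambda>x. \<Sum>i\<in>I. c i *\<^sub>R G i x)"
proof (cases "finite I")
  case True
  then show ?thesis using u
  proof (induction I)
    case (insert i I)
    have "has_weak_gradient \<Omega> (\<lambda>x. c i * u i x + (\<Sum>i\<in>I. c i * u i x)) (\<lambda>x. c i *\<^sub>R G i x + (\<Sum>i\<in>I. c i *\<^sub>R G i x))"
      using insert.prems insert.IH
      by (intro weak_gradient_add[OF \<Omega>] l2.scale_mem l2.sum_mem weak_gradient_scale) auto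
    then show ?case using insert.hyps by simp
  qed (simp add: weak_gradient_zero)
qed (simp add: weak_gradient_zero)

lemma weak_gradient_limit:
  assumes \<Omega>: "open \<Omega>" and u: "\<And>n. u n \<in> L2 (vol \<Omega>)" and G: "\<And>n. has_weak_gradient \<Omega> (u n) (G n)"
    and w: "w \<in> L2 (vol \<Omega>)" and K: "K \<in> borel_measurable (vol \<Omega>)" "integrable (vol \<Omega>) (\<lambda>x. (norm (K x))\<^sup>2)"
    and lim: "(\<lambda>n. LINT x|vol \<Omega>. (norm (u n x - w x))\<^sup>2) \<longlonglongrightarrow> 0"
      "(\<lambda>n. LINT x|vol \<Omega>. (norm (G n x - K x))\<^sup>2) \<longlonglongrightarrow> 0"
  shows "has_weak_gradient \<Omega> w K"
  unfolding has_weak_gradient_def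
proof (intro conjI allI impI ballI K)
  fix \<phi> i assume \<phi>: "test_fun \<Omega> \<phi>" and i: "i \<in> (Basis :: 'a set)"
  have GL: "G n \<in> borel_measurable (vol \<Omega>)" "integrable (vol \<Omega>) (\<lambda>x. (norm (G n x))\<^sup>2)" for n
    using G by (auto simp: has_weak_gradient_def)
  have 1: "(\<lambda>n. LINT x|vol \<Omega>. u n x * frechet_derivative \<phi> (at x) i) \<longlonglongrightarrow> (LINT x|vol \<Omega>. w x * frechet_derivative \<phi> (at x) i)"
    using l2.tendsto_ip_left[OF u w test_fun_deriv_L2[OF \<Omega> \<phi> i]] lim(1)
    by (simp add: l2_ip_diff_self) (simp add: l2_ip_def)
  have \<phi>2: "(\<lambda>x. \<phi> x *\<^sub>R i) \<in> borel_measurable (vol \<Omega>)" "integrable (vol \<Omega>) (\<lambda>x. (norm (\<phi> x *\<^sub>R i))\<^sup>2)"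
    using test_fun_L2[OF \<Omega> \<phi>] i by (auto simp: L2_def)
  have "(\<lambda>n. LINT x|vol \<Omega>. G n x \<bullet> (\<phi> x *\<^sub>R i)) \<longlonglongrightarrow> (LINT x|vol \<Omega>. K x \<bullet> (\<phi> x *\<^sub>R i))"
    by (rule tendsto_integral_inner[OF GL(1) K(1) \<phi>2(1) GL(2) K(2) \<phi>2(2) lim(2)])
  then have 2: "(\<lambda>n. - (LINT x|vol \<Omega>. (G n x \<bullet> i) * \<phi> x)) \<longlonglongrightarrow> - (LINT x|vol \<Omega>. (K x \<bullet> i) * \<phi> x)"
    by (intro tendsto_minus) (simp add: mult.commute)
  have "(LINT x|vol \<Omega>. u n x * frechet_derivative \<phi> (at x) i) = - (LINT x|vol \<Omega>. (G n x \<bullet> i) * \<phi> x)" for n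
    using G \<phi> i by (simp add: has_weak_gradient_def)
  with 1 2 show "(LINT x|vol \<Omega>. w x * frechet_derivative \<phi> (at x) i) = - (LINT x|vol \<Omega>. (K x \<bullet> i) * \<phi> x)"
    using LIMSEQ_unique by force
qed

lemma H1_I: "u \<in> L2 (vol \<Omega>) \<Longrightarrow> has_weak_gradient \<Omega> u G \<Longrightarrow> u \<in> H1 \<Omega>"
  by (auto simp: H1_def)

lemma H1_L2: "u \<in> H1 \<Omega> \<Longrightarrow> u \<in> L2 (vol \<Omega>)"
  by (simp add: H1_def)

lemma H10_H1: "u \<in> H10 \<Omega> \<Longrightarrow> u \<in> H1 \<Omega>"
  by (simp add: H10_def)

lemma has_weak_gradient_wgrad: "u \<in> H1 \<Omega> \<Longrightarrow> has_weak_gradient \<Omega> u (wgrad \<Omega> u)"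
  unfolding wgrad_def H1_def by (auto intro: someI[of "has_weak_gradient \<Omega> u"])

lemma wgrad_measurable: "u \<in> H1 \<Omega> \<Longrightarrow> wgrad \<Omega> u \<in> borel_measurable (vol \<Omega>)"
  and wgrad_square_integrable: "u \<in> H1 \<Omega> \<Longrightarrow> integrable (vol \<Omega>) (\<lambda>x. (norm (wgrad \<Omega> u x))\<^sup>2)"
  using has_weak_gradient_wgrad by (auto simp: has_weak_gradient_def)

text \<open>The Dirichlet form may be computed with any weak gradients at hand, not only the chosen ones.\<close>

lemma grad_ip_eq:
  assumes \<Omega>: "open \<Omega>" and G: "has_weak_gradient \<Omega> u G" and K: "has_weak_gradient \<Omega> v K"
  shows "grad_ip \<Omega> u v = (LINT x|vol \<Omega>. G x \<bullet> K x)"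
proof -
  have u: "has_weak_gradient \<Omega> u (wgrad \<Omega> u)" and v: "has_weak_gradient \<Omega> v (wgrad \<Omega> v)"
    unfolding wgrad_def using G K by (blast intro: someI[of "has_weak_gradient \<Omega> _"])+
  have m: "G \<in> borel_measurable (vol \<Omega>)" "K \<in> borel_measurable (vol \<Omega>)"
    "wgrad \<Omega> u \<in> borel_measurable (vol \<Omega>)" "wgrad \<Omega> v \<in> borel_measurable (vol \<Omega>)"
    using u v G K by (auto simp: has_weak_gradient_def)
  have "AE x in vol \<Omega>. wgrad \<Omega> u x \<bullet> wgrad \<Omega> v x = G x \<bullet> K x"
    using weak_gradient_unique[OF \<Omega> u G] weak_gradient_unique[OF \<Omega> v K] by eventually_elim simp
  then show ?thesis unfolding grad_ip_def
    by (intro integral_cong_AE borel_measurable_inner m)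
qed

lemma grad_semi_inner_space:
  assumes \<Omega>: "open \<Omega>"
  shows "semi_inner_space (H1 \<Omega>) (grad_ip \<Omega>)"
proof
  fix u v w :: "'a \<Rightarrow> real" and c :: real
  show "(\<lambda>x. 0) \<in> H1 \<Omega>" by (intro H1_I[OF l2.zero_mem weak_gradient_zero])
  assume u: "u \<in> H1 \<Omega>"
  note uG = has_weak_gradient_wgrad[OF u]
  note u2 = wgrad_measurable[OF u] wgrad_square_integrable[OF u]
  show "(\<lambda>x. c * u x) \<in> H1 \<Omega>"
    by (rule H1_I[OF l2.scale_mem[OF H1_L2[OF u]] weak_gradient_scale[OF uG]])
  show "0 \<le> grad_ip \<Omega> u u" by (simp add: grad_ip_def)
  { assume w: "w \<in> H1 \<Omega>"
    show "grad_ip \<Omega> (\<lambda>x. c * u x) w = c * grad_ip \<Omega> u w"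
      using grad_ip_eq[OF \<Omega> weak_gradient_scale[OF uG] has_weak_gradient_wgrad[OF w]]
      by (simp add: grad_ip_def) }
  assume v: "v \<in> H1 \<Omega>"
  note vG = has_weak_gradient_wgrad[OF v]
  note v2 = wgrad_measurable[OF v] wgrad_square_integrable[OF v]
  note uvG = weak_gradient_add[OF \<Omega> H1_L2[OF u] uG H1_L2[OF v] vG]
  show "(\<lambda>x. u x + v x) \<in> H1 \<Omega>"
    by (rule H1_I[OF l2.add_mem[OF H1_L2[OF u] H1_L2[OF v]] uvG])
  show "grad_ip \<Omega> u v = grad_ip \<Omega> v u" by (simp add: grad_ip_def inner_commute)
  assume w: "w \<in> H1 \<Omega>"
  note w2 = wgrad_measurable[OF w] wgrad_square_integrable[OF w]
  show "grad_ip \<Omega> (\<lambda>x. u x + v x) w = grad_ip \<Omega> u w + grad_ip \<Omega> v w"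
    using grad_ip_eq[OF \<Omega> uvG has_weak_gradient_wgrad[OF w]]
      integrable_inner_square[OF u2(1) w2(1) u2(2) w2(2)] integrable_inner_square[OF v2(1) w2(1) v2(2) w2(2)]
    by (simp add: grad_ip_def inner_add_left)
qed

lemma h1_semi_inner_space:
  assumes \<Omega>: "open \<Omega>"
  shows "semi_inner_space (H1 \<Omega>) (h1_ip \<Omega>)"
proof -
  interpret g: semi_inner_space "H1 \<Omega>" "grad_ip \<Omega>" using \<Omega> by (rule grad_semi_inner_space)
  show ?thesis
    by standard (auto simp: h1_ip_def g.zero_mem g.add_mem g.scale_mem H1_L2 g.add_left g.scale_left g.nonneg
        l2.add_left l2.scale_left l2.nonneg distrib_left
        l2.sym[OF H1_L2 H1_L2] g.sym)
qed

lemma l2_le_h1: "l2_ip (vol \<Omega>) u u \<le> h1_ip \<Omega> u u"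
  by (simp add: h1_ip_def grad_ip_def)

lemma h1_null_iff:
  assumes \<Omega>: "open \<Omega>" and u: "u \<in> H1 \<Omega>"
  shows "h1_ip \<Omega> u u = 0 \<longleftrightarrow> (AE x in vol \<Omega>. u x = 0)"
proof
  assume "h1_ip \<Omega> u u = 0"
  then have "l2_ip (vol \<Omega>) u u = 0" using l2_le_h1[of \<Omega> u] l2.nonneg[OF H1_L2[OF u]] by simp
  then show "AE x in vol \<Omega>. u x = 0" using L2_null_iff[OF H1_L2[OF u]] by simp
next
  assume z: "AE x in vol \<Omega>. u x = 0"
  have um: "u \<in> borel_measurable (vol \<Omega>)" using u by (simp add: H1_def L2_def)
  have "has_weak_gradient \<Omega> u (\<lambda>x. 0)"
    unfolding has_weak_gradient_def
  proof (intro conjI allI impI ballI)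
    fix \<phi> i assume \<phi>: "test_fun \<Omega> \<phi>" and i: "i \<in> (Basis :: 'a set)"
    have "(LINT x|vol \<Omega>. u x * frechet_derivative \<phi> (at x) i) = (LINT x|vol \<Omega>. 0)"
      using z um L2_measurable[OF test_fun_deriv_L2[OF \<Omega> \<phi> i]] by (intro integral_cong_AE) auto
    then show "(LINT x|vol \<Omega>. u x * frechet_derivative \<phi> (at x) i) = - (LINT x|vol \<Omega>. (0 \<bullet> i) * \<phi> x)" by simp
  qed auto
  then have "grad_ip \<Omega> u u = 0" using grad_ip_eq[OF \<Omega>] by fastforce
  then show "h1_ip \<Omega> u u = 0" using z L2_null_iff[OF H1_L2[OF u]] by (simp add: h1_ip_def)
qed

lemma H1_complete:
  assumes \<Omega>: "open \<Omega>" and u: "\<And>n. u n \<in> H1 \<Omega>"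
    and cauchy: "\<And>e. e > 0 \<Longrightarrow> \<exists>N. \<forall>m\<ge>N. \<forall>n\<ge>N. h1_ip \<Omega> (\<lambda>x. u m x - u n x) (\<lambda>x. u m x - u n x) < e"
  obtains w where "w \<in> H1 \<Omega>" "ip_tendsto (h1_ip \<Omega>) u w"
proof -
  interpret g: semi_inner_space "H1 \<Omega>" "grad_ip \<Omega>" using \<Omega> by (rule grad_semi_inner_space)
  note uL = H1_L2[OF u]
  note G = wgrad_measurable[OF u] wgrad_square_integrable[OF u]
  have diffG: "has_weak_gradient \<Omega> (\<lambda>x. a x - b x) (\<lambda>x. A x - B x)"
    if "a \<in> H1 \<Omega>" "has_weak_gradient \<Omega> a A" "b \<in> H1 \<Omega>" "has_weak_gradient \<Omega> b B" for a A b B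
    using weak_gradient_add[OF \<Omega> H1_L2[OF that(1)] that(2) l2.scale_mem[OF H1_L2[OF that(3)]] weak_gradient_scale[OF that(4)], of "-1"]
    by simp
  have gd: "grad_ip \<Omega> (\<lambda>x. u m x - u n x) (\<lambda>x. u m x - u n x) = (LINT x|vol \<Omega>. (norm (wgrad \<Omega> (u m) x - wgrad \<Omega> (u n) x))\<^sup>2)" for m n
    using grad_ip_eq[OF \<Omega> diffG diffG] u has_weak_gradient_wgrad[OF u] by (simp add: power2_norm_eq_inner)
  have h1: "h1_ip \<Omega> (\<lambda>x. u m x - u n x) (\<lambda>x. u m x - u n x)
     = (LINT x|vol \<Omega>. (norm (u m x - u n x))\<^sup>2) + (LINT x|vol \<Omega>. (norm (wgrad \<Omega> (u m) x - wgrad \<Omega> (u n) x))\<^sup>2)" for m n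
    by (simp add: h1_ip_def gd l2_ip_diff_self)
  have "\<exists>N. \<forall>m\<ge>N. \<forall>n\<ge>N. (LINT x|vol \<Omega>. (norm (u m x - u n x))\<^sup>2) < e" if e: "e > 0" for e
  proof -
    obtain N where N: "\<And>m n. m \<ge> N \<Longrightarrow> n \<ge> N \<Longrightarrow> h1_ip \<Omega> (\<lambda>x. u m x - u n x) (\<lambda>x. u m x - u n x) < e"
      using cauchy[OF e] by blast
    have "(LINT x|vol \<Omega>. (norm (u m x - u n x))\<^sup>2) < e" if "m \<ge> N" "n \<ge> N" for m n
    proof -
      have "0 \<le> (LINT x|vol \<Omega>. (norm (wgrad \<Omega> (u m) x - wgrad \<Omega> (u n) x))\<^sup>2)" by simp
      then show ?thesis using N[OF that] h1[of m n] by linarith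
    qed
    then show ?thesis by blast
  qed
  from riesz_fischer[OF L2_measurable[OF uL] _ this] uL
  obtain w where w: "w \<in> borel_measurable (vol \<Omega>)" "integrable (vol \<Omega>) (\<lambda>x. (norm (w x))\<^sup>2)"
    "(\<lambda>n. LINT x|vol \<Omega>. (norm (u n x - w x))\<^sup>2) \<longlonglongrightarrow> 0" by (auto simp: L2_iff)
  then have wL: "w \<in> L2 (vol \<Omega>)" by (simp add: L2_iff)
  have "\<exists>N. \<forall>m\<ge>N. \<forall>n\<ge>N. (LINT x|vol \<Omega>. (norm (wgrad \<Omega> (u m) x - wgrad \<Omega> (u n) x))\<^sup>2) < e" if e: "e > 0" for e
  proof -
    obtain N where N: "\<And>m n. m \<ge> N \<Longrightarrow> n \<ge> N \<Longrightarrow> h1_ip \<Omega> (\<lambda>x. u m x - u n x) (\<lambda>x. u m x - u n x) < e"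
      using cauchy[OF e] by blast
    have "(LINT x|vol \<Omega>. (norm (wgrad \<Omega> (u m) x - wgrad \<Omega> (u n) x))\<^sup>2) < e" if "m \<ge> N" "n \<ge> N" for m n
    proof -
      have "0 \<le> (LINT x|vol \<Omega>. (norm (u m x - u n x))\<^sup>2)" by simp
      then show ?thesis using N[OF that] h1[of m n] by linarith
    qed
    then show ?thesis by blast
  qed
  note Gcauchy = this
  obtain K where K: "K \<in> borel_measurable (vol \<Omega>)" "integrable (vol \<Omega>) (\<lambda>x. (norm (K x))\<^sup>2)"
    "(\<lambda>n. LINT x|vol \<Omega>. (norm (wgrad \<Omega> (u n) x - K x))\<^sup>2) \<longlonglongrightarrow> 0"
    by (rule riesz_fischer[OF G Gcauchy])
  have wK: "has_weak_gradient \<Omega> w K"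
    by (rule weak_gradient_limit[OF \<Omega> uL has_weak_gradient_wgrad[OF u] wL K(1,2) w(3) K(3)])
  then have wH: "w \<in> H1 \<Omega>" by (rule H1_I[OF wL])
  have "h1_ip \<Omega> (\<lambda>x. u n x - w x) (\<lambda>x. u n x - w x)
     = (LINT x|vol \<Omega>. (norm (u n x - w x))\<^sup>2) + (LINT x|vol \<Omega>. (norm (wgrad \<Omega> (u n) x - K x))\<^sup>2)" for n
    using diffG[OF u has_weak_gradient_wgrad[OF u] wH wK]
    by (simp add: h1_ip_def l2_ip_diff_self grad_ip_eq[OF \<Omega>] power2_norm_eq_inner)
  then have "ip_tendsto (h1_ip \<Omega>) u w"
    using tendsto_add[OF w(3) K(3)] by (simp add: ip_tendsto_def)
  with wH show ?thesis by (rule that)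
qed

section \<open>An orthonormal basis of $H^1$\<close>
text \<open>Gaussian elimination: fewer homogeneous equations than unknowns have a nontrivial solution.\<close>

lemma underdetermined_system:
  fixes a :: "'k \<Rightarrow> 'i \<Rightarrow> real"
  assumes "finite I" "finite K" "card I < card K"
  shows "\<exists>c. (\<exists>k\<in>K. c k \<noteq> 0) \<and> (\<forall>i\<in>I. (\<Sum>k\<in>K. c k * a k i) = 0)"
  using assms
proof (induction I arbitrary: K a rule: finite_induct)
  case empty
  then obtain k where "k \<in> K" by fastforce
  then show ?case by (intro exI[of _ "\<lambda>_. 1"]) auto
next
  case (insert i I)
  show ?case
  proof (cases "\<forall>k\<in>K. a k i = 0")
    case True
    have "card I < card K" using insert by simp
    from insert.IH[OF insert.prems(1) this, of a] True show ?thesis by auto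
  next
    case False
    then obtain p where p: "p \<in> K" "a p i \<noteq> 0" by blast
    define K' where "K' = K - {p}"
    have K': "finite K'" "card I < card K'" using insert p by (auto simp: K'_def)
    from insert.IH[OF this, of "\<lambda>k j. a k j - a k i / a p i * a p j"]
    obtain c where c: "\<exists>k\<in>K'. c k \<noteq> 0" "\<And>j. j \<in> I \<Longrightarrow> (\<Sum>k\<in>K'. c k * (a k j - a k i / a p i * a p j)) = 0" by blast
    \<comment> \<open>The eliminated unknown is determined by equation \<open>i\<close>.\<close>
    define cp where "cp = - (\<Sum>k\<in>K'. c k * a k i) / a p i"
    have split: "(\<Sum>k\<in>K. (c(p := cp)) k * a k j) = cp * a p j + (\<Sum>k\<in>K'. c k * a k j)" for j
      using insert.prems(1) p(1) by (simp add: K'_def sum.remove[of K p])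
    show ?thesis
    proof (intro exI[of _ "c(p := cp)"] conjI ballI)
      show "\<exists>k\<in>K. (c(p := cp)) k \<noteq> 0" using c(1) by (auto simp: K'_def)
      fix j assume "j \<in> insert i I"
      then consider "j = i" | "j \<in> I" by blast
      then show "(\<Sum>k\<in>K. (c(p := cp)) k * a k j) = 0"
      proof cases
        case 1
        have "cp * a p i + (\<Sum>k\<in>K'. c k * a k i) = 0" unfolding cp_def using p(2) by simp
        with 1 show ?thesis by (simp only: split)
      next
        case 2
        have "(\<Sum>k\<in>K'. c k * (a k j - a k i / a p i * a p j)) = (\<Sum>k\<in>K'. c k * a k j) - (\<Sum>k\<in>K'. c k * a k i) / a p i * a p j"
          by (simp add: right_diff_distrib sum_subtractf sum_divide_distrib sum_distrib_right mult.assoc)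
        then have "cp * a p j + (\<Sum>k\<in>K'. c k * a k j) = 0" unfolding cp_def using c(2)[OF 2] by simp
        then show ?thesis by (simp only: split)
      qed
    qed
  qed
qed

context semi_inner_space
begin

lemma ip_diff_null:
  assumes "a \<in> H" "v \<in> H" "ip v v = 0"
  shows "ip (\<lambda>x. a x - v x) (\<lambda>x. a x - v x) = ip a a"
  using assms null_left[of v a] sym[of v a] by (simp add: diff_left diff_right diff_mem)

lemma ip_diff_le:
  assumes "a \<in> H" "b \<in> H"
  shows "ip (\<lambda>x. a x - b x) (\<lambda>x. a x - b x) \<le> 2 * ip a a + 2 * ip b b"
  using assms nonneg[of "\<lambda>x. a x + b x"] sym[of a b]
  by (simp add: diff_left diff_right diff_mem add_left add_right add_mem)

text \<open>The partial Fourier sums are Cauchy by Bessel's inequality; the difference between \<open>u\<close> and their limit is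
  orthogonal to every \<open>f i\<close>, so its norm is zero.\<close>

lemma maximal_orthonormal_family_basis:
  assumes on: "orthonormal_family H ip f"
    and complete: "\<And>s. (\<And>n::nat. s n \<in> H) \<Longrightarrow>
      (\<And>e. e > 0 \<Longrightarrow> \<exists>N. \<forall>m\<ge>N. \<forall>n\<ge>N. ip (\<lambda>x. s m x - s n x) (\<lambda>x. s m x - s n x) < e) \<Longrightarrow>
      \<exists>w\<in>H. ip_tendsto ip s w"
    and maximal: "\<And>v. v \<in> H \<Longrightarrow> (\<And>i. ip v (f i) = 0) \<Longrightarrow> ip v v = 0"
  shows "orthonormal_basis H ip f"
  unfolding orthonormal_basis_def
proof (intro conjI on ballI)
  fix u assume u: "u \<in> H"
  have f: "f i \<in> H" and ff: "ip (f i) (f j) = (if i = j then 1 else 0)" for i j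
    using on by (auto simp: orthonormal_family_def)
  define s where "s n x = (\<Sum>i<n. ip u (f i) * f i x)" for n x
  define q where "q n = (\<Sum>i<n. (ip u (f i))\<^sup>2)" for n
  have s: "s n \<in> H" for n unfolding s_def by (intro sum_mem f)
  have step: "ip (\<lambda>x. s m x - s n x) (\<lambda>x. s m x - s n x) = \<bar>q m - q n\<bar>" for m n
  proof -
    have le: "ip (\<lambda>x. s n x - s m x) (\<lambda>x. s n x - s m x) = q n - q m" if "m \<le> n" for m n
    proof -
      have "s n x - s m x = (\<Sum>i\<in>{m..<n}. ip u (f i) * f i x)" for x
        using that unfolding s_def by (simp add: sum_diff_nat_ivl lessThan_atLeast0)
      then have "ip (\<lambda>x. s n x - s m x) (\<lambda>x. s n x - s m x) = (\<Sum>i\<in>{m..<n}. (ip u (f i))\<^sup>2)"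
        by (simp add: ip_sum_orthonormal f ff)
      also have "\<dots> = q n - q m"
        using that unfolding q_def by (simp add: sum_diff_nat_ivl lessThan_atLeast0)
      finally show ?thesis .
    qed
    have mono: "q m \<le> q n" if "m \<le> n" for m n
      unfolding q_def using that by (intro sum_mono2) auto
    have flip: "ip (\<lambda>x. s m x - s n x) (\<lambda>x. s m x - s n x) = ip (\<lambda>x. s n x - s m x) (\<lambda>x. s n x - s m x)"
      using s by (simp add: diff_left diff_right diff_mem)
    show ?thesis using le[of n m] le[of m n] mono[of n m] mono[of m n] flip by (cases "n \<le> m") auto
  qed
  have "convergent q"
  proof (rule Bseq_monoseq_convergent)
    show "Bseq q"
    proof (rule BseqI')
      show "norm (q n) \<le> ip u u" for n
        using bessel[OF u, of "{..<n}" f] by (simp add: q_def f ff sum_nonneg)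
    qed
    show "monoseq q" by (auto simp: monoseq_def q_def intro!: sum_mono2)
  qed
  then have "Cauchy q" by (rule convergent_Cauchy)
  then have "\<exists>N. \<forall>m\<ge>N. \<forall>n\<ge>N. ip (\<lambda>x. s m x - s n x) (\<lambda>x. s m x - s n x) < e" if "e > 0" for e
    using that unfolding step Cauchy_def dist_real_def by blast
  from complete[OF s this] obtain w where w: "w \<in> H" "ip_tendsto ip s w" by blast
  have null: "ip (\<lambda>x. u x - w x) (\<lambda>x. u x - w x) = 0"
  proof (rule maximal)
    fix i
    have "(\<lambda>n. ip (s n) (f i)) \<longlonglongrightarrow> ip w (f i)"
      using w f s by (intro tendsto_ip_left) (auto simp: ip_tendsto_def)
    moreover have "(\<lambda>n. ip (s n) (f i)) \<longlonglongrightarrow> ip u (f i)"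
    proof (rule tendsto_eventually)
      show "\<forall>\<^sub>F n in sequentially. ip (s n) (f i) = ip u (f i)"
        using eventually_gt_at_top[of i]
      proof eventually_elim
        case (elim n)
        have "ip (s n) (f i) = (\<Sum>j<n. ip u (f j) * ip (f j) (f i))"
          unfolding s_def by (intro sum_left f)
        also have "\<dots> = (\<Sum>j<n. if j = i then ip u (f j) else 0)"
          by (intro sum.cong) (auto simp: ff)
        finally show ?case using elim by simp
      qed
    qed
    ultimately have "ip w (f i) = ip u (f i)" by (rule LIMSEQ_unique)
    then show "ip (\<lambda>x. u x - w x) (f i) = 0" using u w f by (simp add: diff_left)
  qed (intro diff_mem u w)
  have "ip (\<lambda>x. s n x - u x) (\<lambda>x. s n x - u x) = ip (\<lambda>x. s n x - w x) (\<lambda>x. s n x - w x)" for n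
    using ip_diff_null[OF diff_mem[OF s w(1)] diff_mem[OF u w(1)] null] by simp
  then show "ip_tendsto ip (\<lambda>n x. \<Sum>i<n. ip u (f i) * f i x) u"
    using w(2) by (simp add: ip_tendsto_def s_def)
qed

end

text \<open>The exponent 2 lies in the Rellich range for every dimension.\<close>

lemma compact_imbedding_L2_subsequence:
  fixes \<Omega> :: "'a::euclidean_space set"
  assumes "compact_imbedding \<Omega>" "\<And>n. u n \<in> H1 \<Omega>" "\<And>n. h1_ip \<Omega> (u n) (u n) \<le> C"
  obtains r w where "strict_mono (r :: nat \<Rightarrow> nat)" "w \<in> L2 (vol \<Omega>)"
    "ip_tendsto (l2_ip (vol \<Omega>)) (\<lambda>n. u (r n)) w"
proof -
  have "(1::real) \<le> 2 \<and> (3 \<le> DIM('a) \<longrightarrow> 2 < 2 * real DIM('a) / (real DIM('a) - 2))"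
    by (auto simp: field_simps)
  from assms(1)[unfolded compact_imbedding_def, rule_format, OF this, THEN conjunct2, rule_format, of u C]
  obtain r w where "strict_mono (r :: nat \<Rightarrow> nat)" "w \<in> Lp (vol \<Omega>) 2"
    "(\<lambda>n. LINT x|vol \<Omega>. \<bar>u (r n) x - w x\<bar> powr 2) \<longlonglongrightarrow> 0"
    using assms(2,3) by auto
  then show ?thesis
    using that[of r w] by (simp add: Lp_def L2_def ip_tendsto_def l2_ip_def power2_eq_square)
qed

text \<open>Otherwise Rellich yields infinitely many of these functions that are so close to each other in \<open>L^2\<close> that
  their mutual \<open>L^2\<close> products are at least \<open>e / 2\<close>. The sum of \<open>m\<close> of them then has squared \<open>L^2\<close> norm at least
  \<open>m^2 * e / 2\<close>, but its squared \<open>H^1\<close> norm is only \<open>m\<close>, by orthonormality.\<close>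

lemma finite_orthonormal_L2_large:
  assumes \<Omega>: "open \<Omega>" "compact_imbedding \<Omega>" and S: "S \<subseteq> H1 \<Omega>"
    and on: "\<And>u v. u \<in> S \<Longrightarrow> v \<in> S \<Longrightarrow> h1_ip \<Omega> u v = (if u = v then 1 else 0)"
    and e: "e > 0"
  shows "finite {u\<in>S. l2_ip (vol \<Omega>) u u \<ge> e}"
proof (rule ccontr)
  interpret h: semi_inner_space "H1 \<Omega>" "h1_ip \<Omega>" using \<Omega>(1) by (rule h1_semi_inner_space)
  assume "infinite {u\<in>S. l2_ip (vol \<Omega>) u u \<ge> e}"
  then obtain v :: "nat \<Rightarrow> 'a \<Rightarrow> real" where v: "inj v" "range v \<subseteq> {u\<in>S. l2_ip (vol \<Omega>) u u \<ge> e}"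
    using infinite_countable_subset by blast
  then have vS: "v n \<in> S" and ve: "l2_ip (vol \<Omega>) (v n) (v n) \<ge> e" for n by auto
  then have vH: "v n \<in> H1 \<Omega>" for n using S by auto
  obtain r w where r: "strict_mono (r :: nat \<Rightarrow> nat)" and w: "w \<in> L2 (vol \<Omega>)"
    and lim: "ip_tendsto (l2_ip (vol \<Omega>)) (\<lambda>n. v (r n)) w"
    using compact_imbedding_L2_subsequence[of \<Omega> v 1, OF \<Omega>(2) vH] on[OF vS vS] by auto
  define z where "z n = v (r n)" for n
  have zL: "z n \<in> L2 (vol \<Omega>)" and zH: "z n \<in> H1 \<Omega>" for n using H1_L2 vH by (auto simp: z_def)
  have zon: "h1_ip \<Omega> (z i) (z j) = (if i = j then 1 else 0)" for i j
    using on[OF vS vS] v(1) strict_mono_eq[OF r] by (auto simp: z_def inj_eq)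
  obtain N where N: "\<And>n. n \<ge> N \<Longrightarrow> l2_ip (vol \<Omega>) (\<lambda>x. z n x - w x) (\<lambda>x. z n x - w x) < e / 4"
    using order_tendstoD(2)[OF lim[unfolded ip_tendsto_def], of "e / 4"] e
    by (auto simp: eventually_sequentially z_def)
  have far: "e / 2 \<le> l2_ip (vol \<Omega>) (z i) (z j)" if "i \<ge> N" "j \<ge> N" for i j
  proof -
    have "l2_ip (vol \<Omega>) (\<lambda>x. z i x - z j x) (\<lambda>x. z i x - z j x) \<le> e"
      using l2.ip_diff_le[OF l2.diff_mem[OF zL w] l2.diff_mem[OF zL w], of i j] N[OF that(1)] N[OF that(2)] by simp
    moreover have "l2_ip (vol \<Omega>) (z i) (z i) \<ge> e" "l2_ip (vol \<Omega>) (z j) (z j) \<ge> e" using ve by (auto simp: z_def)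
    ultimately show ?thesis
      using zL l2.sym[OF zL zL, of i j] by (simp add: l2.diff_left l2.diff_right l2.diff_mem)
  qed
  obtain m :: nat where m: "2 / e < real m" using reals_Archimedean2 by blast
  then have m0: "0 < real m" using e by (smt (verit) divide_pos_pos)
  define I where "I = {N..<N+m}"
  define s where "s x = (\<Sum>i\<in>I. 1 * z i x)" for x
  have "real m * (real m * (e / 2)) = (\<Sum>i\<in>I. \<Sum>j\<in>I. e / 2)" by (simp add: I_def)
  also have "\<dots> \<le> (\<Sum>i\<in>I. \<Sum>j\<in>I. l2_ip (vol \<Omega>) (z i) (z j))"
    by (intro sum_mono far) (auto simp: I_def)
  also have "\<dots> = l2_ip (vol \<Omega>) s s"
    unfolding s_def l2.sum_left[OF zL l2.sum_mem[OF zL]] l2.sum_right[OF zL zL] by simp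
  also have "\<dots> \<le> h1_ip \<Omega> s s" by (rule l2_le_h1)
  also have "\<dots> = (\<Sum>i\<in>I. 1\<^sup>2)"
    unfolding s_def by (intro h.ip_sum_orthonormal zH zon) (auto simp: I_def)
  also have "\<dots> = real m" by (simp add: I_def)
  finally have "real m * e \<le> 2" using m0 by simp
  then show False using m e by (simp add: field_simps)
qed

text \<open>Zorn's lemma gives a maximal orthonormal set. Its members have positive \<open>L^2\<close> norm, and only finitely many
  have a norm above any given bound, so the set is countable; compactness of the imbedding thus takes
  the place of a separability argument. The independent functions \<open>g k\<close> force it to be infinite, so that it can
  be indexed by all natural numbers. Completeness turns maximality into the basis property. Prescribing one
  basis element \<open>u0\<close> makes it possible to expand a multiple of \<open>u0\<close> with a single term.\<close>

lemma H1_orthonormal_basis_exists: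
  fixes \<Omega> :: "'a::euclidean_space set"
  assumes \<Omega>: "open \<Omega>" "compact_imbedding \<Omega>"
    and g: "\<And>k::nat. g k \<in> H1 \<Omega>" "\<And>j k. j \<noteq> k \<Longrightarrow> l2_ip (vol \<Omega>) (g j) (g k) = 0" "\<And>k. l2_ip (vol \<Omega>) (g k) (g k) \<noteq> 0"
    and u0: "u0 \<in> H1 \<Omega>" "h1_ip \<Omega> u0 u0 = 1"
  obtains f m where "orthonormal_basis (H1 \<Omega>) (h1_ip \<Omega>) f" "f m = u0"
proof -
  interpret h: semi_inner_space "H1 \<Omega>" "h1_ip \<Omega>" using \<Omega>(1) by (rule h1_semi_inner_space)
  define ON where "ON = {S. u0 \<in> S \<and> S \<subseteq> H1 \<Omega> \<and> (\<forall>u\<in>S. \<forall>v\<in>S. h1_ip \<Omega> u v = (if u = v then 1 else 0))}"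
  have "\<exists>S\<in>ON. \<forall>X\<in>ON. S \<subseteq> X \<longrightarrow> X = S"
  proof (rule subset_Zorn_nonempty)
    show "ON \<noteq> {}" using u0 by (auto simp: ON_def intro!: exI[of _ "{u0}"])
    fix C assume "C \<noteq> {}" and C: "subset.chain ON C"
    have "h1_ip \<Omega> u v = (if u = v then 1 else 0)" if "X \<in> C" "Y \<in> C" "u \<in> X" "v \<in> Y" for X Y u v
    proof -
      have "X \<subseteq> Y \<or> Y \<subseteq> X" using C that by (auto simp: subset_chain_def)
      then show ?thesis using C that unfolding subset_chain_def ON_def by blast
    qed
    then show "\<Union>C \<in> ON" using C \<open>C \<noteq> {}\<close> unfolding ON_def subset_chain_def by blast
  qed
  then obtain S where S: "S \<in> ON" and max: "\<And>X. X \<in> ON \<Longrightarrow> S \<subseteq> X \<Longrightarrow> X = S" by blast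
  have SH: "S \<subseteq> H1 \<Omega>" and on: "\<And>u v. u \<in> S \<Longrightarrow> v \<in> S \<Longrightarrow> h1_ip \<Omega> u v = (if u = v then 1 else 0)"
    and u0S: "u0 \<in> S"
    using S by (auto simp: ON_def)
  have maximal: "h1_ip \<Omega> v v = 0" if v: "v \<in> H1 \<Omega>" and orth: "\<And>u. u \<in> S \<Longrightarrow> h1_ip \<Omega> v u = 0" for v
  proof (rule ccontr)
    assume nz: "h1_ip \<Omega> v v \<noteq> 0"
    define y where "y x = (1 / sqrt (h1_ip \<Omega> v v)) * v x" for x
    have yH: "y \<in> H1 \<Omega>" unfolding y_def by (rule h.scale_mem[OF v])
    have yy: "h1_ip \<Omega> y y = 1"
      using v nz h.nonneg[OF v] unfolding y_def
      by (subst h.scale_left[OF v h.scale_mem[OF v]], subst h.scale_right[OF v v]) (simp add: field_simps)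
    have yS: "h1_ip \<Omega> y u = 0" "h1_ip \<Omega> u y = 0" if "u \<in> S" for u
    proof -
      have uH: "u \<in> H1 \<Omega>" using that SH by auto
      show "h1_ip \<Omega> y u = 0" using orth[OF that] unfolding y_def by (subst h.scale_left[OF v uH]) simp
      then show "h1_ip \<Omega> u y = 0" using h.sym[OF uH yH] by simp
    qed
    have "y \<notin> S" using yS(1)[of y] yy by auto
    have "insert y S \<in> ON"
      using u0S SH yH on yy yS \<open>y \<notin> S\<close> by (auto simp: ON_def)
    then show False using max[of "insert y S"] \<open>y \<notin> S\<close> by auto
  qed
  have "countable S"
  proof -
    have "S \<subseteq> (\<Union>n::nat. {u\<in>S. l2_ip (vol \<Omega>) u u \<ge> inverse (real (Suc n))})"
    proof
      fix u assume u: "u \<in> S"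
      then have uH: "u \<in> H1 \<Omega>" using SH by auto
      have "l2_ip (vol \<Omega>) u u \<noteq> 0"
        using h1_null_iff[OF \<Omega>(1) uH] L2_null_iff[OF H1_L2[OF uH]] on[OF u u] by auto
      then have "0 < l2_ip (vol \<Omega>) u u" using l2.nonneg[OF H1_L2[OF uH]] by simp
      then show "u \<in> (\<Union>n::nat. {u\<in>S. l2_ip (vol \<Omega>) u u \<ge> inverse (real (Suc n))})"
        using reals_Archimedean u by (auto intro: less_imp_le)
    qed
    moreover have "countable (\<Union>n::nat. {u\<in>S. l2_ip (vol \<Omega>) u u \<ge> inverse (real (Suc n))})"
    proof (rule countable_UN[OF countableI_type], rule countable_finite)
      fix n :: nat
      show "finite {u\<in>S. l2_ip (vol \<Omega>) u u \<ge> inverse (real (Suc n))}"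
        using finite_orthonormal_L2_large[OF \<Omega> SH on, of "inverse (real (Suc n))"] by simp
    qed
    ultimately show ?thesis by (rule countable_subset)
  qed
  have "infinite S"
  proof
    assume fin: "finite S"
    \<comment> \<open>A combination of \<open>card S + 1\<close> of the \<open>g k\<close> is orthogonal to all of \<open>S\<close>, hence null by maximality.\<close>
    obtain c where c: "\<exists>k\<in>{..card S}. c k \<noteq> 0" "\<And>u. u \<in> S \<Longrightarrow> (\<Sum>k\<le>card S. c k * h1_ip \<Omega> (g k) u) = 0"
      using underdetermined_system[OF fin, of "{..card S}" "\<lambda>k u. h1_ip \<Omega> (g k) u"] by auto
    define s where "s x = (\<Sum>k\<le>card S. c k * g k x)" for x
    have sH: "s \<in> H1 \<Omega>" unfolding s_def by (intro h.sum_mem g)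
    have "h1_ip \<Omega> s u = 0" if "u \<in> S" for u
      using c(2)[OF that] SH that unfolding s_def by (subst h.sum_left) (auto intro: g)
    then have "h1_ip \<Omega> s s = 0" using sH by (intro maximal)
    then have s0: "l2_ip (vol \<Omega>) s s = 0"
      using h1_null_iff[OF \<Omega>(1) sH] L2_null_iff[OF H1_L2[OF sH]] by auto
    obtain k where k: "k \<le> card S" "c k \<noteq> 0" using c(1) by auto
    have "0 = l2_ip (vol \<Omega>) s (g k)" using l2.null_left[OF H1_L2[OF sH] H1_L2[OF g(1)] s0] by simp
    also have "\<dots> = (\<Sum>j\<le>card S. c j * l2_ip (vol \<Omega>) (g j) (g k))"
      unfolding s_def by (intro l2.sum_left H1_L2 g)
    also have "\<dots> = (\<Sum>j\<le>card S. if j = k then c k * l2_ip (vol \<Omega>) (g k) (g k) else 0)"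
      by (intro sum.cong) (auto simp: g(2))
    also have "\<dots> = c k * l2_ip (vol \<Omega>) (g k) (g k)" using k by simp
    finally show False using k g(3)[of k] by simp
  qed
  define f where "f = from_nat_into S"
  have bij: "bij_betw f UNIV S"
    unfolding f_def by (rule bij_betw_from_nat_into[OF \<open>countable S\<close> \<open>infinite S\<close>])
  have fS: "f i \<in> S" for i using bij bij_betwE by blast
  have "orthonormal_basis (H1 \<Omega>) (h1_ip \<Omega>) f"
  proof (rule h.maximal_orthonormal_family_basis)
    show "orthonormal_family (H1 \<Omega>) (h1_ip \<Omega>) f"
      using fS SH on bij by (auto simp: orthonormal_family_def bij_betw_def inj_eq)
    show "\<exists>w\<in>H1 \<Omega>. ip_tendsto (h1_ip \<Omega>) s w"
      if "\<And>n::nat. s n \<in> H1 \<Omega>" "\<And>e. e > 0 \<Longrightarrow> \<exists>N. \<forall>m\<ge>N. \<forall>n\<ge>N. h1_ip \<Omega> (\<lambda>x. s m x - s n x) (\<lambda>x. s m x - s n x) < e" for s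
      using H1_complete[OF \<Omega>(1) that] by metis
    fix v assume v: "v \<in> H1 \<Omega>" "\<And>i. h1_ip \<Omega> v (f i) = 0"
    have "\<exists>i. u = f i" if "u \<in> S" for u using bij that by (auto simp: bij_betw_def)
    then show "h1_ip \<Omega> v v = 0" using v by (intro maximal) auto
  qed
  moreover obtain m where "f m = u0" using bij u0S by (auto simp: bij_betw_def)
  ultimately show ?thesis by (rule that)
qed

section \<open>Tensor products and Fubini\<close>
text \<open>The two measures agree on measurable rectangles, which determines a product of sigma-finite
  measures.\<close>

lemma vol_times:
  fixes A :: "'a::euclidean_space set" and B :: "'b::euclidean_space set"
  assumes [measurable]: "A \<in> sets borel" "B \<in> sets borel"
  shows "vol (A \<times> B) = vol A \<Otimes>\<^sub>M vol B"
proof (rule pair_measure_eqI[symmetric])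
  show "sigma_finite_measure (vol A)" "sigma_finite_measure (vol B)"
    by (auto intro!: sigma_finite_measure_restrict_space sigma_finite_lborel)
  have AB: "A \<times> B \<in> sets borel" by (simp add: borel_Times)
  have rect: "X \<times> Y \<in> sets borel" if "X \<in> sets borel" "Y \<in> sets borel" for X :: "'a set" and Y :: "'b set"
    using that by (simp add: borel_Times)
  have restr: "X \<in> sets borel \<and> X \<subseteq> C" if "X \<in> sets (vol C)" "C \<in> sets borel" for X C :: "'c::euclidean_space set"
    using that by (auto simp: sets_restrict_space_iff)
  show "sets (vol A \<Otimes>\<^sub>M vol B) = sets (vol (A \<times> B))"
  proof (intro equalityI subsetI)
    fix S assume "S \<in> sets (vol A \<Otimes>\<^sub>M vol B)"
    moreover have "sets (vol A \<Otimes>\<^sub>M vol B) \<subseteq> sets (vol (A \<times> B))"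
    proof (rule sets_pair_in_sets)
      fix X Y assume "X \<in> sets (vol A)" "Y \<in> sets (vol B)"
      then show "X \<times> Y \<in> sets (vol (A \<times> B))"
        using restr[of X A] restr[of Y B] rect[of X Y] AB
        by (subst sets_restrict_space_iff) (simp_all add: Sigma_mono)
    qed
    ultimately show "S \<in> sets (vol (A \<times> B))" by blast
  next
    fix S assume "S \<in> sets (vol (A \<times> B))"
    moreover have "sets (lborel \<Otimes>\<^sub>M lborel) = sets (borel :: ('a \<times> 'b) measure)"
      by (simp only: lborel_prod sets_lborel)
    ultimately have S: "S \<in> sets (lborel \<Otimes>\<^sub>M lborel)" "S \<subseteq> A \<times> B"
      using restr[OF _ AB, of S] by simp_all
    have "(\<lambda>z. (fst z, snd z)) \<in> (vol A \<Otimes>\<^sub>M vol B) \<rightarrow>\<^sub>M (lborel \<Otimes>\<^sub>M lborel)"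
    proof (rule measurable_Pair)
      have id1: "(\<lambda>x. x) \<in> vol A \<rightarrow>\<^sub>M lborel" and id2: "(\<lambda>x. x) \<in> vol B \<rightarrow>\<^sub>M lborel"
        by (auto intro!: measurable_restrict_space1)
      show "fst \<in> vol A \<Otimes>\<^sub>M vol B \<rightarrow>\<^sub>M lborel" "snd \<in> vol A \<Otimes>\<^sub>M vol B \<rightarrow>\<^sub>M lborel"
        using measurable_compose[OF measurable_fst id1] measurable_compose[OF measurable_snd id2] by auto
    qed
    from measurable_sets[OF this S(1)]
    have "(\<lambda>z. (fst z, snd z)) -` S \<inter> space (vol A \<Otimes>\<^sub>M vol B) \<in> sets (vol A \<Otimes>\<^sub>M vol B)" .
    moreover have "(\<lambda>z. (fst z, snd z)) -` S \<inter> space (vol A \<Otimes>\<^sub>M vol B) = S"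
      using S(2) by (auto simp: space_pair_measure)
    ultimately show "S \<in> sets (vol A \<Otimes>\<^sub>M vol B)" by simp
  qed
  fix X Y assume XY: "X \<in> sets (vol A)" "Y \<in> sets (vol B)"
  then have X: "X \<in> sets borel" "X \<subseteq> A" and Y: "Y \<in> sets borel" "Y \<subseteq> B"
    using restr[of X A] restr[of Y B] by simp_all
  have "emeasure (vol (A \<times> B)) (X \<times> Y) = emeasure (lborel \<Otimes>\<^sub>M lborel) (X \<times> Y)"
    using X Y AB by (subst emeasure_restrict_space) (auto simp: lborel_prod)
  also have "\<dots> = emeasure lborel X * emeasure lborel Y"
    using X Y by (intro lborel.emeasure_pair_measure_Times) auto
  also have "\<dots> = emeasure (vol A) X * emeasure (vol B) Y"
    using X Y by (simp add: emeasure_restrict_space)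
  finally show "emeasure (vol A) X * emeasure (vol B) Y = emeasure (vol (A \<times> B)) (X \<times> Y)" by simp
qed

lemma pair_sigma_finite_vol:
  "A \<in> sets borel \<Longrightarrow> B \<in> sets borel \<Longrightarrow> pair_sigma_finite (vol A) (vol B)"
  by (simp add: pair_sigma_finite_def sigma_finite_measure_restrict_space sigma_finite_lborel)

lemma (in pair_sigma_finite)
  fixes f :: "'a \<Rightarrow> real" and g :: "'b \<Rightarrow> real"
  assumes f: "integrable M1 f" and g: "integrable M2 g"
  shows integrable_tensor: "integrable (M1 \<Otimes>\<^sub>M M2) (\<lambda>z. f (fst z) * g (snd z))"
    and integral_tensor: "(LINT z|(M1 \<Otimes>\<^sub>M M2). f (fst z) * g (snd z)) = (LINT x|M1. f x) * (LINT y|M2. g y)"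
proof -
  have [measurable]: "f \<in> borel_measurable M1" "g \<in> borel_measurable M2" using f g by auto
  show 1: "integrable (M1 \<Otimes>\<^sub>M M2) (\<lambda>z. f (fst z) * g (snd z))"
    by (rule Fubini_integrable) (use f g in \<open>auto simp: abs_mult\<close>)
  show "(LINT z|(M1 \<Otimes>\<^sub>M M2). f (fst z) * g (snd z)) = (LINT x|M1. f x) * (LINT y|M2. g y)"
    using integral_fst'[OF 1] by simp
qed

lemma (in pair_sigma_finite) tensor_L2:
  assumes "e \<in> L2 M1" "f \<in> L2 M2"
  shows "e \<otimes>\<^sub>f f \<in> L2 (M1 \<Otimes>\<^sub>M M2)"
proof -
  have [measurable]: "e \<in> borel_measurable M1" "f \<in> borel_measurable M2" using assms by (auto simp: L2_def)
  show ?thesis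
    using assms integrable_tensor[of "\<lambda>x. (e x)\<^sup>2" "\<lambda>x. (f x)\<^sup>2"]
    by (auto simp: L2_def tensor_def case_prod_unfold power_mult_distrib)
qed

lemma (in pair_sigma_finite) l2_ip_tensor:
  assumes "e \<in> L2 M1" "f \<in> L2 M2" "e' \<in> L2 M1" "f' \<in> L2 M2"
  shows "l2_ip (M1 \<Otimes>\<^sub>M M2) (e \<otimes>\<^sub>f f) (e' \<otimes>\<^sub>f f') = l2_ip M1 e e' * l2_ip M2 f f'"
  using integral_tensor[OF L2_mult_integrable[OF assms(1,3)] L2_mult_integrable[OF assms(2,4)]]
  by (simp add: l2_ip_def tensor_def case_prod_unfold mult_ac)

lemma has_derivative_slice:
  fixes \<phi> :: "'a::euclidean_space \<times> 'b::euclidean_space \<Rightarrow> real"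
  assumes "\<phi> differentiable at (x, y)"
  shows "((\<lambda>x. \<phi> (x, y)) has_derivative (\<lambda>h. frechet_derivative \<phi> (at (x, y)) (h, 0))) (at x)"
    and "((\<lambda>y. \<phi> (x, y)) has_derivative (\<lambda>h. frechet_derivative \<phi> (at (x, y)) (0, h))) (at y)"
proof -
  have d: "(\<phi> has_derivative frechet_derivative \<phi> (at (x, y))) (at (x, y))"
    using assms by (simp add: frechet_derivative_works)
  have "((\<lambda>x. (x, y)) has_derivative (\<lambda>h. (h, 0))) (at x)" "((\<lambda>y. (x, y)) has_derivative (\<lambda>h. (0, h))) (at y)"
    by (auto intro!: derivative_eq_intros)
  from has_derivative_compose[OF this(1) d] has_derivative_compose[OF this(2) d]
  show "((\<lambda>x. \<phi> (x, y)) has_derivative (\<lambda>h. frechet_derivative \<phi> (at (x, y)) (h, 0))) (at x)"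
    "((\<lambda>y. \<phi> (x, y)) has_derivative (\<lambda>h. frechet_derivative \<phi> (at (x, y)) (0, h))) (at y)" .
qed

lemmas frechet_derivative_slice = has_derivative_slice[THEN frechet_derivative_eqI]

lemma Ck_slice:
  fixes \<phi> :: "'a::euclidean_space \<times> 'b::euclidean_space \<Rightarrow> real"
  shows "Ck k \<phi> \<Longrightarrow> Ck k (\<lambda>x. \<phi> (x, y))" and "Ck k \<phi> \<Longrightarrow> Ck k (\<lambda>y. \<phi> (x, y))"
proof -
  show "Ck k \<phi> \<Longrightarrow> Ck k (\<lambda>x. \<phi> (x, y))"
  proof (induction k arbitrary: \<phi>)
    case 0
    then have "continuous_on UNIV (\<lambda>x. \<phi> (x, y))" by (auto intro!: continuous_on_compose2[of UNIV \<phi>] continuous_intros)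
    then show ?case by simp
  next
    case (Suc k)
    then have d: "\<phi> differentiable at z" for z unfolding Ck.simps by blast
    have "Ck k (\<lambda>x. frechet_derivative \<phi> (at (x, y)) (i, 0))" if "i \<in> Basis" for i
      using Suc.prems that by (intro Suc.IH) (simp add: Basis_prod_def)
    then show ?case
      using has_derivative_slice(1)[OF d] by (auto simp: frechet_derivative_slice(1)[OF d] differentiable_def)
  qed
  show "Ck k \<phi> \<Longrightarrow> Ck k (\<lambda>y. \<phi> (x, y))"
  proof (induction k arbitrary: \<phi>)
    case 0
    then have "continuous_on UNIV (\<lambda>y. \<phi> (x, y))" by (auto intro!: continuous_on_compose2[of UNIV \<phi>] continuous_intros)
    then show ?case by simp
  next
    case (Suc k)
    then have d: "\<phi> differentiable at z" for z unfolding Ck.simps by blast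
    have "Ck k (\<lambda>y. frechet_derivative \<phi> (at (x, y)) (0, i))" if "i \<in> Basis" for i
      using Suc.prems that by (intro Suc.IH) (simp add: Basis_prod_def)
    then show ?case
      using has_derivative_slice(2)[OF d] by (auto simp: frechet_derivative_slice(2)[OF d] differentiable_def)
  qed
qed

lemma test_fun_slice:
  fixes \<phi> :: "'a::euclidean_space \<times> 'b::euclidean_space \<Rightarrow> real"
  assumes \<phi>: "test_fun (\<Omega>1 \<times> \<Omega>2) \<phi>"
  shows "test_fun \<Omega>1 (\<lambda>x. \<phi> (x, y))" and "test_fun \<Omega>2 (\<lambda>y. \<phi> (x, y))"
proof -
  define C where "C = closure {z. \<phi> z \<noteq> 0}"
  have C: "compact C" "C \<subseteq> \<Omega>1 \<times> \<Omega>2" "\<And>z. \<phi> z \<noteq> 0 \<Longrightarrow> z \<in> C"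
    using \<phi> closure_subset[of "{z. \<phi> z \<noteq> 0}"] by (auto simp: test_fun_def C_def)
  have c1: "compact (fst ` (C \<inter> (UNIV \<times> {y})))" and c2: "compact (snd ` (C \<inter> ({x} \<times> UNIV)))"
    using C(1) by (auto intro!: compact_continuous_image continuous_intros compact_Int_closed closed_Times)
  have s1: "closure {x. \<phi> (x, y) \<noteq> 0} \<subseteq> fst ` (C \<inter> (UNIV \<times> {y}))"
    using C(3) by (intro closure_minimal compact_imp_closed c1) force
  have s2: "closure {y. \<phi> (x, y) \<noteq> 0} \<subseteq> snd ` (C \<inter> ({x} \<times> UNIV))"
    using C(3) by (intro closure_minimal compact_imp_closed c2) force
  have p1: "fst ` (C \<inter> (UNIV \<times> {y})) \<subseteq> \<Omega>1" and p2: "snd ` (C \<inter> ({x} \<times> UNIV)) \<subseteq> \<Omega>2"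
    using C(2) by auto
  show "test_fun \<Omega>1 (\<lambda>x. \<phi> (x, y))"
    using order_trans[OF s1 p1] s1 \<phi> Ck_slice(1)[of _ \<phi> y] closed_closure[of "{x. \<phi> (x, y) \<noteq> 0}"] compact_Int_closed[OF c1, of "closure {x. \<phi> (x, y) \<noteq> 0}"]
    unfolding test_fun_def by (simp add: Int_absorb1)
  show "test_fun \<Omega>2 (\<lambda>y. \<phi> (x, y))"
    using order_trans[OF s2 p2] s2 \<phi> Ck_slice(2)[of _ \<phi> x] closed_closure[of "{y. \<phi> (x, y) \<noteq> 0}"] compact_Int_closed[OF c2, of "closure {y. \<phi> (x, y) \<noteq> 0}"]
    unfolding test_fun_def by (simp add: Int_absorb1)
qed

definition tensor_gradient :: "('a \<Rightarrow> real) \<Rightarrow> ('a \<Rightarrow> 'c::real_vector) \<Rightarrow> ('b \<Rightarrow> real) \<Rightarrow> ('b \<Rightarrow> 'd::real_vector) \<Rightarrow> 'a \<times> 'b \<Rightarrow> 'c \<times> 'd" where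
  "tensor_gradient e A f B z = (f (snd z) *\<^sub>R A (fst z), e (fst z) *\<^sub>R B (snd z))"

lemma (in pair_sigma_finite) tensor_gradient_square_integrable:
  fixes A :: "'a \<Rightarrow> 'c::euclidean_space" and B :: "'b \<Rightarrow> 'd::euclidean_space"
  assumes e: "e \<in> L2 M1" and A: "A \<in> borel_measurable M1" "integrable M1 (\<lambda>x. (norm (A x))\<^sup>2)"
    and f: "f \<in> L2 M2" and B: "B \<in> borel_measurable M2" "integrable M2 (\<lambda>x. (norm (B x))\<^sup>2)"
  shows "tensor_gradient e A f B \<in> borel_measurable (M1 \<Otimes>\<^sub>M M2)"
    and "integrable (M1 \<Otimes>\<^sub>M M2) (\<lambda>z. (norm (tensor_gradient e A f B z))\<^sup>2)"
proof -
  have [measurable]: "e \<in> borel_measurable M1" "f \<in> borel_measurable M2" using e f by (auto simp: L2_def)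
  note A(1)[measurable] B(1)[measurable]
  show "tensor_gradient e A f B \<in> borel_measurable (M1 \<Otimes>\<^sub>M M2)"
    unfolding tensor_gradient_def by measurable
  have "(\<lambda>z. (norm (tensor_gradient e A f B z))\<^sup>2) =
    (\<lambda>z. (norm (A (fst z)))\<^sup>2 * (f (snd z))\<^sup>2 + (e (fst z))\<^sup>2 * (norm (B (snd z)))\<^sup>2)"
    by (auto simp: tensor_gradient_def norm_Pair power_mult_distrib)
  then show "integrable (M1 \<Otimes>\<^sub>M M2) (\<lambda>z. (norm (tensor_gradient e A f B z))\<^sup>2)"
    using integrable_tensor[OF A(2), of "\<lambda>y. (f y)\<^sup>2"] integrable_tensor[OF _ B(2), of "\<lambda>x. (e x)\<^sup>2"] e f
    by (auto simp: L2_def)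
qed

text \<open>A slice of a test function on the product is a test function on the factor. So for a basis
  vector in one factor it suffices to integrate by parts in that factor and to apply Fubini.\<close>

lemma weak_gradient_tensor:
  fixes \<Omega>1 :: "'a::euclidean_space set" and \<Omega>2 :: "'b::euclidean_space set"
  assumes \<Omega>: "open \<Omega>1" "open \<Omega>2"
    and e: "e \<in> L2 (vol \<Omega>1)" "has_weak_gradient \<Omega>1 e A"
    and f: "f \<in> L2 (vol \<Omega>2)" "has_weak_gradient \<Omega>2 f B"
  shows "has_weak_gradient (\<Omega>1 \<times> \<Omega>2) (e \<otimes>\<^sub>f f) (tensor_gradient e A f B)"
proof -
  interpret pair_sigma_finite "vol \<Omega>1" "vol \<Omega>2" using \<Omega> by (intro pair_sigma_finite_vol) auto
  have vt: "vol (\<Omega>1 \<times> \<Omega>2) = vol \<Omega>1 \<Otimes>\<^sub>M vol \<Omega>2" using \<Omega> by (intro vol_times) auto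
  have \<Omega>12: "open (\<Omega>1 \<times> \<Omega>2)" using \<Omega> by (rule open_Times)
  have A: "A \<in> borel_measurable (vol \<Omega>1)" "integrable (vol \<Omega>1) (\<lambda>x. (norm (A x))\<^sup>2)"
    and B: "B \<in> borel_measurable (vol \<Omega>2)" "integrable (vol \<Omega>2) (\<lambda>x. (norm (B x))\<^sup>2)"
    using e f by (auto simp: has_weak_gradient_def)
  note T = tensor_gradient_square_integrable[OF e(1) A f(1) B]
  show ?thesis
    unfolding has_weak_gradient_def
  proof (intro conjI allI impI ballI)
    show "tensor_gradient e A f B \<in> borel_measurable (vol (\<Omega>1 \<times> \<Omega>2))"
      "integrable (vol (\<Omega>1 \<times> \<Omega>2)) (\<lambda>z. (norm (tensor_gradient e A f B z))\<^sup>2)"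
      using T by (auto simp: vt)
    fix \<phi> and b :: "'a \<times> 'b" assume \<phi>: "test_fun (\<Omega>1 \<times> \<Omega>2) \<phi>" and b: "b \<in> Basis"
    note sl = frechet_derivative_slice[OF test_fun_differentiable[OF \<phi>]]
    have int1: "integrable (vol \<Omega>1 \<Otimes>\<^sub>M vol \<Omega>2) (\<lambda>z. (e \<otimes>\<^sub>f f) z * frechet_derivative \<phi> (at z) b)"
      using L2_mult_integrable[OF tensor_L2[OF e(1) f(1)]] test_fun_deriv_L2[OF \<Omega>12 \<phi> b] by (simp add: vt)
    have int2: "integrable (vol \<Omega>1 \<Otimes>\<^sub>M vol \<Omega>2) (\<lambda>z. (tensor_gradient e A f B z \<bullet> b) * \<phi> z)"
      using L2_mult_integrable[OF L2_component[OF T b]] test_fun_L2[OF \<Omega>12 \<phi>] by (simp add: vt)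
    show "(LINT z|vol (\<Omega>1 \<times> \<Omega>2). (e \<otimes>\<^sub>f f) z * frechet_derivative \<phi> (at z) b) =
        - (LINT z|vol (\<Omega>1 \<times> \<Omega>2). (tensor_gradient e A f B z \<bullet> b) * \<phi> z)"
    proof (cases "snd b = 0")
      case True
      then obtain i where i: "b = (i, 0)" "i \<in> Basis" using b by (auto simp: Basis_prod_def)
      have "(LINT x|vol \<Omega>1. (e \<otimes>\<^sub>f f) (x, y) * frechet_derivative \<phi> (at (x, y)) b) =
          - (LINT x|vol \<Omega>1. (tensor_gradient e A f B (x, y) \<bullet> b) * \<phi> (x, y))" for y
      proof -
        have "(LINT x|vol \<Omega>1. e x * frechet_derivative (\<lambda>x. \<phi> (x, y)) (at x) i) = - (LINT x|vol \<Omega>1. (A x \<bullet> i) * \<phi> (x, y))"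
          using e(2) test_fun_slice(1)[OF \<phi>] i(2) unfolding has_weak_gradient_def by blast
        then have "f y * (LINT x|vol \<Omega>1. e x * frechet_derivative \<phi> (at (x, y)) (i, 0)) = - (f y * (LINT x|vol \<Omega>1. (A x \<bullet> i) * \<phi> (x, y)))"
          by (simp add: sl(1))
        then show ?thesis
          unfolding Bochner_Integration.integral_mult_right_zero[symmetric]
          by (simp add: tensor_def tensor_gradient_def i(1) mult_ac)
      qed
      then have "(LINT y|vol \<Omega>2. LINT x|vol \<Omega>1. (e \<otimes>\<^sub>f f) (x, y) * frechet_derivative \<phi> (at (x, y)) b) =
         - (LINT y|vol \<Omega>2. LINT x|vol \<Omega>1. (tensor_gradient e A f B (x, y) \<bullet> b) * \<phi> (x, y))" by simp
      moreover have "(LINT y|vol \<Omega>2. LINT x|vol \<Omega>1. (e \<otimes>\<^sub>f f) (x, y) * frechet_derivative \<phi> (at (x, y)) b)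
          = (LINT z|(vol \<Omega>1 \<Otimes>\<^sub>M vol \<Omega>2). (e \<otimes>\<^sub>f f) z * frechet_derivative \<phi> (at z) b)"
        using integral_snd[of "\<lambda>x y. (e \<otimes>\<^sub>f f) (x, y) * frechet_derivative \<phi> (at (x, y)) b"] int1
        by (simp add: case_prod_unfold)
      moreover have "(LINT y|vol \<Omega>2. LINT x|vol \<Omega>1. (tensor_gradient e A f B (x, y) \<bullet> b) * \<phi> (x, y))
          = (LINT z|(vol \<Omega>1 \<Otimes>\<^sub>M vol \<Omega>2). (tensor_gradient e A f B z \<bullet> b) * \<phi> z)"
        using integral_snd[of "\<lambda>x y. (tensor_gradient e A f B (x, y) \<bullet> b) * \<phi> (x, y)"] int2
        by (simp add: case_prod_unfold)
      ultimately show ?thesis by (simp add: vt)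
    next
      case False
      then obtain i where i: "b = (0, i)" "i \<in> Basis" using b by (auto simp: Basis_prod_def)
      have "(LINT y|vol \<Omega>2. (e \<otimes>\<^sub>f f) (x, y) * frechet_derivative \<phi> (at (x, y)) b) =
          - (LINT y|vol \<Omega>2. (tensor_gradient e A f B (x, y) \<bullet> b) * \<phi> (x, y))" for x
      proof -
        have "(LINT y|vol \<Omega>2. f y * frechet_derivative (\<lambda>y. \<phi> (x, y)) (at y) i) = - (LINT y|vol \<Omega>2. (B y \<bullet> i) * \<phi> (x, y))"
          using f(2) test_fun_slice(2)[OF \<phi>] i(2) unfolding has_weak_gradient_def by blast
        then have "e x * (LINT y|vol \<Omega>2. f y * frechet_derivative \<phi> (at (x, y)) (0, i)) = - (e x * (LINT y|vol \<Omega>2. (B y \<bullet> i) * \<phi> (x, y)))"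
          by (simp add: sl(2))
        then show ?thesis
          unfolding Bochner_Integration.integral_mult_right_zero[symmetric]
          by (simp add: tensor_def tensor_gradient_def i(1) mult_ac)
      qed
      then have "(LINT x|vol \<Omega>1. LINT y|vol \<Omega>2. (e \<otimes>\<^sub>f f) (x, y) * frechet_derivative \<phi> (at (x, y)) b) =
         - (LINT x|vol \<Omega>1. LINT y|vol \<Omega>2. (tensor_gradient e A f B (x, y) \<bullet> b) * \<phi> (x, y))" by simp
      then show ?thesis using integral_fst'[OF int1] integral_fst'[OF int2] by (simp add: vt)
    qed
  qed
qed

section \<open>Gradients of finite tensor sums\<close>
text \<open>Poincare's inequality with the reciprocal of a positive lower bound of the eigenvalues as its
  constant: the eigenvalue equation turns the \<open>L^2\<close> Fourier coefficients of \<open>u\<close> into its gradient Fourier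
  coefficients divided by \<open>sqrt (l i)\<close>. Parseval in \<open>L^2\<close> and Bessel for the gradients finish the
  argument. Its hypothesis on \<open>u\<close> is linear in \<open>u\<close>, so it passes from elements of \<^const>\<open>H10\<close> to their finite
  combinations.\<close>

lemma dirichlet_poincare:
  fixes \<Omega> :: "'a::euclidean_space set"
  assumes \<Omega>: "open \<Omega>" and D: "dirichlet_eigendata \<Omega> l e"
  obtains C where "C \<ge> 0"
    "\<And>u. u \<in> H1 \<Omega> \<Longrightarrow> (\<And>i. grad_ip \<Omega> (e i) u = l i * l2_ip (vol \<Omega>) (e i) u) \<Longrightarrow> l2_ip (vol \<Omega>) u u \<le> C * grad_ip \<Omega> u u"
proof -
  interpret g: semi_inner_space "H1 \<Omega>" "grad_ip \<Omega>" using \<Omega> by (rule grad_semi_inner_space)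
  have lpos: "l j > 0" and eH: "e j \<in> H1 \<Omega>" for j
    using D by (auto simp: dirichlet_eigendata_def eigenpair_def H10_H1)
  have "\<forall>\<^sub>F j in sequentially. 1 \<le> l j" using D by (simp add: dirichlet_eigendata_def filterlim_at_top)
  then obtain N where N: "\<And>j. j \<ge> N \<Longrightarrow> 1 \<le> l j" by (auto simp: eventually_sequentially)
  define m where "m = Min (insert 1 (l ` {..<N}))"
  have m0: "m > 0" using lpos by (auto simp: m_def)
  have mle: "m \<le> l j" for j
  proof (cases "j < N")
    case True
    then show ?thesis by (auto simp: m_def intro!: Min_le)
  next
    case False
    then have "1 \<le> l j" using N by simp
    moreover have "m \<le> 1" by (auto simp: m_def intro!: Min_le)
    ultimately show ?thesis by simp
  qed
  have q: "(\<lambda>x. e i x / sqrt (l i)) = (\<lambda>x. (1 / sqrt (l i)) * e i x)" for i by simp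
  have on: "grad_ip \<Omega> (\<lambda>x. e i x / sqrt (l i)) (\<lambda>x. e j x / sqrt (l j)) = (if i = j then 1 else 0)" for i j
    using D by (simp add: dirichlet_eigendata_def orthonormal_basis_def orthonormal_family_def)
  have eon: "l2_ip (vol \<Omega>) (e i) (e j) = (if i = j then 1 else 0)" and eL: "e i \<in> L2 (vol \<Omega>)" for i j
    using D by (auto simp: dirichlet_eigendata_def orthonormal_basis_def orthonormal_family_def)
  show ?thesis
  proof (rule that[of "1 / m"])
    fix u assume u: "u \<in> H1 \<Omega>" and eq: "\<And>i. grad_ip \<Omega> (e i) u = l i * l2_ip (vol \<Omega>) (e i) u"
    note uL = H1_L2[OF u]
    have term_le: "(l2_ip (vol \<Omega>) u (e i))\<^sup>2 \<le> 1 / m * (grad_ip \<Omega> u (\<lambda>x. e i x / sqrt (l i)))\<^sup>2" for i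
    proof -
      have "grad_ip \<Omega> u (\<lambda>x. e i x / sqrt (l i)) = (1 / sqrt (l i)) * grad_ip \<Omega> u (e i)"
        unfolding q by (rule g.scale_right[OF eH u])
      also have "grad_ip \<Omega> u (e i) = l i * l2_ip (vol \<Omega>) u (e i)"
        using eq[of i] g.sym[OF u eH] l2.sym[OF uL eL] by simp
      also have "1 / sqrt (l i) * (l i * l2_ip (vol \<Omega>) u (e i)) = sqrt (l i) * l2_ip (vol \<Omega>) u (e i)"
      proof -
        have "1 / sqrt (l i) * (l i * l2_ip (vol \<Omega>) u (e i)) = (l i / sqrt (l i)) * l2_ip (vol \<Omega>) u (e i)" by simp
        then show ?thesis using real_div_sqrt[of "l i"] lpos[of i] by simp
      qed
      finally have "(grad_ip \<Omega> u (\<lambda>x. e i x / sqrt (l i)))\<^sup>2 = l i * (l2_ip (vol \<Omega>) u (e i))\<^sup>2"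
        using lpos[of i] by (simp add: power_mult_distrib)
      moreover have "m * (l2_ip (vol \<Omega>) u (e i))\<^sup>2 \<le> l i * (l2_ip (vol \<Omega>) u (e i))\<^sup>2"
        by (intro mult_right_mono mle) simp
      ultimately show ?thesis using m0 by (simp add: field_simps)
    qed
    have sum_le: "(\<Sum>i<n. (l2_ip (vol \<Omega>) u (e i))\<^sup>2) \<le> 1 / m * grad_ip \<Omega> u u" for n
    proof -
      have "(\<Sum>i<n. (l2_ip (vol \<Omega>) u (e i))\<^sup>2) \<le> (\<Sum>i<n. 1 / m * (grad_ip \<Omega> u (\<lambda>x. e i x / sqrt (l i)))\<^sup>2)"
        by (intro sum_mono term_le)
      also have "\<dots> = 1 / m * (\<Sum>i<n. (grad_ip \<Omega> u (\<lambda>x. e i x / sqrt (l i)))\<^sup>2)" by (simp add: sum_distrib_left)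
      also have "\<dots> \<le> 1 / m * grad_ip \<Omega> u u"
      proof (rule mult_left_mono)
        show "(\<Sum>i<n. (grad_ip \<Omega> u (\<lambda>x. e i x / sqrt (l i)))\<^sup>2) \<le> grad_ip \<Omega> u u"
        proof (rule g.bessel[OF u])
          show "(\<lambda>x. e i x / sqrt (l i)) \<in> H1 \<Omega>" for i unfolding q by (rule g.scale_mem[OF eH])
        qed (rule finite_lessThan, rule on)
      qed (use m0 in simp)
      finally show ?thesis .
    qed
    have "ip_tendsto (l2_ip (vol \<Omega>)) (\<lambda>n x. \<Sum>i<n. l2_ip (vol \<Omega>) u (e i) * e i x) u"
      using D uL by (auto simp: dirichlet_eigendata_def orthonormal_basis_def)
    then have "(\<lambda>n. l2_ip (vol \<Omega>) u u - (\<Sum>i<n. (l2_ip (vol \<Omega>) u (e i))\<^sup>2)) \<longlonglongrightarrow> 0"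
      unfolding ip_tendsto_def by (subst (asm) l2.ip_diff_partial_sum) (auto simp: uL eL eon)
    moreover have "\<exists>N. \<forall>n\<ge>N. l2_ip (vol \<Omega>) u u - 1 / m * grad_ip \<Omega> u u \<le> l2_ip (vol \<Omega>) u u - (\<Sum>i<n. (l2_ip (vol \<Omega>) u (e i))\<^sup>2)"
      using sum_le by (intro exI[of _ 0]) simp
    ultimately have "l2_ip (vol \<Omega>) u u - 1 / m * grad_ip \<Omega> u u \<le> 0" by (rule LIMSEQ_le_const)
    then show "l2_ip (vol \<Omega>) u u \<le> 1 / m * grad_ip \<Omega> u u" by simp
  qed (use m0 in simp)
qed

lemma double_sum_delta_fst:
  fixes d :: "'i \<times> 'k \<Rightarrow> real"
  assumes "finite A" "finite B"
  shows "(\<Sum>p\<in>A\<times>B. \<Sum>q\<in>A\<times>B. d p * (d q * ((if fst p = fst q then 1 else 0) * b (snd p) (snd q))))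
    = (\<Sum>j\<in>A. \<Sum>k\<in>B. d (j, k) * (\<Sum>k'\<in>B. d (j, k') * b k k'))"
proof -
  have "(\<Sum>q\<in>A\<times>B. d (j, k) * (d q * ((if j = fst q then 1 else 0) * b k (snd q))))
      = d (j, k) * (\<Sum>k'\<in>B. d (j, k') * b k k')" if "j \<in> A" for j k
  proof -
    have "(\<Sum>q\<in>A\<times>B. d (j, k) * (d q * ((if j = fst q then 1 else 0) * b k (snd q))))
      = (\<Sum>j'\<in>A. if j = j' then d (j, k) * (\<Sum>k'\<in>B. d (j', k') * b k k') else 0)"
      unfolding sum.cartesian_product'
      by (intro sum.cong refl) (auto simp: sum_distrib_left)
    then show ?thesis using assms that by simp
  qed
  then show ?thesis unfolding sum.cartesian_product'[where A=A and B=B and g="\<lambda>p. \<Sum>q\<in>A\<times>B. _ p q"] by simp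
qed

lemma double_sum_delta_snd:
  fixes d :: "'i \<times> 'k \<Rightarrow> real"
  assumes "finite A" "finite B"
  shows "(\<Sum>p\<in>A\<times>B. \<Sum>q\<in>A\<times>B. d p * (d q * (a (fst p) (fst q) * (if snd p = snd q then 1 else 0))))
    = (\<Sum>k\<in>B. \<Sum>j\<in>A. d (j, k) * (\<Sum>j'\<in>A. d (j', k) * a j j'))"
proof -
  have "(\<Sum>q\<in>A\<times>B. d (j, k) * (d q * (a j (fst q) * (if k = snd q then 1 else 0))))
      = d (j, k) * (\<Sum>j'\<in>A. d (j', k) * a j j')" if "k \<in> B" for j k
  proof -
    have "(\<Sum>q\<in>A\<times>B. d (j, k) * (d q * (a j (fst q) * (if k = snd q then 1 else 0))))
      = (\<Sum>j'\<in>A. \<Sum>k'\<in>B. if k = k' then d (j, k) * (d (j', k') * a j j') else 0)"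
      unfolding sum.cartesian_product' by (intro sum.cong refl) auto
    then show ?thesis using assms that by (simp add: sum_distrib_left)
  qed
  then show ?thesis
    unfolding sum.cartesian_product'[where A=A and B=B and g="\<lambda>p. \<Sum>q\<in>A\<times>B. _ p q"]
    by (subst sum.swap) simp
qed

definition basis_tensor_gradient where
  "basis_tensor_gradient \<Omega>1 E \<Omega>2 F p =
     tensor_gradient (E (fst p)) (wgrad \<Omega>1 (E (fst p))) (F (snd p)) (wgrad \<Omega>2 (F (snd p)))"

context
  fixes \<Omega>1 :: "'a::euclidean_space set" and \<Omega>2 :: "'b::euclidean_space set"
    and E :: "nat \<Rightarrow> 'a \<Rightarrow> real" and F :: "nat \<Rightarrow> 'b \<Rightarrow> real" and C :: real
  assumes \<Omega>: "open \<Omega>1" "open \<Omega>2"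
    and E: "\<And>j. E j \<in> H1 \<Omega>1" "\<And>i j. grad_ip \<Omega>1 (E i) (E j) = (if i = j then 1 else 0)"
    and poincare: "\<And>t n. l2_ip (vol \<Omega>1) (\<lambda>x. \<Sum>j<n. t j * E j x) (\<lambda>x. \<Sum>j<n. t j * E j x) \<le> C * (\<Sum>j<n. (t j)\<^sup>2)"
    and F: "\<And>k. F k \<in> H1 \<Omega>2" "\<And>i j. h1_ip \<Omega>2 (F i) (F j) = (if i = j then 1 else 0)"
begin

lemma basis_tensor_square_integrable:
  "E (fst p) \<otimes>\<^sub>f F (snd p) \<in> L2 (vol (\<Omega>1 \<times> \<Omega>2))"
  "basis_tensor_gradient \<Omega>1 E \<Omega>2 F p \<in> borel_measurable (vol (\<Omega>1 \<times> \<Omega>2))"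
  "integrable (vol (\<Omega>1 \<times> \<Omega>2)) (\<lambda>z. (norm (basis_tensor_gradient \<Omega>1 E \<Omega>2 F p z))\<^sup>2)"
  "has_weak_gradient (\<Omega>1 \<times> \<Omega>2) (E (fst p) \<otimes>\<^sub>f F (snd p)) (basis_tensor_gradient \<Omega>1 E \<Omega>2 F p)"
proof -
  interpret pair_sigma_finite "vol \<Omega>1" "vol \<Omega>2" using \<Omega> by (intro pair_sigma_finite_vol) auto
  have vt: "vol (\<Omega>1 \<times> \<Omega>2) = vol \<Omega>1 \<Otimes>\<^sub>M vol \<Omega>2" using \<Omega> by (intro vol_times) auto
  show "E (fst p) \<otimes>\<^sub>f F (snd p) \<in> L2 (vol (\<Omega>1 \<times> \<Omega>2))"
    unfolding vt by (intro tensor_L2 H1_L2 E F)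
  show g: "has_weak_gradient (\<Omega>1 \<times> \<Omega>2) (E (fst p) \<otimes>\<^sub>f F (snd p)) (basis_tensor_gradient \<Omega>1 E \<Omega>2 F p)"
    unfolding basis_tensor_gradient_def by (intro weak_gradient_tensor \<Omega> H1_L2 has_weak_gradient_wgrad E F)
  then show "basis_tensor_gradient \<Omega>1 E \<Omega>2 F p \<in> borel_measurable (vol (\<Omega>1 \<times> \<Omega>2))"
    "integrable (vol (\<Omega>1 \<times> \<Omega>2)) (\<lambda>z. (norm (basis_tensor_gradient \<Omega>1 E \<Omega>2 F p z))\<^sup>2)"
    by (auto simp: has_weak_gradient_def)
qed

lemma basis_tensor_gradient_inner:
  "(LINT z|vol (\<Omega>1 \<times> \<Omega>2). basis_tensor_gradient \<Omega>1 E \<Omega>2 F p z \<bullet> basis_tensor_gradient \<Omega>1 E \<Omega>2 F q z)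
   = grad_ip \<Omega>1 (E (fst p)) (E (fst q)) * l2_ip (vol \<Omega>2) (F (snd p)) (F (snd q))
   + l2_ip (vol \<Omega>1) (E (fst p)) (E (fst q)) * grad_ip \<Omega>2 (F (snd p)) (F (snd q))"
proof -
  interpret pair_sigma_finite "vol \<Omega>1" "vol \<Omega>2" using \<Omega> by (intro pair_sigma_finite_vol) auto
  have vt: "vol (\<Omega>1 \<times> \<Omega>2) = vol \<Omega>1 \<Otimes>\<^sub>M vol \<Omega>2" using \<Omega> by (intro vol_times) auto
  have gE: "integrable (vol \<Omega>1) (\<lambda>x. wgrad \<Omega>1 (E i) x \<bullet> wgrad \<Omega>1 (E j) x)" for i j
    by (intro integrable_inner_square wgrad_measurable wgrad_square_integrable E)
  have gF: "integrable (vol \<Omega>2) (\<lambda>x. wgrad \<Omega>2 (F i) x \<bullet> wgrad \<Omega>2 (F j) x)" for i j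
    by (intro integrable_inner_square wgrad_measurable wgrad_square_integrable F)
  have lE: "integrable (vol \<Omega>1) (\<lambda>x. E i x * E j x)" for i j by (intro L2_mult_integrable H1_L2 E)
  have lF: "integrable (vol \<Omega>2) (\<lambda>x. F i x * F j x)" for i j by (intro L2_mult_integrable H1_L2 F)
  have "basis_tensor_gradient \<Omega>1 E \<Omega>2 F p z \<bullet> basis_tensor_gradient \<Omega>1 E \<Omega>2 F q z =
     (wgrad \<Omega>1 (E (fst p)) (fst z) \<bullet> wgrad \<Omega>1 (E (fst q)) (fst z)) * (F (snd p) (snd z) * F (snd q) (snd z)) +
     (E (fst p) (fst z) * E (fst q) (fst z)) * (wgrad \<Omega>2 (F (snd p)) (snd z) \<bullet> wgrad \<Omega>2 (F (snd q)) (snd z))" for z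
    by (simp add: basis_tensor_gradient_def tensor_gradient_def inner_prod_def mult_ac)
  then show ?thesis
    unfolding vt by (simp add: integrable_tensor[OF gE lF] integrable_tensor[OF lE gF] integral_tensor[OF gE lF] integral_tensor[OF lE gF]
      grad_ip_def l2_ip_def)
qed

text \<open>Write \<open>s\<close> for the tensor sum with coefficients \<open>d\<close>. The \<open>x\<close>-gradient of \<open>s\<close> has squared norm
  \<open>\<Sum>j. |\<Sum>k. d (j, k) F_k|^2\<close>, as the \<open>E_j\<close> have orthonormal gradients. The squared norms of the \<open>y\<close>-gradient of \<open>s\<close>
  and of \<open>s\<close> itself add up to \<open>\<Sum>k. |\<Sum>j. d (j, k) E_j|^2\<close>, as the \<open>F_k\<close> are orthonormal in \<open>H^1\<close>. Here all norms on the right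
  are \<open>L^2\<close> norms; the \<open>H^1\<close> norm bounds the first sum and Poincare's inequality the second.\<close>

lemma tensor_combination_gradient_bound:
  assumes I: "I \<subseteq> {..<n} \<times> {..<n}"
  shows "(LINT z|vol (\<Omega>1 \<times> \<Omega>2). (norm (\<Sum>p\<in>I. d p *\<^sub>R basis_tensor_gradient \<Omega>1 E \<Omega>2 F p z))\<^sup>2) \<le> (1 + C) * (\<Sum>p\<in>I. (d p)\<^sup>2)"
proof -
  interpret pair_sigma_finite "vol \<Omega>1" "vol \<Omega>2" using \<Omega> by (intro pair_sigma_finite_vol) auto
  interpret h: semi_inner_space "H1 \<Omega>2" "h1_ip \<Omega>2" using \<Omega>(2) by (rule h1_semi_inner_space)
  have vt: "vol (\<Omega>1 \<times> \<Omega>2) = vol \<Omega>1 \<Otimes>\<^sub>M vol \<Omega>2" using \<Omega> by (intro vol_times) auto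
  define c where "c p = (if p \<in> I then d p else 0)" for p
  define S where "S = {..<n} \<times> {..<n}"
  have S: "finite S" "I \<subseteq> S" using I by (auto simp: S_def)
  let ?W = "basis_tensor_gradient \<Omega>1 E \<Omega>2 F"
  let ?a = "\<lambda>i j. l2_ip (vol \<Omega>1) (E i) (E j)" and ?b = "\<lambda>i j. l2_ip (vol \<Omega>2) (F i) (F j)"
  have sumI: "(\<Sum>p\<in>I. d p *\<^sub>R ?W p z) = (\<Sum>p\<in>S. c p *\<^sub>R ?W p z)" for z
    using S by (intro sum.mono_neutral_cong_left) (auto simp: c_def)
  have sqI: "(\<Sum>p\<in>I. (d p)\<^sup>2) = (\<Sum>p\<in>S. (c p)\<^sup>2)"
    using S by (intro sum.mono_neutral_cong_left) (auto simp: c_def)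
  have Wint: "integrable (vol (\<Omega>1 \<times> \<Omega>2)) (\<lambda>z. ?W p z \<bullet> ?W q z)" for p q
    by (intro integrable_inner_square basis_tensor_square_integrable)
  \<comment> \<open>\<open>H^1\<close> orthonormality expresses the gradient products by the \<open>L^2\<close> products.\<close>
  have gradF: "grad_ip \<Omega>2 (F i) (F j) = (if i = j then 1 else 0) - ?b i j" for i j
    using F(2)[of i j] by (simp add: h1_ip_def)
  have "(LINT z|vol (\<Omega>1 \<times> \<Omega>2). (norm (\<Sum>p\<in>I. d p *\<^sub>R ?W p z))\<^sup>2)
      = (LINT z|vol (\<Omega>1 \<times> \<Omega>2). (\<Sum>p\<in>S. \<Sum>q\<in>S. c p * (c q * (?W p z \<bullet> ?W q z))))"
    by (simp add: sumI power2_norm_eq_inner inner_sum_left inner_sum_right sum_distrib_left inner_commute mult.left_commute)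
  also have "\<dots> = (\<Sum>p\<in>S. \<Sum>q\<in>S. c p * (c q * (LINT z|vol (\<Omega>1 \<times> \<Omega>2). ?W p z \<bullet> ?W q z)))"
    using Wint by (simp add: Bochner_Integration.integral_sum)
  also have "\<dots> = (\<Sum>p\<in>S. \<Sum>q\<in>S. c p * (c q * ((if fst p = fst q then 1 else 0) * ?b (snd p) (snd q))))
      + (\<Sum>p\<in>S. \<Sum>q\<in>S. c p * (c q * (?a (fst p) (fst q) * (if snd p = snd q then 1 else 0))))
      - (\<Sum>p\<in>S. \<Sum>q\<in>S. c p * (c q * (?a (fst p) (fst q) * ?b (snd p) (snd q))))"
    unfolding basis_tensor_gradient_inner E(2) gradF
    by (simp only: right_diff_distrib distrib_left sum.distrib sum_subtractf add_diff_eq)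
  also have "(\<Sum>p\<in>S. \<Sum>q\<in>S. c p * (c q * (?a (fst p) (fst q) * ?b (snd p) (snd q)))) =
      l2_ip (vol (\<Omega>1 \<times> \<Omega>2)) (\<lambda>z. \<Sum>p\<in>S. c p * (E (fst p) \<otimes>\<^sub>f F (snd p)) z) (\<lambda>z. \<Sum>p\<in>S. c p * (E (fst p) \<otimes>\<^sub>f F (snd p)) z)"
  proof -
    have TL: "E (fst p) \<otimes>\<^sub>f F (snd p) \<in> L2 (vol (\<Omega>1 \<times> \<Omega>2))" for p by (rule basis_tensor_square_integrable)
    show ?thesis
      by (subst l2.sum_left[OF TL l2.sum_mem[OF TL]], subst l2.sum_right[OF TL TL])
        (simp add: vt l2_ip_tensor H1_L2 E F sum_distrib_left)
  qed
  also have "(\<Sum>p\<in>S. \<Sum>q\<in>S. c p * (c q * ((if fst p = fst q then 1 else 0) * ?b (snd p) (snd q))))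
      \<le> (\<Sum>p\<in>S. (c p)\<^sup>2)"
  proof -
    have "(\<Sum>p\<in>S. \<Sum>q\<in>S. c p * (c q * ((if fst p = fst q then 1 else 0) * ?b (snd p) (snd q))))
       = (\<Sum>j<n. \<Sum>k<n. c (j, k) * (\<Sum>k'<n. c (j, k') * ?b k k'))"
      unfolding S_def by (rule double_sum_delta_fst) auto
    also have "\<dots> = (\<Sum>j<n. l2_ip (vol \<Omega>2) (\<lambda>y. \<Sum>k<n. c (j, k) * F k y) (\<lambda>y. \<Sum>k<n. c (j, k) * F k y))"
    proof (rule sum.cong[OF refl])
      fix j
      have FL: "F k \<in> L2 (vol \<Omega>2)" for k by (intro H1_L2 F)
      show "(\<Sum>k<n. c (j, k) * (\<Sum>k'<n. c (j, k') * ?b k k')) = l2_ip (vol \<Omega>2) (\<lambda>y. \<Sum>k<n. c (j, k) * F k y) (\<lambda>y. \<Sum>k<n. c (j, k) * F k y)"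
        by (subst l2.sum_left[OF FL l2.sum_mem[OF FL]], subst l2.sum_right[OF FL FL]) simp
    qed
    also have "\<dots> \<le> (\<Sum>j<n. h1_ip \<Omega>2 (\<lambda>y. \<Sum>k<n. c (j, k) * F k y) (\<lambda>y. \<Sum>k<n. c (j, k) * F k y))"
      by (intro sum_mono l2_le_h1)
    also have "\<dots> = (\<Sum>j<n. \<Sum>k<n. (c (j, k))\<^sup>2)"
      by (intro sum.cong refl h.ip_sum_orthonormal F) auto
    also have "\<dots> = (\<Sum>p\<in>S. (c p)\<^sup>2)" unfolding S_def by (rule sum.cartesian_product'[symmetric])
    finally show ?thesis .
  qed
  also have "(\<Sum>p\<in>S. \<Sum>q\<in>S. c p * (c q * (?a (fst p) (fst q) * (if snd p = snd q then 1 else 0))))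
      \<le> C * (\<Sum>p\<in>S. (c p)\<^sup>2)"
  proof -
    have "(\<Sum>p\<in>S. \<Sum>q\<in>S. c p * (c q * (?a (fst p) (fst q) * (if snd p = snd q then 1 else 0))))
       = (\<Sum>k<n. \<Sum>j<n. c (j, k) * (\<Sum>j'<n. c (j', k) * ?a j j'))"
      unfolding S_def by (rule double_sum_delta_snd) auto
    also have "\<dots> = (\<Sum>k<n. l2_ip (vol \<Omega>1) (\<lambda>x. \<Sum>j<n. c (j, k) * E j x) (\<lambda>x. \<Sum>j<n. c (j, k) * E j x))"
    proof (rule sum.cong[OF refl])
      fix k
      have EL: "E j \<in> L2 (vol \<Omega>1)" for j by (intro H1_L2 E)
      show "(\<Sum>j<n. c (j, k) * (\<Sum>j'<n. c (j', k) * ?a j j')) = l2_ip (vol \<Omega>1) (\<lambda>x. \<Sum>j<n. c (j, k) * E j x) (\<lambda>x. \<Sum>j<n. c (j, k) * E j x)"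
        by (subst l2.sum_left[OF EL l2.sum_mem[OF EL]], subst l2.sum_right[OF EL EL]) simp
    qed
    also have "\<dots> \<le> (\<Sum>k<n. C * (\<Sum>j<n. (c (j, k))\<^sup>2))" by (intro sum_mono poincare)
    also have "\<dots> = C * (\<Sum>j<n. \<Sum>k<n. (c (j, k))\<^sup>2)"
      unfolding sum_distrib_left[symmetric] by (subst sum.swap) simp
    also have "(\<Sum>j<n. \<Sum>k<n. (c (j, k))\<^sup>2) = (\<Sum>p\<in>S. (c p)\<^sup>2)" unfolding S_def by (rule sum.cartesian_product'[symmetric])
    finally show ?thesis .
  qed
  finally have "(LINT z|vol (\<Omega>1 \<times> \<Omega>2). (norm (\<Sum>p\<in>I. d p *\<^sub>R ?W p z))\<^sup>2)
     \<le> (\<Sum>p\<in>S. (c p)\<^sup>2) + C * (\<Sum>p\<in>S. (c p)\<^sup>2)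
      - l2_ip (vol (\<Omega>1 \<times> \<Omega>2)) (\<lambda>z. \<Sum>p\<in>S. c p * (E (fst p) \<otimes>\<^sub>f F (snd p)) z) (\<lambda>z. \<Sum>p\<in>S. c p * (E (fst p) \<otimes>\<^sub>f F (snd p)) z)" by simp
  moreover have "0 \<le> l2_ip (vol (\<Omega>1 \<times> \<Omega>2)) (\<lambda>z. \<Sum>p\<in>S. c p * (E (fst p) \<otimes>\<^sub>f F (snd p)) z) (\<lambda>z. \<Sum>p\<in>S. c p * (E (fst p) \<otimes>\<^sub>f F (snd p)) z)"
    by (intro l2.nonneg l2.sum_mem basis_tensor_square_integrable)
  ultimately show ?thesis by (simp add: sqI distrib_right)
qed

end

section \<open>Elements of the tensor product space\<close>
text \<open>Convergence in \<open>L^2\<close> of the product means convergence in \<open>L^1\<close> of the squared slice distances. Along a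
  subsequence these tend to zero for almost every \<open>x\<close>, and weak gradients are closed under such limits.\<close>

lemma weak_gradient_slice_limit:
  fixes \<Omega>1 :: "'a::euclidean_space set" and \<Omega>2 :: "'b::euclidean_space set"
  assumes \<Omega>: "open \<Omega>1" "open \<Omega>2"
    and s: "\<And>n. s n \<in> L2 (vol (\<Omega>1 \<times> \<Omega>2))" and h: "h \<in> L2 (vol (\<Omega>1 \<times> \<Omega>2))"
    and P: "\<And>n. P n \<in> borel_measurable (vol (\<Omega>1 \<times> \<Omega>2))" "\<And>n. integrable (vol (\<Omega>1 \<times> \<Omega>2)) (\<lambda>z. (norm (P n z))\<^sup>2)"
    and G: "G \<in> borel_measurable (vol (\<Omega>1 \<times> \<Omega>2))" "integrable (vol (\<Omega>1 \<times> \<Omega>2)) (\<lambda>z. (norm (G z))\<^sup>2)"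
    and slim: "(\<lambda>n. LINT z|vol (\<Omega>1 \<times> \<Omega>2). (norm (s n z - h z))\<^sup>2) \<longlonglongrightarrow> 0"
    and Plim: "(\<lambda>n. LINT z|vol (\<Omega>1 \<times> \<Omega>2). (norm (P n z - G z))\<^sup>2) \<longlonglongrightarrow> 0"
    and slice: "\<And>n x. (\<lambda>y. s n (x, y)) \<in> L2 (vol \<Omega>2) \<and> has_weak_gradient \<Omega>2 (\<lambda>y. s n (x, y)) (\<lambda>y. P n (x, y))"
  shows "AE x in vol \<Omega>1. (\<lambda>y. h (x, y)) \<in> L2 (vol \<Omega>2) \<and> has_weak_gradient \<Omega>2 (\<lambda>y. h (x, y)) (\<lambda>y. G (x, y))"
proof -
  interpret pair_sigma_finite "vol \<Omega>1" "vol \<Omega>2" using \<Omega> by (intro pair_sigma_finite_vol) auto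
  have vt: "vol (\<Omega>1 \<times> \<Omega>2) = vol \<Omega>1 \<Otimes>\<^sub>M vol \<Omega>2" using \<Omega> by (intro vol_times) auto
  define f where "f n z = (norm (s n z - h z))\<^sup>2 + (norm (P n z - G z))\<^sup>2" for n z
  have i1: "integrable (vol (\<Omega>1 \<times> \<Omega>2)) (\<lambda>z. (norm (s n z - h z))\<^sup>2)" for n
    using s[of n] h by (intro square_integrable_diff) (auto simp: L2_iff)
  have i2: "integrable (vol (\<Omega>1 \<times> \<Omega>2)) (\<lambda>z. (norm (P n z - G z))\<^sup>2)" for n
    by (intro square_integrable_diff P G)
  have fint: "integrable (vol \<Omega>1 \<Otimes>\<^sub>M vol \<Omega>2) (f n)" for n
    unfolding vt[symmetric] f_def using i1 i2 by (rule Bochner_Integration.integrable_add)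
  define u where "u n x = (LINT y|vol \<Omega>2. f n (x, y))" for n x
  have fnn: "0 \<le> f n z" for n z by (simp add: f_def)
  have unn: "0 \<le> u n x" for n x unfolding u_def by (simp add: fnn)
  have "(LINT x|vol \<Omega>1. norm (u n x)) = (LINT z|vol (\<Omega>1 \<times> \<Omega>2). (norm (s n z - h z))\<^sup>2) + (LINT z|vol (\<Omega>1 \<times> \<Omega>2). (norm (P n z - G z))\<^sup>2)" for n
    using integral_fst'[OF fint[of n]] i1[of n] i2[of n] unn
    by (simp add: u_def vt f_def[abs_def])
  then have "(\<lambda>n. LINT x|vol \<Omega>1. norm (u n x)) \<longlonglongrightarrow> 0"
    using tendsto_add[OF slim Plim] by simp
  moreover have "integrable (vol \<Omega>1) (u n)" for n unfolding u_def by (rule integrable_fst'[OF fint])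
  ultimately obtain r where r: "strict_mono (r :: nat \<Rightarrow> nat)" "AE x in vol \<Omega>1. (\<lambda>n. u (r n) x) \<longlonglongrightarrow> 0"
    using tendsto_L1_AE_subseq by blast
  have hm[measurable]: "h \<in> borel_measurable (vol \<Omega>1 \<Otimes>\<^sub>M vol \<Omega>2)" and Gm[measurable]: "G \<in> borel_measurable (vol \<Omega>1 \<Otimes>\<^sub>M vol \<Omega>2)"
    using h G by (auto simp: L2_def vt)
  have "AE x in vol \<Omega>1. \<forall>n. integrable (vol \<Omega>2) (\<lambda>y. f n (x, y))"
    unfolding AE_all_countable using AE_integrable_fst'[OF fint] by blast
  moreover have "AE x in vol \<Omega>1. integrable (vol \<Omega>2) (\<lambda>y. (norm (h (x, y)))\<^sup>2)"
    using h AE_integrable_fst'[of "\<lambda>z. (norm (h z))\<^sup>2"] by (simp add: L2_def vt)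
  moreover have "AE x in vol \<Omega>1. integrable (vol \<Omega>2) (\<lambda>y. (norm (G (x, y)))\<^sup>2)"
    using G AE_integrable_fst'[of "\<lambda>z. (norm (G z))\<^sup>2"] by (simp add: vt)
  ultimately show ?thesis
    using r(2) AE_space
  proof eventually_elim
    case (elim x)
    have hL: "(\<lambda>y. h (x, y)) \<in> L2 (vol \<Omega>2)"
      using elim(2,5) measurable_compose[OF measurable_Pair1' hm, of x] by (simp add: L2_iff)
    have GL: "(\<lambda>y. G (x, y)) \<in> borel_measurable (vol \<Omega>2)" "integrable (vol \<Omega>2) (\<lambda>y. (norm (G (x, y)))\<^sup>2)"
      using elim(3,5) measurable_compose[OF measurable_Pair1' Gm, of x] by simp_all
    have sL: "(\<lambda>y. s n (x, y)) \<in> L2 (vol \<Omega>2)" for n using slice by blast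
    have PL: "(\<lambda>y. P n (x, y)) \<in> borel_measurable (vol \<Omega>2)" "integrable (vol \<Omega>2) (\<lambda>y. (norm (P n (x, y)))\<^sup>2)" for n
      using slice[of n x] by (auto simp: has_weak_gradient_def)
    have j1: "integrable (vol \<Omega>2) (\<lambda>y. (norm (s n (x, y) - h (x, y)))\<^sup>2)" for n
      using sL[of n] hL by (intro square_integrable_diff) (auto simp: L2_iff)
    have j2: "integrable (vol \<Omega>2) (\<lambda>y. (norm (P n (x, y) - G (x, y)))\<^sup>2)" for n
      by (intro square_integrable_diff PL GL)
    have ueq: "u n x = (LINT y|vol \<Omega>2. (norm (s n (x, y) - h (x, y)))\<^sup>2) + (LINT y|vol \<Omega>2. (norm (P n (x, y) - G (x, y)))\<^sup>2)" for n
      unfolding u_def f_def by (rule Bochner_Integration.integral_add[OF j1 j2])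
    have l1: "(\<lambda>n. LINT y|vol \<Omega>2. (norm (s (r n) (x, y) - h (x, y)))\<^sup>2) \<longlonglongrightarrow> 0"
      by (rule tendsto_sandwich[OF _ _ tendsto_const elim(4)]) (auto simp: ueq)
    have l2: "(\<lambda>n. LINT y|vol \<Omega>2. (norm (P (r n) (x, y) - G (x, y)))\<^sup>2) \<longlonglongrightarrow> 0"
      by (rule tendsto_sandwich[OF _ _ tendsto_const elim(4)]) (auto simp: ueq)
    have "has_weak_gradient \<Omega>2 (\<lambda>y. h (x, y)) (\<lambda>y. G (x, y))"
      by (rule weak_gradient_limit[OF \<Omega>(2) sL _ hL GL l1 l2]) (use slice in blast)
    with hL show ?case by blast
  qed
qed

text \<open>The coefficients are square summable, so the gradients of the partial sums are Cauchy in \<open>L^2\<close> and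
  converge to some \<open>G\<close>. Closedness of weak gradients, on the product and on almost every slice, gives the first two
  properties. The third is the Dirichlet eigenvalue equation in the variable \<open>x\<close>: it holds for every term
  \<open>E_j \<otimes> F_k\<close> by Fubini, hence for the partial sums, and it passes to the limit.\<close>

lemma V_space_gradient:
  fixes \<Omega>1 :: "'a::euclidean_space set" and \<Omega>2 :: "'b::euclidean_space set"
  assumes \<Omega>: "open \<Omega>1" "open \<Omega>2" and D: "dirichlet_eigendata \<Omega>1 l e"
    and h: "h \<in> V_space \<Omega>1 \<Omega>2"
  obtains G where "has_weak_gradient (\<Omega>1 \<times> \<Omega>2) h G"
    "AE x in vol \<Omega>1. (\<lambda>y. h (x, y)) \<in> L2 (vol \<Omega>2) \<and> has_weak_gradient \<Omega>2 (\<lambda>y. h (x, y)) (\<lambda>y. snd (G (x, y)))"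
    "\<And>j g. g \<in> L2 (vol \<Omega>2) \<Longrightarrow>
       (LINT z|vol (\<Omega>1 \<times> \<Omega>2). G z \<bullet> (g (snd z) *\<^sub>R wgrad \<Omega>1 (e j) (fst z), 0)) = l j * l2_ip (vol (\<Omega>1 \<times> \<Omega>2)) h (e j \<otimes>\<^sub>f g)"
proof -
  interpret pair_sigma_finite "vol \<Omega>1" "vol \<Omega>2" using \<Omega> by (intro pair_sigma_finite_vol) auto
  have vt: "vol (\<Omega>1 \<times> \<Omega>2) = vol \<Omega>1 \<Otimes>\<^sub>M vol \<Omega>2" using \<Omega> by (intro vol_times) auto
  have \<Omega>12: "open (\<Omega>1 \<times> \<Omega>2)" using \<Omega> by (rule open_Times)
  interpret g: semi_inner_space "H1 \<Omega>1" "grad_ip \<Omega>1" using \<Omega>(1) by (rule grad_semi_inner_space)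
  let ?M = "vol (\<Omega>1 \<times> \<Omega>2)"
  from h obtain E F and c :: "nat \<Rightarrow> nat \<Rightarrow> real" where
    hL: "h \<in> L2 ?M" and EB: "orthonormal_basis (H10 \<Omega>1) (grad_ip \<Omega>1) E"
    and FB: "orthonormal_basis (H1 \<Omega>2) (h1_ip \<Omega>2) F"
    and csum: "(\<lambda>(j, k). (c j k)\<^sup>2) summable_on UNIV"
    and slim0: "ip_tendsto (l2_ip ?M) (\<lambda>n z. \<Sum>j<n. \<Sum>k<n. c j k * (E j \<otimes>\<^sub>f F k) z) h"
    unfolding V_space_def hilbert_tensor_def by blast
  have E0: "E j \<in> H10 \<Omega>1" and EH: "E j \<in> H1 \<Omega>1" and Eon: "grad_ip \<Omega>1 (E i) (E j) = (if i = j then 1 else 0)" for i j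
    using EB by (auto simp: orthonormal_basis_def orthonormal_family_def H10_H1)
  have FH: "F j \<in> H1 \<Omega>2" and Fon: "h1_ip \<Omega>2 (F i) (F j) = (if i = j then 1 else 0)" for i j
    using FB by (auto simp: orthonormal_basis_def orthonormal_family_def)
  have eH: "e j \<in> H1 \<Omega>1" and eig: "v \<in> H10 \<Omega>1 \<Longrightarrow> grad_ip \<Omega>1 (e j) v = l j * l2_ip (vol \<Omega>1) (e j) v" for j v
    using D by (auto simp: dirichlet_eigendata_def eigenpair_def H10_H1)
  obtain C where C: "C \<ge> 0"
    "\<And>u. u \<in> H1 \<Omega>1 \<Longrightarrow> (\<And>i. grad_ip \<Omega>1 (e i) u = l i * l2_ip (vol \<Omega>1) (e i) u) \<Longrightarrow> l2_ip (vol \<Omega>1) u u \<le> C * grad_ip \<Omega>1 u u"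
    using dirichlet_poincare[OF \<Omega>(1) D] by blast
  have poincare: "l2_ip (vol \<Omega>1) (\<lambda>x. \<Sum>j<n. t j * E j x) (\<lambda>x. \<Sum>j<n. t j * E j x) \<le> C * (\<Sum>j<n. (t j)\<^sup>2)" for t n
  proof -
    have "grad_ip \<Omega>1 (e i) (\<lambda>x. \<Sum>j<n. t j * E j x) = l i * l2_ip (vol \<Omega>1) (e i) (\<lambda>x. \<Sum>j<n. t j * E j x)" for i
      using g.sum_right[OF EH eH[of i], where I="{..<n}" and c=t]
        l2.sum_right[OF H1_L2[OF EH] H1_L2[OF eH[of i]], where I="{..<n}" and c=t]
      by (simp add: eig E0 sum_distrib_left mult_ac)
    then have "l2_ip (vol \<Omega>1) (\<lambda>x. \<Sum>j<n. t j * E j x) (\<lambda>x. \<Sum>j<n. t j * E j x)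
       \<le> C * grad_ip \<Omega>1 (\<lambda>x. \<Sum>j<n. t j * E j x) (\<lambda>x. \<Sum>j<n. t j * E j x)"
      by (intro C(2) g.sum_mem EH)
    also have "grad_ip \<Omega>1 (\<lambda>x. \<Sum>j<n. t j * E j x) (\<lambda>x. \<Sum>j<n. t j * E j x) = (\<Sum>j<n. (t j)\<^sup>2)"
      by (intro g.ip_sum_orthonormal EH Eon) auto
    finally show ?thesis .
  qed
  let ?W = "basis_tensor_gradient \<Omega>1 E \<Omega>2 F"
  let ?T = "\<lambda>p. E (fst p) \<otimes>\<^sub>f F (snd p)"
  note W = basis_tensor_square_integrable[OF \<Omega> EH Eon poincare FH Fon]
  note bound = tensor_combination_gradient_bound[OF \<Omega> EH Eon poincare FH Fon]
  define cc where "cc p = c (fst p) (snd p)" for p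
  define S where "S n = {..<n} \<times> {..<n}" for n :: nat
  have S: "finite (S n)" "m \<le> n \<Longrightarrow> S m \<subseteq> S n" for m n by (auto simp: S_def)
  define s where "s n z = (\<Sum>p\<in>S n. cc p * ?T p z)" for n z
  define P where "P n z = (\<Sum>p\<in>S n. cc p *\<^sub>R ?W p z)" for n z
  define q where "q n = (\<Sum>p\<in>S n. (cc p)\<^sup>2)" for n
  have sL: "s n \<in> L2 ?M" for n unfolding s_def by (intro l2.sum_mem W)
  have sP: "has_weak_gradient (\<Omega>1 \<times> \<Omega>2) (s n) (P n)" for n
    unfolding s_def P_def by (intro weak_gradient_sum \<Omega>12 W)
  have PL: "P n \<in> borel_measurable ?M" "integrable ?M (\<lambda>z. (norm (P n z))\<^sup>2)" for n
    using sP by (auto simp: has_weak_gradient_def)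
  have "s n z = (\<Sum>j<n. \<Sum>k<n. c j k * (E j \<otimes>\<^sub>f F k) z)" for n z
    unfolding s_def S_def sum.cartesian_product' cc_def by simp
  then have slim: "(\<lambda>n. LINT z|?M. (norm (s n z - h z))\<^sup>2) \<longlonglongrightarrow> 0"
    using slim0 by (simp add: ip_tendsto_def l2_ip_diff_self)
  \<comment> \<open>The increments of \<open>P\<close> are tensor sums over a difference of two squares of indices.\<close>
  have qdiff: "(LINT z|?M. (norm (P n z - P m z))\<^sup>2) \<le> (1 + C) * \<bar>q n - q m\<bar>" for m n
  proof -
    have le: "(LINT z|?M. (norm (P n z - P m z))\<^sup>2) \<le> (1 + C) * \<bar>q n - q m\<bar>" if "m \<le> n" for m n
    proof -
      have "P n z - P m z = (\<Sum>p\<in>S n - S m. cc p *\<^sub>R ?W p z)" for z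
        unfolding P_def using S that by (simp add: sum_diff)
      then have "(LINT z|?M. (norm (P n z - P m z))\<^sup>2) \<le> (1 + C) * (\<Sum>p\<in>S n - S m. (cc p)\<^sup>2)"
        using bound[of "S n - S m" n cc] by (auto simp: S_def)
      also have "(\<Sum>p\<in>S n - S m. (cc p)\<^sup>2) = q n - q m"
        unfolding q_def using S that by (simp add: sum_diff)
      also have "(1 + C) * (q n - q m) \<le> (1 + C) * \<bar>q n - q m\<bar>" using C(1) by (intro mult_left_mono) auto
      finally show ?thesis .
    qed
    show ?thesis
      using le[of m n] le[of n m] by (cases "m \<le> n") (auto simp: norm_minus_commute abs_minus_commute)
  qed
  have "convergent q"
  proof (rule Bseq_monoseq_convergent)
    have csum': "(\<lambda>p. (cc p)\<^sup>2) summable_on UNIV" using csum by (simp add: cc_def case_prod_unfold)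
    show "Bseq q"
    proof (rule BseqI')
      show "norm (q n) \<le> infsum (\<lambda>p. (cc p)\<^sup>2) UNIV" for n
        unfolding q_def using finite_sum_le_infsum[OF csum' S(1)] by (simp add: sum_nonneg)
    qed
    show "monoseq q" using S by (auto simp: monoseq_def q_def intro!: sum_mono2)
  qed
  then have Cq: "Cauchy q" by (rule convergent_Cauchy)
  have Pcauchy: "\<exists>N. \<forall>m\<ge>N. \<forall>n\<ge>N. (LINT z|?M. (norm (P m z - P n z))\<^sup>2) < d" if d: "d > 0" for d
  proof -
    obtain N where N: "\<And>m n. m \<ge> N \<Longrightarrow> n \<ge> N \<Longrightarrow> \<bar>q m - q n\<bar> < d / (1 + C)"
      using Cq C(1) d unfolding Cauchy_def dist_real_def
      by (metis add_strict_increasing divide_pos_pos zero_less_one)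
    have "(LINT z|?M. (norm (P m z - P n z))\<^sup>2) < d" if "m \<ge> N" "n \<ge> N" for m n
    proof -
      have "(LINT z|?M. (norm (P m z - P n z))\<^sup>2) \<le> (1 + C) * \<bar>q m - q n\<bar>" by (rule qdiff)
      also have "\<dots> < (1 + C) * (d / (1 + C))" using N[OF that] C(1) by (intro mult_strict_left_mono) auto
      finally show ?thesis using C(1) by simp
    qed
    then show ?thesis by blast
  qed
  obtain G where G: "G \<in> borel_measurable ?M" "integrable ?M (\<lambda>z. (norm (G z))\<^sup>2)"
    and Glim: "(\<lambda>n. LINT z|?M. (norm (P n z - G z))\<^sup>2) \<longlonglongrightarrow> 0"
    by (rule riesz_fischer[OF PL Pcauchy])
  show ?thesis
  proof (rule that[of G])
    show "has_weak_gradient (\<Omega>1 \<times> \<Omega>2) h G"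
      by (rule weak_gradient_limit[OF \<Omega>12 sL sP hL G slim Glim])
    show "AE x in vol \<Omega>1. (\<lambda>y. h (x, y)) \<in> L2 (vol \<Omega>2) \<and> has_weak_gradient \<Omega>2 (\<lambda>y. h (x, y)) (\<lambda>y. snd (G (x, y)))"
    proof (rule weak_gradient_slice_limit[OF \<Omega> sL hL, where P="\<lambda>n z. snd (P n z)" and G="\<lambda>z. snd (G z)"])
      have snd_le: "norm (snd w) \<le> norm w" for w :: "'a \<times> 'b" by (cases w) (simp add: norm_snd_le)
      have sndm: "(\<lambda>z. snd (A z)) \<in> borel_measurable ?M" if "A \<in> borel_measurable ?M" for A :: "'a \<times> 'b \<Rightarrow> 'a \<times> 'b"
        by (rule measurable_compose[OF that]) (intro borel_measurable_continuous_onI continuous_intros)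
      have sndint: "integrable ?M (\<lambda>z. (norm (snd (A z)))\<^sup>2)"
        if "A \<in> borel_measurable ?M" "integrable ?M (\<lambda>z. (norm (A z :: 'a \<times> 'b))\<^sup>2)" for A
      proof (rule Bochner_Integration.integrable_bound[OF that(2)])
        show "(\<lambda>z. (norm (snd (A z)))\<^sup>2) \<in> borel_measurable ?M"
          using sndm[OF that(1)] by measurable
      qed (auto intro!: AE_I2 power_mono snd_le)
      show "(\<lambda>z. snd (P n z)) \<in> borel_measurable ?M" for n by (intro sndm PL)
      show "integrable ?M (\<lambda>z. (norm (snd (P n z)))\<^sup>2)" for n by (intro sndint PL)
      show "(\<lambda>z. snd (G z)) \<in> borel_measurable ?M" by (intro sndm G)
      show "integrable ?M (\<lambda>z. (norm (snd (G z)))\<^sup>2)" by (intro sndint G)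
      show "(\<lambda>n. LINT z|?M. (norm (s n z - h z))\<^sup>2) \<longlonglongrightarrow> 0" by (rule slim)
      show "(\<lambda>n. LINT z|?M. (norm (snd (P n z) - snd (G z)))\<^sup>2) \<longlonglongrightarrow> 0"
      proof (rule tendsto_sandwich[OF _ _ tendsto_const Glim])
        show "\<forall>\<^sub>F n in sequentially. (LINT z|?M. (norm (snd (P n z) - snd (G z)))\<^sup>2) \<le> (LINT z|?M. (norm (P n z - G z))\<^sup>2)"
        proof (intro always_eventually allI integral_mono)
          fix n
          have d: "(\<lambda>z. P n z - G z) \<in> borel_measurable ?M" "integrable ?M (\<lambda>z. (norm (P n z - G z))\<^sup>2)"
            using PL[of n] G by (auto intro!: square_integrable_diff)
          show "integrable ?M (\<lambda>z. (norm (P n z - G z))\<^sup>2)" by (rule d)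
          show "integrable ?M (\<lambda>z. (norm (snd (P n z) - snd (G z)))\<^sup>2)" using sndint[OF d] by simp
          show "(norm (snd (P n z) - snd (G z)))\<^sup>2 \<le> (norm (P n z - G z))\<^sup>2" for z
            using snd_le[of "P n z - G z"] by (intro power_mono) auto
        qed
      qed auto
      fix n x
      have s1: "(\<lambda>y. s n (x, y)) = (\<lambda>y. \<Sum>p\<in>S n. (cc p * E (fst p) x) * F (snd p) y)"
        by (simp add: s_def tensor_def mult_ac)
      have s2: "(\<lambda>y. snd (P n (x, y))) = (\<lambda>y. \<Sum>p\<in>S n. (cc p * E (fst p) x) *\<^sub>R wgrad \<Omega>2 (F (snd p)) y)"
        by (simp add: P_def snd_sum basis_tensor_gradient_def tensor_gradient_def)
      show "(\<lambda>y. s n (x, y)) \<in> L2 (vol \<Omega>2) \<and> has_weak_gradient \<Omega>2 (\<lambda>y. s n (x, y)) (\<lambda>y. snd (P n (x, y)))"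
        unfolding s1 s2 by (intro conjI l2.sum_mem weak_gradient_sum \<Omega> H1_L2 has_weak_gradient_wgrad FH)
    qed
    fix j and g assume gL: "g \<in> L2 (vol \<Omega>2)"
    define K where "K z = (g (snd z) *\<^sub>R wgrad \<Omega>1 (e j) (fst z), 0 :: 'b)" for z
    have Keq: "K = tensor_gradient (\<lambda>x. 0) (wgrad \<Omega>1 (e j)) g (\<lambda>y. 0)"
      by (auto simp: K_def tensor_gradient_def)
    have K: "K \<in> borel_measurable ?M" "integrable ?M (\<lambda>z. (norm (K z))\<^sup>2)"
      unfolding Keq vt
      by (intro tensor_gradient_square_integrable l2.zero_mem wgrad_measurable wgrad_square_integrable eH gL; simp)+
    have egL: "e j \<otimes>\<^sub>f g \<in> L2 ?M" unfolding vt by (intro tensor_L2 H1_L2 eH gL)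
    have Wint: "integrable ?M (\<lambda>z. ?W p z \<bullet> K z)" for p by (intro integrable_inner_square W K)
    have WK: "(LINT z|?M. ?W p z \<bullet> K z) = l j * l2_ip ?M (?T p) (e j \<otimes>\<^sub>f g)" for p
    proof -
      have i1: "integrable (vol \<Omega>1) (\<lambda>x. wgrad \<Omega>1 (E (fst p)) x \<bullet> wgrad \<Omega>1 (e j) x)"
        by (intro integrable_inner_square wgrad_measurable wgrad_square_integrable EH eH)
      have i2: "integrable (vol \<Omega>2) (\<lambda>y. F (snd p) y * g y)" by (intro L2_mult_integrable H1_L2 FH gL)
      have "(LINT z|?M. ?W p z \<bullet> K z) = (LINT z|?M. (wgrad \<Omega>1 (E (fst p)) (fst z) \<bullet> wgrad \<Omega>1 (e j) (fst z)) * (F (snd p) (snd z) * g (snd z)))"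
        by (simp add: K_def basis_tensor_gradient_def tensor_gradient_def inner_prod_def mult_ac)
      also have "\<dots> = grad_ip \<Omega>1 (E (fst p)) (e j) * l2_ip (vol \<Omega>2) (F (snd p)) g"
        unfolding vt by (simp add: integral_tensor[OF i1 i2] grad_ip_def l2_ip_def)
      also have "grad_ip \<Omega>1 (E (fst p)) (e j) = l j * l2_ip (vol \<Omega>1) (E (fst p)) (e j)"
        using g.sym[OF EH eH] l2.sym[OF H1_L2[OF EH] H1_L2[OF eH]] eig[OF E0] by simp
      finally show ?thesis
        unfolding vt by (simp add: l2_ip_tensor H1_L2 EH FH eH gL)
    qed
    have "(LINT z|?M. P n z \<bullet> K z) = l j * l2_ip ?M (s n) (e j \<otimes>\<^sub>f g)" for n
    proof -
      have "(LINT z|?M. P n z \<bullet> K z) = (\<Sum>p\<in>S n. cc p * (LINT z|?M. ?W p z \<bullet> K z))"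
        unfolding P_def inner_sum_left inner_scaleR_left using Wint by (simp add: Bochner_Integration.integral_sum)
      also have "\<dots> = l j * (\<Sum>p\<in>S n. cc p * l2_ip ?M (?T p) (e j \<otimes>\<^sub>f g))"
        by (simp add: WK sum_distrib_left mult_ac)
      also have "(\<Sum>p\<in>S n. cc p * l2_ip ?M (?T p) (e j \<otimes>\<^sub>f g)) = l2_ip ?M (s n) (e j \<otimes>\<^sub>f g)"
        unfolding s_def by (rule l2.sum_left[symmetric]) (intro W egL)+
      finally show ?thesis .
    qed
    moreover have "(\<lambda>n. LINT z|?M. P n z \<bullet> K z) \<longlonglongrightarrow> (LINT z|?M. G z \<bullet> K z)"
      by (rule tendsto_integral_inner[OF PL(1) G(1) K(1) PL(2) G(2) K(2) Glim])
    moreover have "(\<lambda>n. l j * l2_ip ?M (s n) (e j \<otimes>\<^sub>f g)) \<longlonglongrightarrow> l j * l2_ip ?M h (e j \<otimes>\<^sub>f g)"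
      using slim by (intro tendsto_mult tendsto_const l2.tendsto_ip_left sL hL egL) (simp add: l2_ip_diff_self)
    ultimately have "(LINT z|?M. G z \<bullet> K z) = l j * l2_ip ?M h (e j \<otimes>\<^sub>f g)"
      using LIMSEQ_unique by simp
    then show "(LINT z|?M. G z \<bullet> (g (snd z) *\<^sub>R wgrad \<Omega>1 (e j) (fst z), 0)) = l j * l2_ip ?M h (e j \<otimes>\<^sub>f g)"
      by (simp add: K_def)
  qed
qed

section \<open>The boundary term and the eigenfunctions\<close>
text \<open>An integrand that is known only up to a null set becomes measurable by completing the measure.\<close>

lemma integral_lebesgue_on_eq_vol:
  fixes F1 F2 :: "'a::euclidean_space \<Rightarrow> real"
  assumes \<Omega>: "\<Omega> \<in> sets borel" and F2: "F2 \<in> borel_measurable (vol \<Omega>)"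
    and eq: "AE x in vol \<Omega>. F1 x = F2 x"
  shows "(LINT x|lebesgue_on \<Omega>. F1 x) = (LINT x|vol \<Omega>. F2 x)"
proof -
  have m2: "(\<lambda>x. indicator \<Omega> x *\<^sub>R F2 x) \<in> borel_measurable lborel"
    using F2 \<Omega> by (subst (asm) borel_measurable_restrict_space_iff) auto
  have "AE x in lborel. indicator \<Omega> x *\<^sub>R F1 x = indicator \<Omega> x *\<^sub>R F2 x"
    using eq \<Omega> by (simp add: AE_restrict_space_iff indicator_def)
  then have ae: "AE x in lebesgue. indicator \<Omega> x *\<^sub>R F1 x = indicator \<Omega> x *\<^sub>R F2 x"
    by (rule AE_completion)
  have l2: "(\<lambda>x. indicator \<Omega> x *\<^sub>R F2 x) \<in> borel_measurable lebesgue"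
    using m2 by (rule measurable_completion)
  have "AE x in lebesgue. indicator \<Omega> x *\<^sub>R F2 x = indicator \<Omega> x *\<^sub>R F1 x"
    using ae by eventually_elim (rule sym)
  then have l1: "(\<lambda>x. indicator \<Omega> x *\<^sub>R F1 x) \<in> borel_measurable lebesgue"
    by (rule borel_measurable_AE[OF l2])
  have "(LINT x|lebesgue_on \<Omega>. F1 x) = (LINT x|lebesgue. indicator \<Omega> x *\<^sub>R F1 x)"
    using \<Omega> by (intro integral_restrict_space) auto
  also have "\<dots> = (LINT x|lebesgue. indicator \<Omega> x *\<^sub>R F2 x)"
    by (rule integral_cong_AE[OF l1 l2 ae])
  also have "\<dots> = (LINT x|lborel. indicator \<Omega> x *\<^sub>R F2 x)"
    by (rule integral_completion[OF m2])
  also have "\<dots> = (LINT x|vol \<Omega>. F2 x)"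
    using \<Omega> by (intro integral_restrict_space[symmetric]) auto
  finally show ?thesis .
qed

text \<open>Homogeneity of the trace is the only property, besides its existence and uniqueness, that
  the boundary term calls for.\<close>

lemma has_trace_scale:
  assumes \<Omega>: "open \<Omega>" and t: "has_trace \<Omega> u t"
  shows "has_trace \<Omega> (\<lambda>x. c * u x) (\<lambda>x. c * t x)"
proof -
  interpret h: semi_inner_space "H1 \<Omega>" "h1_ip \<Omega>" using \<Omega> by (rule h1_semi_inner_space)
  from t obtain \<phi> where u: "u \<in> H1 \<Omega>" and tL: "t \<in> L2 (surf \<Omega>)"
    and \<phi>: "\<And>n. \<phi> n \<in> H1 \<Omega>" "\<And>n. \<phi> n \<in> L2 (surf \<Omega>)" "\<And>n. \<exists>L. L-lipschitz_on (closure \<Omega>) (\<phi> n)"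
    and lim: "ip_tendsto (h1_ip \<Omega>) \<phi> u" "ip_tendsto (l2_ip (surf \<Omega>)) \<phi> t"
    unfolding has_trace_def by blast
  show ?thesis
    unfolding has_trace_def
  proof (intro conjI exI[of _ "\<lambda>n x. c * \<phi> n x"] allI h.scale_mem l2.scale_mem u tL \<phi>)
    show "\<exists>L. L-lipschitz_on (closure \<Omega>) (\<lambda>x. c * \<phi> n x)" for n
    proof -
      obtain L where "L-lipschitz_on (closure \<Omega>) (\<phi> n)" using \<phi>(3) by blast
      then have "(\<bar>c\<bar> * L)-lipschitz_on (closure \<Omega>) (\<lambda>x. c * \<phi> n x)" by (rule lipschitz_on_cmult_real)
      then show ?thesis by blast
    qed
    have 1: "h1_ip \<Omega> (\<lambda>x. c * \<phi> n x - c * u x) (\<lambda>x. c * \<phi> n x - c * u x) = c * (c * h1_ip \<Omega> (\<lambda>x. \<phi> n x - u x) (\<lambda>x. \<phi> n x - u x))" for n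
    proof -
      note d = h.diff_mem[OF \<phi>(1)[of n] u]
      show ?thesis unfolding right_diff_distrib[symmetric] h.scale_left[OF d h.scale_mem[OF d]] h.scale_right[OF d d] ..
    qed
    show "ip_tendsto (h1_ip \<Omega>) (\<lambda>n x. c * \<phi> n x) (\<lambda>x. c * u x)"
      using lim(1) unfolding ip_tendsto_def 1 by (intro tendsto_mult_right_zero)
    have 2: "l2_ip (surf \<Omega>) (\<lambda>x. c * \<phi> n x - c * t x) (\<lambda>x. c * \<phi> n x - c * t x) = c * (c * l2_ip (surf \<Omega>) (\<lambda>x. \<phi> n x - t x) (\<lambda>x. \<phi> n x - t x))" for n
    proof -
      note d = l2.diff_mem[OF \<phi>(2)[of n] tL]
      show ?thesis unfolding right_diff_distrib[symmetric] l2.scale_left[OF d l2.scale_mem[OF d]] l2.scale_right[OF d d] ..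
    qed
    show "ip_tendsto (l2_ip (surf \<Omega>)) (\<lambda>n x. c * \<phi> n x) (\<lambda>x. c * t x)"
      using lim(2) unfolding ip_tendsto_def 2 by (intro tendsto_mult_right_zero)
  qed
qed

lemma has_trace_bdry_trace: "compact_trace \<Omega> \<Longrightarrow> u \<in> H1 \<Omega> \<Longrightarrow> has_trace \<Omega> u (bdry_trace \<Omega> u)"
  unfolding bdry_trace_def compact_trace_def by (blast intro: someI[of "has_trace \<Omega> u"])

lemma bdry_trace_measurable: "compact_trace \<Omega> \<Longrightarrow> u \<in> H1 \<Omega> \<Longrightarrow> bdry_trace \<Omega> u \<in> borel_measurable (surf \<Omega>)"
  using has_trace_bdry_trace[of \<Omega> u] by (simp add: has_trace_def L2_def)

text \<open>This eliminates the traces: the boundary integral of a multiple of \<open>u\<close> is a difference of two forms, and the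
  first of them is known when \<open>u\<close> is a Robin eigenfunction.\<close>

lemma boundary_integral_scale:
  assumes \<Omega>: "open \<Omega>" "compact_trace \<Omega>" and b: "b \<in> borel_measurable (surf \<Omega>)"
    and u: "u \<in> H1 \<Omega>" and v: "v \<in> H1 \<Omega>"
  shows "(LINT y|surf \<Omega>. b y * bdry_trace \<Omega> (\<lambda>y. c * u y) y * bdry_trace \<Omega> v y) = c * (robin_ip \<Omega> b u v - grad_ip \<Omega> u v)"
proof -
  interpret g: semi_inner_space "H1 \<Omega>" "grad_ip \<Omega>" using \<Omega>(1) by (rule grad_semi_inner_space)
  have cu: "(\<lambda>y. c * u y) \<in> H1 \<Omega>" by (rule g.scale_mem[OF u])
  note m = b bdry_trace_measurable[OF \<Omega>(2) cu] bdry_trace_measurable[OF \<Omega>(2) u] bdry_trace_measurable[OF \<Omega>(2) v]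
  have "AE y in surf \<Omega>. bdry_trace \<Omega> (\<lambda>y. c * u y) y = c * bdry_trace \<Omega> u y"
    using has_trace_bdry_trace[OF \<Omega>(2) cu] has_trace_scale[OF \<Omega>(1) has_trace_bdry_trace[OF \<Omega>(2) u]] \<Omega>(2)
    unfolding compact_trace_def by blast
  then have "AE y in surf \<Omega>. b y * bdry_trace \<Omega> (\<lambda>y. c * u y) y * bdry_trace \<Omega> v y = c * (b y * bdry_trace \<Omega> u y * bdry_trace \<Omega> v y)"
    by eventually_elim simp
  then have "(LINT y|surf \<Omega>. b y * bdry_trace \<Omega> (\<lambda>y. c * u y) y * bdry_trace \<Omega> v y)
     = (LINT y|surf \<Omega>. c * (b y * bdry_trace \<Omega> u y * bdry_trace \<Omega> v y))"
    by (intro integral_cong_AE borel_measurable_times borel_measurable_const m)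
  then show ?thesis by (simp add: robin_ip_def)
qed

text \<open>In a basis of \<open>H^1(\<Omega>2)\<close> that contains the normalised \<open>g k\<close>, the function \<open>e j \<otimes> g k\<close> is a multiple of a
  single basis tensor.\<close>

lemma tensor_mem_V_space:
  fixes \<Omega>1 :: "'a::euclidean_space set" and \<Omega>2 :: "'b::euclidean_space set"
  assumes \<Omega>: "open \<Omega>1" "open \<Omega>2" "compact_imbedding \<Omega>2"
    and E: "orthonormal_basis (H10 \<Omega>1) (grad_ip \<Omega>1) (\<lambda>j x. e j x / sqrt (l j))"
    and l: "\<And>j. l j > 0" and e: "e j \<in> L2 (vol \<Omega>1)"
    and g: "\<And>k::nat. g k \<in> H1 \<Omega>2" "\<And>i k. i \<noteq> k \<Longrightarrow> l2_ip (vol \<Omega>2) (g i) (g k) = 0" "\<And>k. l2_ip (vol \<Omega>2) (g k) (g k) \<noteq> 0"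
  shows "e j \<otimes>\<^sub>f g k \<in> V_space \<Omega>1 \<Omega>2"
proof -
  interpret pair_sigma_finite "vol \<Omega>1" "vol \<Omega>2" using \<Omega> by (intro pair_sigma_finite_vol) auto
  interpret h: semi_inner_space "H1 \<Omega>2" "h1_ip \<Omega>2" using \<Omega>(2) by (rule h1_semi_inner_space)
  have vt: "vol (\<Omega>1 \<times> \<Omega>2) = vol \<Omega>1 \<Otimes>\<^sub>M vol \<Omega>2" using \<Omega> by (intro vol_times) auto
  define \<nu> where "\<nu> = sqrt (h1_ip \<Omega>2 (g k) (g k))"
  have "h1_ip \<Omega>2 (g k) (g k) > 0"
    using l2_le_h1[of \<Omega>2 "g k"] l2.nonneg[OF H1_L2[OF g(1)], of k] g(3)[of k] by linarith
  then have \<nu>: "\<nu> > 0" "\<nu> * \<nu> = h1_ip \<Omega>2 (g k) (g k)" by (auto simp: \<nu>_def)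
  define u0 where "u0 y = (1 / \<nu>) * g k y" for y
  have u0: "u0 \<in> H1 \<Omega>2" "h1_ip \<Omega>2 u0 u0 = 1"
  proof -
    show "u0 \<in> H1 \<Omega>2" unfolding u0_def by (rule h.scale_mem[OF g(1)])
    have "h1_ip \<Omega>2 u0 u0 = (1 / \<nu>) * ((1 / \<nu>) * (\<nu> * \<nu>))"
      unfolding u0_def h.scale_left[OF g(1) h.scale_mem[OF g(1)]] h.scale_right[OF g(1) g(1)] \<nu>(2) ..
    then show "h1_ip \<Omega>2 u0 u0 = 1" using \<nu>(1) by simp
  qed
  obtain f m where f: "orthonormal_basis (H1 \<Omega>2) (h1_ip \<Omega>2) f" and fm: "f m = u0"
    by (rule H1_orthonormal_basis_exists[OF \<Omega>(2,3) g u0])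
  \<comment> \<open>The coefficient undoes both normalisations.\<close>
  define c where "c i n = (if i = j \<and> n = m then sqrt (l j) * \<nu> else 0)" for i n
  have uL: "e j \<otimes>\<^sub>f g k \<in> L2 (vol (\<Omega>1 \<times> \<Omega>2))" unfolding vt by (intro tensor_L2 H1_L2 e g)
  have "\<forall>\<^sub>F n in sequentially. l2_ip (vol (\<Omega>1 \<times> \<Omega>2))
      (\<lambda>z. (\<Sum>i<n. \<Sum>p<n. c i p * ((\<lambda>x. e i x / sqrt (l i)) \<otimes>\<^sub>f f p) z) - (e j \<otimes>\<^sub>f g k) z)
      (\<lambda>z. (\<Sum>i<n. \<Sum>p<n. c i p * ((\<lambda>x. e i x / sqrt (l i)) \<otimes>\<^sub>f f p) z) - (e j \<otimes>\<^sub>f g k) z) = 0"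
    using eventually_gt_at_top[of "max j m"]
  proof eventually_elim
    case (elim n)
    have "(\<Sum>i<n. \<Sum>p<n. c i p * ((\<lambda>x. e i x / sqrt (l i)) \<otimes>\<^sub>f f p) z) = (e j \<otimes>\<^sub>f g k) z" for z
    proof -
      have "(\<Sum>i<n. \<Sum>p<n. c i p * ((\<lambda>x. e i x / sqrt (l i)) \<otimes>\<^sub>f f p) z) =
        (\<Sum>i<n. if i = j then (\<Sum>p<n. if p = m then sqrt (l j) * \<nu> * ((\<lambda>x. e j x / sqrt (l j)) \<otimes>\<^sub>f f m) z else 0) else 0)"
        by (intro sum.cong refl) (use elim in \<open>auto simp: c_def mult_delta_left\<close>)
      also have "\<dots> = sqrt (l j) * \<nu> * ((\<lambda>x. e j x / sqrt (l j)) \<otimes>\<^sub>f f m) z" using elim by simp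
      also have "\<dots> = (e j \<otimes>\<^sub>f g k) z"
        using \<nu>(1) l[of j] by (simp add: fm u0_def tensor_def case_prod_unfold)
      finally show ?thesis .
    qed
    then show ?case by (simp add: l2_ip_def)
  qed
  then have "ip_tendsto (l2_ip (vol (\<Omega>1 \<times> \<Omega>2))) (\<lambda>n z. \<Sum>i<n. \<Sum>p<n. c i p * ((\<lambda>x. e i x / sqrt (l i)) \<otimes>\<^sub>f f p) z) (e j \<otimes>\<^sub>f g k)"
    unfolding ip_tendsto_def by (rule tendsto_eventually)
  moreover have "(\<lambda>(i, n). (c i n)\<^sup>2) summable_on UNIV"
    by (rule finite_nonzero_values_imp_summable_on, rule finite_subset[of _ "{(j, m)}"]) (auto simp: c_def split: if_splits)
  ultimately show ?thesis
    unfolding V_space_def hilbert_tensor_def using uL E f by blast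
qed

text \<open>The weak eigenvalue equation. With \<open>G = (G_x, G_y)\<close> the weak gradient of \<open>h\<close>, the volume integral is
  \<open>\<integral> g \<nabla>e \<bullet> G_x + \<integral> e \<nabla>g \<bullet> G_y\<close>, whose first part is \<open>l j\<close> times the \<open>L^2\<close> product. For almost every \<open>x\<close>, testing the
  Robin equation for \<open>g\<close> with the slice of \<open>h\<close> at \<open>x\<close> evaluates the inner boundary integral as
  \<open>e(x) (\<mu> \<integral> g h - \<integral> \<nabla>g \<bullet> G_y)\<close>. Integration over \<open>x\<close> produces \<open>\<mu>\<close> times the \<open>L^2\<close> product and cancels the
  second part of the volume integral.\<close>

lemma DRL_ip_tensor:
  fixes \<Omega>1 :: "'a::euclidean_space set" and \<Omega>2 :: "'b::euclidean_space set"
  assumes \<Omega>: "open \<Omega>1" "open \<Omega>2" "compact_trace \<Omega>2" and b: "b \<in> borel_measurable (surf \<Omega>2)"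
    and D: "dirichlet_eigendata \<Omega>1 l e"
    and g: "eigenpair (vol \<Omega>2) (H1 \<Omega>2) (robin_ip \<Omega>2 b) \<mu> g"
    and h: "h \<in> V_space \<Omega>1 \<Omega>2"
  shows "DRL_ip \<Omega>1 \<Omega>2 b (e j \<otimes>\<^sub>f g) h = (l j + \<mu>) * l2_ip (vol (\<Omega>1 \<times> \<Omega>2)) (e j \<otimes>\<^sub>f g) h"
proof -
  interpret pair_sigma_finite "vol \<Omega>1" "vol \<Omega>2" using \<Omega> by (intro pair_sigma_finite_vol) auto
  let ?M = "vol (\<Omega>1 \<times> \<Omega>2)"
  have vt: "?M = vol \<Omega>1 \<Otimes>\<^sub>M vol \<Omega>2" using \<Omega> by (intro vol_times) auto
  have \<Omega>12: "open (\<Omega>1 \<times> \<Omega>2)" using \<Omega>(1,2) by (rule open_Times)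
  have eH: "e j \<in> H1 \<Omega>1" using D by (auto simp: dirichlet_eigendata_def eigenpair_def H10_H1)
  have gH: "g \<in> H1 \<Omega>2" and rob: "\<And>v. v \<in> H1 \<Omega>2 \<Longrightarrow> robin_ip \<Omega>2 b g v = \<mu> * l2_ip (vol \<Omega>2) g v"
    using g by (auto simp: eigenpair_def)
  note eL = H1_L2[OF eH] and gL = H1_L2[OF gH]
  obtain G where G: "has_weak_gradient (\<Omega>1 \<times> \<Omega>2) h G"
    and slice: "AE x in vol \<Omega>1. (\<lambda>y. h (x, y)) \<in> L2 (vol \<Omega>2) \<and> has_weak_gradient \<Omega>2 (\<lambda>y. h (x, y)) (\<lambda>y. snd (G (x, y)))"
    and Gx: "\<And>j g. g \<in> L2 (vol \<Omega>2) \<Longrightarrow>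
       (LINT z|?M. G z \<bullet> (g (snd z) *\<^sub>R wgrad \<Omega>1 (e j) (fst z), 0)) = l j * l2_ip ?M h (e j \<otimes>\<^sub>f g)"
    using V_space_gradient[OF \<Omega>(1,2) D h] by blast
  have hL: "h \<in> L2 ?M" using h by (simp add: V_space_def hilbert_tensor_def)
  have uL: "e j \<otimes>\<^sub>f g \<in> L2 ?M" unfolding vt by (intro tensor_L2 eL gL)
  note Gm = G[unfolded has_weak_gradient_def, THEN conjunct1] G[unfolded has_weak_gradient_def, THEN conjunct2, THEN conjunct1]
  note we = wgrad_measurable[OF eH] wgrad_square_integrable[OF eH]
  note wg = wgrad_measurable[OF gH] wgrad_square_integrable[OF gH]
  define K where "K z = (g (snd z) *\<^sub>R wgrad \<Omega>1 (e j) (fst z), 0 :: 'b)" for z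
  define J where "J z = (0 :: 'a, e j (fst z) *\<^sub>R wgrad \<Omega>2 g (snd z))" for z
  have KJ: "K = tensor_gradient (\<lambda>x. 0) (wgrad \<Omega>1 (e j)) g (\<lambda>y. 0)"
    "J = tensor_gradient (e j) (\<lambda>x. 0) (\<lambda>y. 0) (wgrad \<Omega>2 g)"
    by (auto simp: K_def J_def tensor_gradient_def)
  have K: "K \<in> borel_measurable ?M" "integrable ?M (\<lambda>z. (norm (K z))\<^sup>2)"
    unfolding KJ vt by (intro tensor_gradient_square_integrable l2.zero_mem we gL; simp)+
  have J: "J \<in> borel_measurable ?M" "integrable ?M (\<lambda>z. (norm (J z))\<^sup>2)"
    unfolding KJ vt by (intro tensor_gradient_square_integrable l2.zero_mem wg eL; simp)+
  have GK: "integrable ?M (\<lambda>z. G z \<bullet> K z)" and GJ: "integrable ?M (\<lambda>z. G z \<bullet> J z)"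
    by (intro integrable_inner_square Gm K J)+
  have uh: "integrable ?M (\<lambda>z. (e j \<otimes>\<^sub>f g) z * h z)" by (rule L2_mult_integrable[OF uL hL])
  have "grad_ip (\<Omega>1 \<times> \<Omega>2) (e j \<otimes>\<^sub>f g) h
      = (LINT z|?M. tensor_gradient (e j) (wgrad \<Omega>1 (e j)) g (wgrad \<Omega>2 g) z \<bullet> G z)"
    by (intro grad_ip_eq \<Omega>12 weak_gradient_tensor \<Omega> eL gL has_weak_gradient_wgrad eH gH G)
  also have "\<dots> = (LINT z|?M. G z \<bullet> K z + G z \<bullet> J z)"
    by (intro Bochner_Integration.integral_cong refl)
      (simp add: tensor_gradient_def K_def J_def inner_prod_def inner_commute)
  also have "\<dots> = (LINT z|?M. G z \<bullet> K z) + (LINT z|?M. G z \<bullet> J z)"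
    using GK GJ by (rule Bochner_Integration.integral_add)
  also have "(LINT z|?M. G z \<bullet> K z) = l j * l2_ip ?M (e j \<otimes>\<^sub>f g) h"
    using Gx[OF gL, of j] l2.sym[OF hL uL] by (simp add: K_def)
  finally have grad: "grad_ip (\<Omega>1 \<times> \<Omega>2) (e j \<otimes>\<^sub>f g) h = l j * l2_ip ?M (e j \<otimes>\<^sub>f g) h + (LINT z|?M. G z \<bullet> J z)" .
  define \<Phi> where "\<Phi> z = \<mu> * ((e j \<otimes>\<^sub>f g) z * h z) - G z \<bullet> J z" for z
  have \<Phi>: "integrable (vol \<Omega>1 \<Otimes>\<^sub>M vol \<Omega>2) \<Phi>"
    unfolding \<Phi>_def vt[symmetric] using uh GJ by simp
  have bdry: "AE x in vol \<Omega>1. (LINT y|surf \<Omega>2. b y * bdry_trace \<Omega>2 (\<lambda>y. (e j \<otimes>\<^sub>f g) (x, y)) y * bdry_trace \<Omega>2 (\<lambda>y. h (x, y)) y)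
      = (LINT y|vol \<Omega>2. \<Phi> (x, y))"
    using slice
  proof eventually_elim
    case (elim x)
    then have hxL: "(\<lambda>y. h (x, y)) \<in> L2 (vol \<Omega>2)" and hxG: "has_weak_gradient \<Omega>2 (\<lambda>y. h (x, y)) (\<lambda>y. snd (G (x, y)))"
      by auto
    have hxH: "(\<lambda>y. h (x, y)) \<in> H1 \<Omega>2" by (rule H1_I[OF hxL hxG])
    have i1: "integrable (vol \<Omega>2) (\<lambda>y. g y * h (x, y))" by (rule L2_mult_integrable[OF gL hxL])
    have i2: "integrable (vol \<Omega>2) (\<lambda>y. wgrad \<Omega>2 g y \<bullet> snd (G (x, y)))"
      using hxG by (intro integrable_inner_square wg) (auto simp: has_weak_gradient_def)
    have "(LINT y|surf \<Omega>2. b y * bdry_trace \<Omega>2 (\<lambda>y. (e j \<otimes>\<^sub>f g) (x, y)) y * bdry_trace \<Omega>2 (\<lambda>y. h (x, y)) y)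
       = e j x * (robin_ip \<Omega>2 b g (\<lambda>y. h (x, y)) - grad_ip \<Omega>2 g (\<lambda>y. h (x, y)))"
      using boundary_integral_scale[OF \<Omega>(2,3) b gH hxH, of "e j x"] by (simp add: tensor_def)
    also have "\<dots> = e j x * (\<mu> * (LINT y|vol \<Omega>2. g y * h (x, y)) - (LINT y|vol \<Omega>2. wgrad \<Omega>2 g y \<bullet> snd (G (x, y))))"
      using rob[OF hxH] grad_ip_eq[OF \<Omega>(2) has_weak_gradient_wgrad[OF gH] hxG] by (simp add: l2_ip_def)
    also have "\<dots> = (LINT y|vol \<Omega>2. \<mu> * (e j x * (g y * h (x, y))) - e j x * (wgrad \<Omega>2 g y \<bullet> snd (G (x, y))))"
      using i1 i2 by (simp add: right_diff_distrib)
    also have "\<dots> = (LINT y|vol \<Omega>2. \<Phi> (x, y))"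
      by (intro Bochner_Integration.integral_cong refl)
        (simp add: \<Phi>_def J_def tensor_def inner_prod_def inner_commute)
    finally show ?case .
  qed
  have "(LINT x|lebesgue_on \<Omega>1. LINT y|surf \<Omega>2. b y * bdry_trace \<Omega>2 (\<lambda>y. (e j \<otimes>\<^sub>f g) (x, y)) y * bdry_trace \<Omega>2 (\<lambda>y. h (x, y)) y)
      = (LINT x|vol \<Omega>1. LINT y|vol \<Omega>2. \<Phi> (x, y))"
    using \<Omega>(1) borel_measurable_integrable[OF integrable_fst'[OF \<Phi>]]
    by (intro integral_lebesgue_on_eq_vol bdry) auto
  also have "\<dots> = (LINT z|?M. \<Phi> z)" unfolding vt by (rule integral_fst'[OF \<Phi>])
  also have "\<dots> = \<mu> * l2_ip ?M (e j \<otimes>\<^sub>f g) h - (LINT z|?M. G z \<bullet> J z)"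
    unfolding \<Phi>_def using uh GJ by (simp add: l2_ip_def)
  finally show ?thesis unfolding DRL_ip_def grad by (simp add: distrib_right)
qed

theorem theorem9p1:
  fixes \<Omega>1 :: "'a::euclidean_space set" and \<Omega>2 :: "'b::euclidean_space set"
    and b2 :: "'b \<Rightarrow> real"
    and l1 l2 :: "nat \<Rightarrow> real"
    and e1 :: "nat \<Rightarrow> 'a \<Rightarrow> real" and g2 :: "nat \<Rightarrow> 'b \<Rightarrow> real"
  assumes "region \<Omega>1" and "cond_B1 \<Omega>1" and "cond_B2 \<Omega>1"
    and "region \<Omega>2" and "cond_B1 \<Omega>2" and "cond_B2 \<Omega>2"
    and "cond_B3 \<Omega>2 b2"
    and "dirichlet_eigendata \<Omega>1 l1 e1"
    and "robin_eigendata \<Omega>2 b2 l2 g2"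
  shows "(\<forall>j k. DRL_eigenpair \<Omega>1 \<Omega>2 b2 (l1 j + l2 k) (e1 j \<otimes>\<^sub>f g2 k)) \<and>
    orthogonal_family (V_space \<Omega>1 \<Omega>2) (DRL_ip \<Omega>1 \<Omega>2 b2) (\<lambda>(j, k). e1 j \<otimes>\<^sub>f g2 k) \<and>
    orthogonal_family (L2 (vol (\<Omega>1 \<times> \<Omega>2))) (l2_ip (vol (\<Omega>1 \<times> \<Omega>2))) (\<lambda>(j, k). e1 j \<otimes>\<^sub>f g2 k)"
proof -
  have \<Omega>: "open \<Omega>1" "open \<Omega>2" "compact_imbedding \<Omega>2" "compact_trace \<Omega>2"
    and b: "b2 \<in> borel_measurable (surf \<Omega>2)"
    using assms by (auto simp: region_def cond_B2_def cond_B3_def)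
  interpret pair_sigma_finite "vol \<Omega>1" "vol \<Omega>2" using \<Omega> by (intro pair_sigma_finite_vol) auto
  let ?M = "vol (\<Omega>1 \<times> \<Omega>2)"
  have vt: "?M = vol \<Omega>1 \<Otimes>\<^sub>M vol \<Omega>2" using \<Omega> by (intro vol_times) auto
  have e: "\<And>j. l1 j > 0" "\<And>j. e1 j \<in> L2 (vol \<Omega>1)"
    "\<And>i j. l2_ip (vol \<Omega>1) (e1 i) (e1 j) = (if i = j then 1 else 0)"
    "orthonormal_basis (H10 \<Omega>1) (grad_ip \<Omega>1) (\<lambda>j x. e1 j x / sqrt (l1 j))"
    using assms(8) unfolding dirichlet_eigendata_def orthonormal_basis_def orthonormal_family_def by blast+
  have g: "\<And>k. l2 k > 0" "\<And>k. eigenpair (vol \<Omega>2) (H1 \<Omega>2) (robin_ip \<Omega>2 b2) (l2 k) (g2 k)"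
    "\<And>i k. robin_ip \<Omega>2 b2 (g2 i) (g2 k) = (if i = k then 1 else 0)"
    using assms(9) unfolding robin_eigendata_def orthonormal_family_def by blast+
  have gH: "g2 k \<in> H1 \<Omega>2" for k using g(2) by (simp add: eigenpair_def)
  \<comment> \<open>Orthonormality in the Robin form rescales to \<open>L^2\<close> by the eigenvalue equation.\<close>
  have gg: "l2_ip (vol \<Omega>2) (g2 i) (g2 k) = (if i = k then 1 / l2 k else 0)" for i k
  proof -
    have "robin_ip \<Omega>2 b2 (g2 i) (g2 k) = l2 i * l2_ip (vol \<Omega>2) (g2 i) (g2 k)"
      using g(2)[of i] gH[of k] by (simp add: eigenpair_def)
    then show ?thesis using g(3)[of i k] g(1)[of i] by (simp add: field_simps split: if_splits)
  qed
  have V: "e1 j \<otimes>\<^sub>f g2 k \<in> V_space \<Omega>1 \<Omega>2" for j k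
    using g(1) by (intro tensor_mem_V_space[OF \<Omega>(1-3) e(4) e(1,2) gH]) (auto simp: gg less_imp_neq[symmetric])
  have L: "e1 j \<otimes>\<^sub>f g2 k \<in> L2 ?M" for j k unfolding vt by (intro tensor_L2 e H1_L2 gH)
  have ip: "l2_ip ?M (e1 i \<otimes>\<^sub>f g2 m) (e1 j \<otimes>\<^sub>f g2 k) = (if i = j \<and> m = k then 1 / l2 k else 0)" for i j k m
    unfolding vt using l2_ip_tensor[OF e(2) H1_L2[OF gH] e(2) H1_L2[OF gH], of i m j k] by (simp add: e(3) gg)
  have weak: "DRL_ip \<Omega>1 \<Omega>2 b2 (e1 j \<otimes>\<^sub>f g2 k) h = (l1 j + l2 k) * l2_ip ?M (e1 j \<otimes>\<^sub>f g2 k) h"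
    if "h \<in> V_space \<Omega>1 \<Omega>2" for j k h
    by (rule DRL_ip_tensor[OF \<Omega>(1,2,4) b assms(8) g(2) that])
  have nz: "\<not> (AE z in ?M. (e1 j \<otimes>\<^sub>f g2 k) z = 0)" for j k
    using L2_null_iff[OF L, of j k] ip[of j k j k] g(1)[of k] by auto
  show ?thesis
    unfolding DRL_eigenpair_def eigenpair_def orthogonal_family_def
    using V L weak nz ip by auto
qed

end
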